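(* Let $\mathcal{M}\subset\mathcal{M}(\mathbb{C}P^N)$ be a $\mathbb{C}$-invariant closed subset, and let $\mathcal{M}_+:=\overline{\{f\in\mathcal{M}: e(f)>0\}}$. If $\dim(\mathcal{M}:\mathbb{C})$ is positive, then $\mathcal{M}_+$ is an infinite dimensional space (in the sense of topological covering dimension).
   Context: Fubini-Study form and norm: $\omega_{FS}$ is the 2-form on $\mathbb{C}P^N$ given on $\{[1:z_1:\cdots:z_N]\}$ by $\omega_{FS}=\frac{\sqrt{-1}}{2\pi}\partial\bar\partial\log(1+\sum_{i=1}^N|z_i|^2)$. For holomorphic $f:\mathbb{C}\to\mathbb{C}P^N$, with $z=x+y\sqrt{-1}$, define $|df|(z)\ge 0$ by $f^*\omega_{FS}=|df|^2\,dx\,dy$. Brody curves: $\mathcal{M}(\mathbb{C}P^N)$ is the set of holomorphic $f:\mathbb{C}\to\mathbb{C}P^N$ with $|df|(z)\le 1$ for all $z\in\mathbb{C}$, with the compact-open topology; it is compact and metrizable, and $\mathbb{C}$ acts continuously on it by $(a,f(z))\mapsto f(z+a)$. Mean energy: $T(r,f):=\int_1^r\frac{dt}{t}\int_{|z|\le t}|df|^2(z)\,dx\,dy$ for $r\ge1$ and $e(f):=\limsup_{r\to\infty}\frac{2}{\pi r^2}T(r,f)$. The overline denotes closure in the compact-open topology. Mean dimension: for a compact metric space $(M,d)$ and $\varepsilon>0$, $\mathrm{Widim}_\varepsilon(M,d)$ is the minimal $n$ such that there are an $n$-dimensional finite polyhedron $P$ and a continuous map $g:M\to P$ with $\mathrm{Diam}(g^{-1}(p))\le\varepsilon$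 for all $p\in P$. If $\mathbb{C}=\mathbb{R}^2$ acts continuously on $M$ and $\Omega\subset\mathbb{R}^2$ is bounded, put $d_\Omega(x,y):=\sup_{\gamma\in\Omega}d(\gamma.x,\gamma.y)$. Then $\mathrm{Widim}_\varepsilon(M:\mathbb{C}):=\lim_{n\to\infty}\frac1{n^2}\mathrm{Widim}_\varepsilon(M,d_{[0,n)^2})$ and $\dim(M:\mathbb{C}):=\lim_{\varepsilon\downarrow0}\mathrm{Widim}_\varepsilon(M:\mathbb{C})$; this does not depend on the choice of metric compatible with the topology of $M$. Convention: $\dim(\emptyset:\mathbb{C}):=0$. *)

theory Defs
  imports "HOL-Analysis.Analysis"
begin

unbundle no fps_syntax

section \<open>Complex projective space\<close>

text \<open>
  Points are classes of nonzero vectors of homogeneous coordinates, so \<open>'n cp\<close> is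
  $\mathbb{C}P^N$ with \<open>N + 1 = CARD('n)\<close>.
\<close>

definition cp_rel :: "complex ^ 'n::finite \<Rightarrow> complex ^ 'n \<Rightarrow> bool" where
  "cp_rel Z W \<longleftrightarrow> Z \<noteq> 0 \<and> W \<noteq> 0 \<and> (\<exists>c. c \<noteq> 0 \<and> W = c *s Z)"

lemma part_equivp_cp_rel: "part_equivp (cp_rel :: complex ^ 'n::finite \<Rightarrow> _)"
proof (rule part_equivpI)
  show "\<exists>Z :: complex ^ 'n. cp_rel Z Z"
    by (rule exI[of _ "vec 1"], unfold cp_rel_def)
       (auto simp: vec_eq_iff intro!: exI[of _ 1])
  show "symp (cp_rel :: complex ^ 'n \<Rightarrow> _)"
  proof (rule sympI)
    fix Z W :: "complex ^ 'n"
    assume "cp_rel Z W"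
    then obtain c where "Z \<noteq> 0" "W \<noteq> 0" "c \<noteq> 0" "W = c *s Z"
      by (auto simp: cp_rel_def)
    moreover from this have "Z = inverse c *s W" by simp
    ultimately show "cp_rel W Z"
      unfolding cp_rel_def by (metis nonzero_imp_inverse_nonzero)
  qed
  show "transp (cp_rel :: complex ^ 'n \<Rightarrow> _)"
    by (rule transpI) (unfold cp_rel_def, metis mult_eq_0_iff vector_smult_assoc)
qed

quotient_type 'n cp = "complex ^ 'n::finite" / partial: cp_rel
  by (rule part_equivp_cp_rel)

text \<open>
  The topology is the quotient topology; the set of nonzero vectors is open, so it does not
  matter whether the preimage is required to be open in it or in the whole vector space.
\<close>

instantiation cp :: (finite) topological_space
begin

definition open_cp :: "'a cp set \<Rightarrow> bool" where
  "open_cp U \<longleftrightarrow> open {Z. Z \<noteq> 0 \<and> abs_cp Z \<in> U}"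

instance
proof
  have "{Z. Z \<noteq> 0 \<and> abs_cp Z \<in> UNIV} = - {0 :: complex ^ 'a}" by auto
  then show "open (UNIV :: 'a cp set)"
    unfolding open_cp_def by (simp add: open_Compl)
next
  fix S T :: "'a cp set"
  assume "open S" "open T"
  moreover have "{Z. Z \<noteq> 0 \<and> abs_cp Z \<in> S \<inter> T} =
    {Z. Z \<noteq> 0 \<and> abs_cp Z \<in> S} \<inter> {Z. Z \<noteq> 0 \<and> abs_cp Z \<in> T}" by auto
  ultimately show "open (S \<inter> T)"
    unfolding open_cp_def by (simp add: open_Int)
next
  fix K :: "'a cp set set"
  assume "\<forall>S\<in>K. open S"
  moreover have "{Z. Z \<noteq> 0 \<and> abs_cp Z \<in> \<Union>K} = (\<Union>S\<in>K. {Z. Z \<noteq> 0 \<and> abs_cp Z \<in> S})"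
    by auto
  ultimately show "open (\<Union>K)"
    unfolding open_cp_def by auto
qed

end

lift_definition in_chart :: "'n::finite \<Rightarrow> 'n cp \<Rightarrow> bool" is "\<lambda>i Z. Z $ i \<noteq> 0"
  by (auto simp: cp_rel_def)

text \<open>
  The affine coordinates of the \<open>i\<close>-th standard chart are the components with index
  \<open>j \<noteq> i\<close> of \<open>chart_coords i p\<close>; the component with index \<open>i\<close> is the constant 1.
\<close>

lift_definition chart_coords :: "'n::finite \<Rightarrow> 'n cp \<Rightarrow> complex ^ 'n"
  is "\<lambda>i Z. \<chi> j. Z $ j / Z $ i"
  by (auto simp: cp_rel_def vec_eq_iff)

definition holomorphic_curve :: "(complex \<Rightarrow> 'n::finite cp) \<Rightarrow> bool" where
  "holomorphic_curve f \<longleftrightarrow> continuous_on UNIV f \<and>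
     (\<forall>i j. (\<lambda>z. chart_coords i (f z) $ j) holomorphic_on {z. in_chart i (f z)})"

section \<open>The Fubini--Study form\<close>

text \<open>The Wirtinger derivatives $\partial/\partial z_j$ and $\partial/\partial\bar z_j$.\<close>

definition wirtinger :: "'n::finite \<Rightarrow> (complex ^ 'n \<Rightarrow> complex) \<Rightarrow> complex ^ 'n \<Rightarrow> complex" where
  "wirtinger j F w =
     (frechet_derivative F (at w) (axis j 1) - \<i> * frechet_derivative F (at w) (axis j \<i>)) / 2"

definition wirtinger_bar :: "'n::finite \<Rightarrow> (complex ^ 'n \<Rightarrow> complex) \<Rightarrow> complex ^ 'n \<Rightarrow> complex" where
  "wirtinger_bar j F w =
     (frechet_derivative F (at w) (axis j 1) + \<i> * frechet_derivative F (at w) (axis j \<i>)) / 2"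

definition FS_potential :: "'n::finite \<Rightarrow> complex ^ 'n \<Rightarrow> complex" where
  "FS_potential i w = of_real (ln (1 + (\<Sum>j\<in>UNIV - {i}. (cmod (w $ j))\<^sup>2)))"

text \<open>
  The form $\frac{\sqrt{-1}}{2\pi}\partial\bar\partial$ \<open>FS_potential i\<close> in the \<open>i\<close>-th chart, at
  the point with coordinates \<open>w\<close> and evaluated on the tangent vectors \<open>u\<close> and \<open>v\<close>, where
  $(dz_j \wedge d\bar z_k)(u, v) = u_j \bar v_k - v_j \bar u_k$. The potential does not depend on
  the dummy component \<open>w $ i\<close>, so the terms with \<open>j = i\<close> or \<open>k = i\<close> vanish.
\<close>

definition FS_form :: "'n::finite \<Rightarrow> complex ^ 'n \<Rightarrow> complex ^ 'n \<Rightarrow> complex ^ 'n \<Rightarrow> complex" where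
  "FS_form i w u v = \<i> / (2 * of_real pi) *
     (\<Sum>j\<in>UNIV. \<Sum>k\<in>UNIV. wirtinger j (wirtinger_bar k (FS_potential i)) w *
        (u $ j * cnj (v $ k) - v $ j * cnj (u $ k)))"

text \<open>
  The value of the pullback of the Fubini--Study form under \<open>f\<close> at \<open>z\<close> on two tangent vectors.
  The choice of the chart around \<open>f z\<close> is immaterial: on the overlap of two charts the
  potentials differ by the pluriharmonic function $\log |z_i|^2$.
\<close>

definition FS_pullback ::
    "(complex \<Rightarrow> 'n::finite cp) \<Rightarrow> complex \<Rightarrow> complex \<Rightarrow> complex \<Rightarrow> complex" where
  "FS_pullback f z a b =
     (let i = (SOME i. in_chart i (f z));
          F = (\<lambda>\<zeta>. chart_coords i (f \<zeta>));
          D = frechet_derivative F (at z)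
      in FS_form i (F z) (D a) (D b))"

text \<open>
  $f^*\omega_{FS} = |df|^2\,dx\,dy$; the coefficient of $dx\,dy$ is the value on
  $(\partial/\partial x, \partial/\partial y) = (1, \sqrt{-1})$, which is a nonnegative real.
\<close>

definition df_norm :: "(complex \<Rightarrow> 'n::finite cp) \<Rightarrow> complex \<Rightarrow> real" where
  "df_norm f z = sqrt (Re (FS_pullback f z 1 \<i>))"

section \<open>Brody curves and mean energy\<close>

definition brody_curves :: "(complex \<Rightarrow> 'n::finite cp) set" where
  "brody_curves = {f. holomorphic_curve f \<and> (\<forall>z. df_norm f z \<le> 1)}"

definition compact_open_topology ::
    "('a::topological_space \<Rightarrow> 'b::topological_space) topology" where
  "compact_open_topology = topology_generated_by
     {{f. continuous_on UNIV f \<and> f ` K \<subseteq> U} | K U. compact K \<and> open U}"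

definition brody_topology :: "(complex \<Rightarrow> 'n::finite cp) topology" where
  "brody_topology = subtopology compact_open_topology brody_curves"

definition translate :: "complex \<Rightarrow> (complex \<Rightarrow> 'b) \<Rightarrow> complex \<Rightarrow> 'b" where
  "translate a f = (\<lambda>z. f (z + a))"

definition char_function :: "real \<Rightarrow> (complex \<Rightarrow> 'n::finite cp) \<Rightarrow> real" where
  "char_function r f = integral {1..r} (\<lambda>t. 1 / t * integral (cball 0 t) (\<lambda>z. (df_norm f z)\<^sup>2))"

definition mean_energy :: "(complex \<Rightarrow> 'n::finite cp) \<Rightarrow> ereal" where
  "mean_energy f = Limsup at_top (\<lambda>r. ereal (2 / (pi * r\<^sup>2) * char_function r f))"

section \<open>Mean dimension\<close>

text \<open>
  Finite polyhedra are geometric realizations of finite abstract simplicial complexes with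
  vertices in \<open>nat\<close>: up to homeomorphism this gives all of them, in a single type that contains
  polyhedra of every dimension. Complexes do not contain the empty simplex.
\<close>

definition finite_complex :: "nat set set \<Rightarrow> bool" where
  "finite_complex K \<longleftrightarrow> finite K \<and> (\<forall>s\<in>K. finite s \<and> s \<noteq> {} \<and> (\<forall>t. t \<subseteq> s \<and> t \<noteq> {} \<longrightarrow> t \<in> K))"

definition realization :: "nat set set \<Rightarrow> (nat \<Rightarrow> real) set" where
  "realization K = {x. (\<forall>v. 0 \<le> x v) \<and> {v. x v \<noteq> 0} \<in> K \<and> (\<Sum>v | x v \<noteq> 0. x v) = 1}"

definition polyhedron_of_dim :: "nat \<Rightarrow> (nat \<Rightarrow> real) set \<Rightarrow> bool" where
  "polyhedron_of_dim n P \<longleftrightarrow>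
     (\<exists>K. finite_complex K \<and> K \<noteq> {} \<and> Max (card ` K) = n + 1 \<and> P = realization K)"

definition widim :: "real \<Rightarrow> 'a set \<Rightarrow> ('a \<Rightarrow> 'a \<Rightarrow> real) \<Rightarrow> nat" where
  "widim \<epsilon> M d = (LEAST n. \<exists>P g. polyhedron_of_dim n P \<and>
     continuous_map (Metric_space.mtopology M d) (top_of_set P) g \<and>
     (\<forall>p\<in>P. \<forall>x\<in>M. \<forall>y\<in>M. g x = p \<and> g y = p \<longrightarrow> d x y \<le> \<epsilon>))"

text \<open>
  The locale \<open>Metric_space\<close> demands nonnegativity and symmetry off \<open>M\<close> as well, where the
  supremum may be of an unbounded set; hence the value 0 there.
\<close>

definition sup_dist ::
    "(complex \<Rightarrow> 'a \<Rightarrow> 'a) \<Rightarrow> 'a set \<Rightarrow> ('a \<Rightarrow> 'a \<Rightarrow> real) \<Rightarrow> complex set \<Rightarrow> 'a \<Rightarrow> 'a \<Rightarrow> real" where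
  "sup_dist act M d \<Omega> x y =
     (if x \<in> M \<and> y \<in> M then SUP \<gamma>\<in>\<Omega>. d (act \<gamma> x) (act \<gamma> y) else 0)"

definition square :: "nat \<Rightarrow> complex set" where
  "square n = {w. 0 \<le> Re w \<and> Re w < real n \<and> 0 \<le> Im w \<and> Im w < real n}"

definition mean_widim ::
    "(complex \<Rightarrow> 'a \<Rightarrow> 'a) \<Rightarrow> real \<Rightarrow> 'a set \<Rightarrow> ('a \<Rightarrow> 'a \<Rightarrow> real) \<Rightarrow> ereal" where
  "mean_widim act \<epsilon> M d =
     lim (\<lambda>n. ereal (1 / (real n)\<^sup>2 * real (widim \<epsilon> M (sup_dist act M d (square n)))))"

definition mean_dim :: "(complex \<Rightarrow> 'a \<Rightarrow> 'a) \<Rightarrow> 'a set \<Rightarrow> ('a \<Rightarrow> 'a \<Rightarrow> real) \<Rightarrow> ereal" where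
  "mean_dim act M d =
     (if M = {} then 0 else Lim (at_right 0) (\<lambda>\<epsilon>. mean_widim act \<epsilon> M d))"

section \<open>Covering dimension\<close>

definition open_cover :: "'a topology \<Rightarrow> 'a set set \<Rightarrow> bool" where
  "open_cover X \<U> \<longleftrightarrow> (\<forall>U\<in>\<U>. openin X U) \<and> \<Union>\<U> = topspace X"

text \<open>The dimension \<open>dim_le\<close> of the library is the small inductive one.\<close>

definition covering_dim_le :: "'a topology \<Rightarrow> nat \<Rightarrow> bool" where
  "covering_dim_le X n \<longleftrightarrow> (\<forall>\<U>. open_cover X \<U> \<longrightarrow>
     (\<exists>\<V>. open_cover X \<V> \<and> (\<forall>V\<in>\<V>. \<exists>U\<in>\<U>. V \<subseteq> U) \<and>
       (\<forall>x\<in>topspace X. finite {V\<in>\<V>. x \<in> V} \<and> card {V\<in>\<V>. x \<in> V} \<le> n + 1)))"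

definition infinite_covering_dim :: "'a topology \<Rightarrow> bool" where
  "infinite_covering_dim X \<longleftrightarrow> (\<forall>n. \<not> covering_dim_le X n)"

end

theory Submission
  imports Defs "HOL-Complex_Analysis.Great_Picard"
begin

text \<open>
  Suppose that the covering dimension of \<open>M_plus\<close> is at most \<open>n\<close>; then the mean dimension of
  \<open>M\<close> is 0, which contradicts the hypothesis. The point is that mean dimension only sees the part
  of \<open>M\<close> that orbits visit with positive frequency, and that this part consists of \<open>M_plus\<close>
  and the constant curves.

  Frequent visits create energy. Let \<open>A \<subseteq> M\<close> be closed and suppose that arbitrarily large
  squares contain a fixed proportion of translations carrying some curve of \<open>M\<close> into \<open>A\<close>.
  Passing repeatedly to a quarter of the square that is at least as densely visited, and taking a
  limit, one obtains a single \<open>g \<in> A\<close> that visits \<open>A\<close> with positive frequency in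
  \<^emph>\<open>every\<close> large square around the origin (\<open>recurrent_point\<close>). If \<open>A\<close> contains no
  constant curve, then by compactness every curve of \<open>A\<close> has at least a fixed energy on the unit
  square, so that each visit contributes this amount and \<open>g\<close> has positive mean energy
  (\<open>mean_energy_pos\<close>). Thus a closed set disjoint from \<open>M_plus\<close> and from the constants is
  visited with frequency 0, uniformly on \<open>M\<close> (\<open>visits_negligible\<close>).

  It remains to count parameters. Near \<open>M_plus\<close> and the constant curves a curve is determined up to
  \<open>\<epsilon>\<close> on a square of side \<open>l\<close> by at most \<open>m\<close> real parameters, where \<open>m\<close> depends
  neither on \<open>l\<close> nor on \<open>\<epsilon>\<close>: for \<open>M_plus\<close> this is the assumed finite dimension
  (\<open>encodable_of_covering_dim\<close>), and constant curves are given by a point of projective space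
  (\<open>encodable_of_separating\<close>). On the rest of \<open>M\<close> some number \<open>B\<close> of parameters,
  depending on \<open>l\<close> and \<open>\<epsilon>\<close>, suffices by compactness. Cutting the square of side \<open>L\<close>
  into tiles of side \<open>l\<close> and using the additional \<open>B\<close> parameters only on the rarely visited
  tiles, one encodes \<open>M\<close> with about $(m / l^2 + B \delta) L^2$ parameters, where \<open>\<delta>\<close> is the
  frequency of visits. Choosing first \<open>l\<close> large and then \<open>\<delta>\<close> small makes this at most
  \<open>\<eta> L\<^sup>2\<close> (\<open>widim_growth\<close>).

  Parameters are counted as the coordinates different from 0 and 1 of a map to a cube. This count is
  additive when families of coordinates are put together, and the standard triangulation of the cube
  turns such a map into a map to a polyhedron of the corresponding dimension
  (\<open>widim_le_cubical\<close>).

  The facts about Brody curves that enter are compactness and continuity of the energy. Projective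
  space is embedded in the matrices by $Z \mapsto Z Z^* / |Z|^2$. The bound \<open>df_norm f z \<le> 1\<close>
  makes the matrix entries of all Brody curves Lipschitz with the same constant, so that convergence
  in the compact-open topology is pointwise convergence of these entries (\<open>limitin_brody_iff\<close>) and
  every sequence of Brody curves has a convergent subsequence
  (\<open>brody_convergent_subsequence\<close>); the derivatives converge by Cauchy's estimates
  (\<open>limit_df_norm\<close>).
\<close>

no_notation fps_nth (infixl "$" 75)

section \<open>Cubical coordinates and polyhedra\<close>

text \<open>
  The barycentric coordinates of a point \<open>v\<close> of the cube $[0,1]^I$ in the triangulation whose
  vertices are the corners of the cube, written as subsets of \<open>I\<close>, and whose simplices are the
  chains of subsets. The weight of the corner \<open>S\<close> is the length of the set of levels \<open>t\<close> at
  which the superlevel set of \<open>v\<close> is \<open>S\<close>. The elements 1 and 0 inserted are the values for an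
  empty minimum and an empty maximum.
\<close>

definition level_weight :: "'b set \<Rightarrow> ('b \<Rightarrow> real) \<Rightarrow> 'b set \<Rightarrow> real" where
  "level_weight I v S = max 0 (Min (insert 1 (v ` S)) - Max (insert 0 (v ` (I - S))))"

lemma level_weight_eq_measure:
  assumes "finite I" "S \<subseteq> I"
  shows "level_weight I v S = measure lborel {t \<in> {0<..1}. {i \<in> I. t \<le> v i} = S}"
    and "{t \<in> {0<..1}. {i \<in> I. t \<le> v i} = S} \<in> sets lborel"
proof -
  have fin: "finite S" using assms finite_subset by blast
  have "{t \<in> {0<..1}. {i \<in> I. t \<le> v i} = S}
      = {Max (insert 0 (v ` (I - S)))<..Min (insert 1 (v ` S))}"
    using assms fin by (auto simp: not_le) (meson DiffI leD)
  then show "level_weight I v S = measure lborel {t \<in> {0<..1}. {i \<in> I. t \<le> v i} = S}"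
    "{t \<in> {0<..1}. {i \<in> I. t \<le> v i} = S} \<in> sets lborel"
    by (auto simp: level_weight_def max_def measure_def)
qed

text \<open>
  As the weights are lengths of disjoint sets of levels, sums of weights are lengths of unions. The
  whole unit interval gives total weight 1, and the levels below \<open>v i\<close> recover the coordinate
  \<open>v i\<close>, so that the weights determine the point.
\<close>

lemma sum_level_weight:
  assumes "finite I" "P \<subseteq> Pow I"
  shows "(\<Sum>S\<in>P. level_weight I v S) = measure lborel {t \<in> {0<..1}. {i \<in> I. t \<le> v i} \<in> P}"
proof -
  let ?A = "\<lambda>S. {t \<in> {0<..1}. {i \<in> I. t \<le> v i} = S}"
  have fP: "finite P" using assms finite_subset by blast
  have sub: "S \<subseteq> I" if "S \<in> P" for S using that assms by auto
  have "emeasure lborel (?A S) \<noteq> \<infinity>" for S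
  proof -
    have "emeasure lborel (?A S) \<le> emeasure lborel {0<..1::real}"
      by (rule emeasure_mono) auto
    then show ?thesis by (auto simp: top_unique)
  qed
  then have "(\<Sum>S\<in>P. measure lborel (?A S)) = measure lborel (\<Union>S\<in>P. ?A S)"
    using level_weight_eq_measure(2)[OF assms(1) sub] fP
    by (intro measure_finite_Union[symmetric]) (auto simp: disjoint_family_on_def)
  also have "(\<Union>S\<in>P. ?A S) = {t \<in> {0<..1}. {i \<in> I. t \<le> v i} \<in> P}" by auto
  finally show ?thesis
    using level_weight_eq_measure(1)[OF assms(1) sub] by simp
qed

lemma sum_level_weight_Pow:
  assumes "finite I"
  shows "(\<Sum>S\<in>Pow I. level_weight I v S) = 1"
proof -
  have "{t \<in> {0<..1::real}. {i \<in> I. t \<le> v i} \<in> Pow I} = {0<..1}" by auto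
  then show ?thesis using sum_level_weight[OF assms, of "Pow I" v] by simp
qed

lemma sum_level_weight_containing:
  assumes "finite I" "i \<in> I" "v i \<in> {0..1}"
  shows "(\<Sum>S | S \<subseteq> I \<and> i \<in> S. level_weight I v S) = v i"
proof -
  have "{t \<in> {0<..1::real}. {i \<in> I. t \<le> v i} \<in> {S. S \<subseteq> I \<and> i \<in> S}} = {0<..v i}"
    using assms by auto
  then show ?thesis using sum_level_weight[OF assms(1), of "{S. S \<subseteq> I \<and> i \<in> S}" v] assms by auto
qed

text \<open>
  The superlevel set of \<open>v\<close> changes only at values of \<open>v\<close>. A corner \<open>S\<close> of positive
  weight is therefore determined by the level at which it stops being the superlevel set, the minimum
  of \<open>v\<close> on \<open>S\<close>, and this is either 1 or a value strictly between 0 and 1.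
\<close>

lemma card_level_weight_support:
  assumes "finite I" "\<And>i. i \<in> I \<Longrightarrow> v i \<in> {0..1}"
  shows "card {S \<in> Pow I. level_weight I v S \<noteq> 0} \<le> card {i \<in> I. v i \<notin> {0, 1}} + 1"
proof -
  let ?T = "{S \<in> Pow I. level_weight I v S \<noteq> 0}"
  let ?m = "\<lambda>S. Min (insert 1 (v ` S))"
  have pos: "Max (insert 0 (v ` (I - S))) < ?m S" if "S \<in> ?T" for S
    using that by (auto simp: level_weight_def max_def split: if_splits)
  have fS: "finite S" if "S \<in> ?T" for S
    using that assms finite_subset by blast
  have eq: "S = {i \<in> I. ?m S \<le> v i}" if "S \<in> ?T" for S
  proof -
    have "?m S \<le> v i" if "i \<in> S" for i using that \<open>S \<in> ?T\<close> fS by (intro Min_le) auto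
    moreover have "v i < ?m S" if "i \<in> I" "i \<notin> S" for i
    proof -
      have "v i \<le> Max (insert 0 (v ` (I - S)))" using that assms by (intro Max_ge) auto
      then show ?thesis using pos[OF \<open>S \<in> ?T\<close>] by linarith
    qed
    ultimately show ?thesis using that by (auto simp: not_le) (meson leD)
  qed
  have inj: "inj_on ?m ?T"
  proof (rule inj_onI)
    fix S S' assume *: "S \<in> ?T" "S' \<in> ?T" "?m S = ?m S'"
    show "S = S'" using eq[OF *(1)] eq[OF *(2)] unfolding *(3) by blast
  qed
  have sub: "?m ` ?T \<subseteq> insert 1 (v ` {i \<in> I. v i \<notin> {0, 1}})"
  proof
    fix y assume "y \<in> ?m ` ?T"
    then obtain S where S: "S \<in> ?T" "y = ?m S" by auto
    have "0 \<le> Max (insert 0 (v ` (I - S)))" using assms by (intro Max_ge) auto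
    then have "y > 0" using pos[OF S(1)] S(2) by linarith
    moreover have "y \<in> insert 1 (v ` S)" unfolding S(2) using fS[OF S(1)] by (intro Min_in) auto
    ultimately show "y \<in> insert 1 (v ` {i \<in> I. v i \<notin> {0, 1}})" using S(1) by auto
  qed
  have "card ?T = card (?m ` ?T)" using inj by (simp add: card_image)
  also have "\<dots> \<le> card (insert 1 (v ` {i \<in> I. v i \<notin> {0, 1}}))"
    by (rule card_mono[OF _ sub]) (use assms in auto)
  also have "\<dots> \<le> Suc (card (v ` {i \<in> I. v i \<notin> {0, 1}}))" by (rule card_insert_le_m1) auto
  also have "\<dots> \<le> card {i \<in> I. v i \<notin> {0, 1}} + 1" using assms by (simp add: card_image_le)
  finally show ?thesis .
qed

lemma continuous_map_Min_finite:
  assumes "finite A" "A \<noteq> {}" "\<And>a. a \<in> A \<Longrightarrow> continuous_map X euclideanreal (f a)"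
  shows "continuous_map X euclideanreal (\<lambda>x. Min ((\<lambda>a. f a x) ` A))"
  using assms by (induction rule: finite_ne_induct) (auto intro!: continuous_map_real_min)

lemma continuous_map_Max_finite:
  assumes "finite A" "A \<noteq> {}" "\<And>a. a \<in> A \<Longrightarrow> continuous_map X euclideanreal (f a)"
  shows "continuous_map X euclideanreal (\<lambda>x. Max ((\<lambda>a. f a x) ` A))"
  using assms by (induction rule: finite_ne_induct) (auto intro!: continuous_map_real_max)

lemma continuous_map_level_weight:
  assumes "finite I" "S \<subseteq> I" "\<And>i. i \<in> I \<Longrightarrow> continuous_map X euclideanreal (f i)"
  shows "continuous_map X euclideanreal (\<lambda>x. level_weight I (\<lambda>i. f i x) S)"
proof -
  have fin: "finite S" using assms finite_subset by blast
  have 1: "continuous_map X euclideanreal (\<lambda>x. Min (insert 1 ((\<lambda>i. f i x) ` S)))"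
  proof (cases "S = {}")
    case False
    then have "Min (insert 1 ((\<lambda>i. f i x) ` S)) = min 1 (Min ((\<lambda>i. f i x) ` S))" for x
      using fin by (intro Min_insert) auto
    then show ?thesis using False fin assms
      by (auto intro!: continuous_map_real_min continuous_map_Min_finite)
  qed auto
  have 2: "continuous_map X euclideanreal (\<lambda>x. Max (insert 0 ((\<lambda>i. f i x) ` (I - S))))"
  proof (cases "I - S = {}")
    case False
    then have "Max (insert 0 ((\<lambda>i. f i x) ` (I - S))) = max 0 (Max ((\<lambda>i. f i x) ` (I - S)))" for x
      using assms(1) by (intro Max_insert) auto
    then show ?thesis using False fin assms
      by (auto intro!: continuous_map_real_max continuous_map_Max_finite)
  next
    case True
    then show ?thesis unfolding True by simp
  qed
  show ?thesis unfolding level_weight_def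
    by (intro continuous_map_real_max continuous_map_diff 1 2) auto
qed

text \<open>
  The \<open>k\<close>-skeleton of the full simplex with \<open>N\<close> vertices has dimension \<open>k\<close> only if
  there are enough vertices, hence the minimum.
\<close>

lemma skeleton_polyhedron:
  assumes "N > 0"
  shows "polyhedron_of_dim (min k (N - 1)) (realization {s. s \<subseteq> {..<N} \<and> s \<noteq> {} \<and> card s \<le> k + 1})"
proof -
  let ?K = "{s. s \<subseteq> {..<N} \<and> s \<noteq> {} \<and> card s \<le> k + 1}"
  have finK: "finite ?K" by (rule finite_subset[of _ "Pow {..<N}"]) auto
  have fins: "finite s" if "s \<in> ?K" for s using that finite_subset by blast
  have "finite_complex ?K"
    unfolding finite_complex_def
  proof (intro conjI ballI allI impI finK)
    fix s t assume "s \<in> ?K" "t \<subseteq> s \<and> t \<noteq> {}"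
    then show "t \<in> ?K" using card_mono[OF fins, of s t] by auto
  next
    fix s assume "s \<in> ?K"
    then show "finite s" "s \<noteq> {}" using fins by blast+
  qed
  moreover have top: "{..<min (k + 1) N} \<in> ?K" using assms by auto
  moreover have "Max (card ` ?K) = min k (N - 1) + 1"
  proof (rule Max_eqI)
    show "finite (card ` ?K)" using finK by auto
    fix y assume "y \<in> card ` ?K"
    then obtain s where s: "s \<in> ?K" "y = card s" by auto
    then have "card s \<le> card {..<N}" by (intro card_mono) auto
    then show "y \<le> min k (N - 1) + 1" using s(1) assms unfolding s(2) by (simp add: min_def)
  next
    have "card {..<min (k + 1) N} = min k (N - 1) + 1" using assms by auto
    then show "min k (N - 1) + 1 \<in> card ` ?K" unfolding image_iff using top by (intro bexI[of _ "{..<min (k + 1) N}"]) auto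
  qed
  ultimately show ?thesis unfolding polyhedron_of_dim_def by blast
qed

text \<open>
  The family \<open>\<Phi>\<close> is a map to a cube whose image lies in the union of the faces of dimension at
  most \<open>k\<close>. The triangulation of the cube turns it into a map to a polyhedron of dimension at most
  \<open>k\<close> with the same fibres.
\<close>

lemma widim_le_cubical:
  fixes \<Phi> :: "('a \<Rightarrow> real) set"
  assumes met: "Metric_space M d" and fin: "finite \<Phi>"
    and cont: "\<And>\<phi>. \<phi> \<in> \<Phi> \<Longrightarrow> continuous_map (Metric_space.mtopology M d) euclideanreal \<phi>"
    and range: "\<And>\<phi> x. \<phi> \<in> \<Phi> \<Longrightarrow> x \<in> M \<Longrightarrow> \<phi> x \<in> {0..1}"
    and dim: "\<And>x. x \<in> M \<Longrightarrow> card {\<phi> \<in> \<Phi>. \<phi> x \<notin> {0, 1}} \<le> k"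
    and fibre: "\<And>x y. x \<in> M \<Longrightarrow> y \<in> M \<Longrightarrow> (\<And>\<phi>. \<phi> \<in> \<Phi> \<Longrightarrow> \<phi> x = \<phi> y) \<Longrightarrow> d x y \<le> \<epsilon>"
  shows "widim \<epsilon> M d \<le> k"
proof -
  interpret Metric_space M d by (rule met)
  \<comment> \<open>The vertices of a polyhedron have to be natural numbers, so the subsets of \<open>\<Phi>\<close> are numbered by \<open>h\<close>.\<close>
  define N where "N = card (Pow \<Phi>)"
  obtain h where h: "bij_betw h (Pow \<Phi>) {..<N}"
    unfolding N_def using fin by (metis ex_bij_betw_finite_nat finite_Pow_iff atLeast0LessThan)
  define h' where "h' = the_inv_into (Pow \<Phi>) h"
  have h': "h' i \<in> Pow \<Phi>" "h (h' i) = i" if "i < N" for i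
    using that bij_betw_the_inv_into[OF h] f_the_inv_into_f_bij_betw[OF h, of i]
    unfolding h'_def bij_betw_def by blast+
  have h'h: "h' (h S) = S" "h S < N" if "S \<subseteq> \<Phi>" for S
    using that h unfolding h'_def bij_betw_def by (auto simp: the_inv_into_f_f)
  have N: "N > 0" unfolding N_def using fin by (simp add: card_Pow)
  let ?K = "{s. s \<subseteq> {..<N} \<and> s \<noteq> {} \<and> card s \<le> k + 1}"
  let ?w = "\<lambda>x S. level_weight \<Phi> (\<lambda>\<phi>. \<phi> x) S"
  define g where "g x i = (if i < N then ?w x (h' i) else 0)" for x i
  have supp: "{i. g x i \<noteq> 0} = h ` {S \<in> Pow \<Phi>. ?w x S \<noteq> 0}" for x
  proof (intro set_eqI iffI)
    fix i assume "i \<in> {i. g x i \<noteq> 0}"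
    then have "i < N" "?w x (h' i) \<noteq> 0" by (auto simp: g_def split: if_splits)
    then show "i \<in> h ` {S \<in> Pow \<Phi>. ?w x S \<noteq> 0}"
      using h'[of i] by (intro image_eqI[of i h "h' i"]) auto
  qed (auto simp: g_def h'h)
  have injh: "inj_on h (Pow \<Phi>)" using h by (simp add: bij_betw_def)
  have sums: "(\<Sum>i | g x i \<noteq> 0. g x i) = 1" for x
  proof -
    have "(\<Sum>i | g x i \<noteq> 0. g x i) = (\<Sum>S | S \<in> Pow \<Phi> \<and> ?w x S \<noteq> 0. g x (h S))"
      unfolding supp by (rule sum.reindex_cong[of h]) (use injh in \<open>auto intro: inj_on_subset\<close>)
    also have "\<dots> = (\<Sum>S | S \<in> Pow \<Phi> \<and> ?w x S \<noteq> 0. ?w x S)"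
      by (rule sum.cong) (auto simp: g_def h'h)
    also have "\<dots> = (\<Sum>S\<in>Pow \<Phi>. ?w x S)"
      using fin by (intro sum.mono_neutral_left) auto
    finally show ?thesis using sum_level_weight_Pow[OF fin] by simp
  qed
  have img: "g x \<in> realization ?K" if "x \<in> M" for x
  proof -
    have nn: "\<forall>i. 0 \<le> g x i" by (simp add: g_def level_weight_def)
    have "{i. g x i \<noteq> 0} \<noteq> {}" using sums[of x] by (metis sum.empty zero_neq_one)
    moreover have "{i. g x i \<noteq> 0} \<subseteq> {..<N}" by (auto simp: g_def split: if_splits)
    moreover have "card {i. g x i \<noteq> 0} \<le> k + 1"
    proof -
      have "card {i. g x i \<noteq> 0} \<le> card {S \<in> Pow \<Phi>. ?w x S \<noteq> 0}"
        unfolding supp using fin by (intro card_image_le) auto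
      also have "\<dots> \<le> card {\<phi> \<in> \<Phi>. \<phi> x \<notin> {0, 1}} + 1"
        using card_level_weight_support[OF fin, of "\<lambda>\<phi>. \<phi> x"] range that by auto
      finally show ?thesis using dim[OF that] by linarith
    qed
    ultimately show ?thesis using nn sums[of x] by (simp add: realization_def)
  qed
  have cg: "continuous_map mtopology (top_of_set (realization ?K)) g"
  proof (rule continuous_map_into_subtopology)
    have "continuous_map mtopology euclideanreal (\<lambda>x. g x i)" for i
    proof (cases "i < N")
      case True
      then show ?thesis unfolding g_def using h'(1)[OF True] cont fin
        by (auto intro!: continuous_map_level_weight[where f="\<lambda>\<phi>. \<phi>"])
    qed (simp add: g_def)
    then show "continuous_map mtopology euclidean g"
      by (simp add: continuous_map_componentwise_UNIV flip: euclidean_product_topology)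
  qed (use img in auto)
  have fib: "d x y \<le> \<epsilon>" if "x \<in> M" "y \<in> M" "g x = g y" for x y
  proof (rule fibre[OF that(1,2)])
    fix \<phi> assume \<phi>: "\<phi> \<in> \<Phi>"
    have w: "?w x S = ?w y S" if "S \<subseteq> \<Phi>" for S
      using fun_cong[OF \<open>g x = g y\<close>, of "h S"] h'h[OF that] by (simp add: g_def)
    have "\<phi> x = (\<Sum>S | S \<subseteq> \<Phi> \<and> \<phi> \<in> S. ?w x S)"
      using sum_level_weight_containing[OF fin \<phi>, of "\<lambda>\<phi>. \<phi> x"] range[OF \<phi> that(1)] by simp
    also have "\<dots> = (\<Sum>S | S \<subseteq> \<Phi> \<and> \<phi> \<in> S. ?w y S)" using w by (intro sum.cong) auto
    also have "\<dots> = \<phi> y"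
      using sum_level_weight_containing[OF fin \<phi>, of "\<lambda>\<phi>. \<phi> y"] range[OF \<phi> that(2)] by simp
    finally show "\<phi> x = \<phi> y" .
  qed
  have "widim \<epsilon> M d \<le> min k (N - 1)"
    unfolding widim_def
    by (rule Least_le, rule exI[of _ "realization ?K"], rule exI[of _ g])
       (use skeleton_polyhedron[OF N] cg fib in auto)
  then show ?thesis by simp
qed

section \<open>Planar flows on compact metric spaces\<close>

text \<open>
  An action of the plane on a compact metric space. Joint continuity is stated through sequences,
  which is the form in which it is used and in which it holds visibly for translations of curves.
\<close>

locale planar_flow = Metric_space M d for M :: "'a set" and d :: "'a \<Rightarrow> 'a \<Rightarrow> real" +
  fixes act :: "complex \<Rightarrow> 'a \<Rightarrow> 'a"
  assumes compact: "compact_space mtopology"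
    and act_in: "x \<in> M \<Longrightarrow> act a x \<in> M"
    and act_act: "x \<in> M \<Longrightarrow> act a (act b x) = act (a + b) x"
    and act_0: "x \<in> M \<Longrightarrow> act 0 x = x"
    and act_limit: "limitin mtopology s x sequentially \<Longrightarrow> range s \<subseteq> M \<Longrightarrow> c \<longlonglongrightarrow> c0 \<Longrightarrow>
      limitin mtopology (\<lambda>n. act (c n) (s n)) (act c0 x) sequentially"
begin

lemma limit_in_M: "limitin mtopology s x F \<Longrightarrow> x \<in> M"
  by (simp add: limitin_metric)

lemma convergent_subsequence:
  fixes s :: "nat \<Rightarrow> 'a"
  assumes "range s \<subseteq> M"
  obtains l r where "l \<in> M" "strict_mono r" "limitin mtopology (\<lambda>n. s (r n)) l sequentially"
  using assms compact unfolding compact_space_sequentially comp_def by blast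

lemma limitin_subseq:
  assumes "limitin mtopology s l sequentially" "strict_mono r"
  shows "limitin mtopology (\<lambda>n. s (r n)) l sequentially"
  using limitin_subsequence[OF assms(2,1)] by (simp add: comp_def)

lemma limit_close:
  assumes "limitin mtopology s l sequentially" "range t \<subseteq> M" "(\<lambda>n. d (s n) (t n)) \<longlonglongrightarrow> 0"
  shows "limitin mtopology t l sequentially"
  unfolding limitin_metric_dist_null
proof (intro conjI)
  show "l \<in> M" using assms(1) by (rule limit_in_M)
  show "\<forall>\<^sub>F n in sequentially. t n \<in> M" using assms(2) by (intro always_eventually) auto
  have ev: "\<forall>\<^sub>F n in sequentially. s n \<in> M" and 0: "(\<lambda>n. d (s n) l) \<longlonglongrightarrow> 0"
    using assms(1) by (auto simp: limitin_metric_dist_null)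
  have "(\<lambda>n. d (s n) (t n) + d (s n) l) \<longlonglongrightarrow> 0"
    using tendsto_add[OF assms(3) 0] by simp
  then show "(\<lambda>n. d (t n) l) \<longlonglongrightarrow> 0"
  proof (rule Lim_null_comparison[rotated])
    show "\<forall>\<^sub>F n in sequentially. norm (d (t n) l) \<le> d (s n) (t n) + d (s n) l"
      using ev
    proof eventually_elim
      case (elim n)
      then show ?case
        using triangle[of "t n" "s n" l] assms(2) \<open>l \<in> M\<close> by (auto simp: commute)
    qed
  qed
qed

lemma limits_dist:
  assumes "limitin mtopology s l sequentially" "limitin mtopology t l sequentially"
  shows "(\<lambda>n. d (s n) (t n)) \<longlonglongrightarrow> 0"
proof -
  have ev: "\<forall>\<^sub>F n in sequentially. s n \<in> M \<and> t n \<in> M" and 0: "(\<lambda>n. d (s n) l + d (t n) l) \<longlonglongrightarrow> 0"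
    using assms tendsto_add[of "\<lambda>n. d (s n) l" 0 _ "\<lambda>n. d (t n) l" 0]
    by (auto simp: limitin_metric_dist_null eventually_conj_iff)
  show ?thesis
  proof (rule Lim_null_comparison[OF _ 0])
    show "\<forall>\<^sub>F n in sequentially. norm (d (s n) (t n)) \<le> d (s n) l + d (t n) l"
      using ev
    proof eventually_elim
      case (elim n)
      then show ?case
        using triangle[of "s n" l "t n"] limit_in_M[OF assms(1)] by (auto simp: commute)
    qed
  qed
qed

text \<open>
  Otherwise there would be pairs of points ever closer to each other that are separated by some
  element of the compact set \<open>C\<close>; both members of the pairs subconverge to the same point, and so
  do their translates.
\<close>

lemma act_uniform:
  assumes "compact C" "0 < \<epsilon>"
  obtains \<delta> where "\<delta> > 0"
    "\<And>x y \<gamma>. x \<in> M \<Longrightarrow> y \<in> M \<Longrightarrow> \<gamma> \<in> C \<Longrightarrow> d x y < \<delta> \<Longrightarrow> d (act \<gamma> x) (act \<gamma> y) < \<epsilon>"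
proof (rule ccontr)
  assume "\<not> thesis"
  then have "\<forall>n. \<exists>x y \<gamma>. x \<in> M \<and> y \<in> M \<and> \<gamma> \<in> C \<and> d x y < inverse (real (Suc n)) \<and>
      \<not> d (act \<gamma> x) (act \<gamma> y) < \<epsilon>"
    using that by (metis inverse_positive_iff_positive of_nat_0_less_iff zero_less_Suc)
  then obtain x y c where *: "\<And>n. x n \<in> M" "\<And>n. y n \<in> M" "\<And>n. c n \<in> C"
      "\<And>n. d (x n) (y n) < inverse (real (Suc n))" "\<And>n. \<not> d (act (c n) (x n)) (act (c n) (y n)) < \<epsilon>"
    by metis
  obtain l r where lr: "l \<in> M" "strict_mono r" "limitin mtopology (\<lambda>n. x (r n)) l sequentially"
    using convergent_subsequence[of x] *(1) by auto
  obtain c0 r' where cr: "strict_mono (r' :: nat \<Rightarrow> nat)" "(\<lambda>n. c (r (r' n))) \<longlonglongrightarrow> c0"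
    using assms(1) *(3) unfolding compact_def comp_def by meson
  define q where "q = (\<lambda>n. r (r' n))"
  have q: "strict_mono q" using lr(2) cr(1) by (auto simp: q_def strict_mono_def)
  have x: "limitin mtopology (\<lambda>n. x (q n)) l sequentially"
    using limitin_subseq[OF lr(3) cr(1)] by (simp add: q_def)
  have "(\<lambda>n. inverse (real (Suc (q n)))) \<longlonglongrightarrow> 0"
    using LIMSEQ_subseq_LIMSEQ[OF LIMSEQ_inverse_real_of_nat q] by (simp add: comp_def)
  then have "(\<lambda>n. d (x (q n)) (y (q n))) \<longlonglongrightarrow> 0"
    by (rule Lim_null_comparison[rotated]) (use *(4) in \<open>auto intro!: always_eventually less_imp_le\<close>)
  then have y: "limitin mtopology (\<lambda>n. y (q n)) l sequentially"
    by (rule limit_close[OF x, rotated]) (use * in auto)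
  have "(\<lambda>n. d (act (c (q n)) (x (q n))) (act (c (q n)) (y (q n)))) \<longlonglongrightarrow> 0"
    using cr(2) by (intro limits_dist[OF act_limit[OF x] act_limit[OF y]]) (use * in \<open>auto simp: q_def\<close>)
  then have "\<forall>\<^sub>F n in sequentially. d (act (c (q n)) (x (q n))) (act (c (q n)) (y (q n))) < \<epsilon>"
    using assms(2) by (rule order_tendstoD)
  then show False using *(5) by (auto simp: eventually_sequentially)
qed

lemma continuous_map_act: "continuous_map mtopology mtopology (act a)"
proof -
  have "\<exists>\<delta>>0. \<forall>y. y \<in> M \<and> d x y < \<delta> \<longrightarrow> d (act a x) (act a y) < \<epsilon>"
    if "x \<in> M" "\<epsilon> > 0" for x \<epsilon>
    using act_uniform[of "{a}" \<epsilon>] that by (metis compact_sing insertI1)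
  then show ?thesis
    unfolding metric_continuous_map[OF Metric_space_axioms] using act_in by auto
qed

lemma dist_bounded: obtains B where "\<And>x y. x \<in> M \<Longrightarrow> y \<in> M \<Longrightarrow> d x y \<le> B"
proof -
  have "mbounded M"
    using compact compactin_imp_mbounded unfolding compact_space_def by simp
  then show thesis using that unfolding mbounded_alt by auto
qed

lemma bdd_above_orbit_dist:
  assumes "x \<in> M" "y \<in> M"
  shows "bdd_above ((\<lambda>\<gamma>. d (act \<gamma> x) (act \<gamma> y)) ` \<Omega>)"
proof -
  obtain B where "\<And>x y. x \<in> M \<Longrightarrow> y \<in> M \<Longrightarrow> d x y \<le> B" using dist_bounded by blast
  then show ?thesis using assms act_in by (intro bdd_aboveI[of _ B]) auto
qed

lemma sup_dist_le_iff:
  assumes "x \<in> M" "y \<in> M" "\<Omega> \<noteq> {}"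
  shows "sup_dist act M d \<Omega> x y \<le> \<epsilon> \<longleftrightarrow> (\<forall>\<gamma>\<in>\<Omega>. d (act \<gamma> x) (act \<gamma> y) \<le> \<epsilon>)"
  using assms bdd_above_orbit_dist by (simp add: sup_dist_def cSUP_le_iff)

lemma dist_le_sup_dist:
  assumes "x \<in> M" "y \<in> M" "0 \<in> \<Omega>"
  shows "d x y \<le> sup_dist act M d \<Omega> x y"
  using cSUP_upper[OF assms(3) bdd_above_orbit_dist[OF assms(1,2)]] assms
  by (simp add: sup_dist_def act_0)

lemma Metric_space_sup_dist:
  assumes "0 \<in> \<Omega>"
  shows "Metric_space M (sup_dist act M d \<Omega>)"
proof
  fix x y
  show "0 \<le> sup_dist act M d \<Omega> x y"
  proof (cases "x \<in> M \<and> y \<in> M")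
    case True
    then show ?thesis using order_trans[OF nonneg[of x y] dist_le_sup_dist[OF _ _ assms, of x y]] by simp
  qed (auto simp: sup_dist_def)
  show "sup_dist act M d \<Omega> x y = sup_dist act M d \<Omega> y x"
    by (simp add: sup_dist_def commute conj_commute)
next
  fix x y assume xy: "x \<in> M" "y \<in> M"
  show "sup_dist act M d \<Omega> x y = 0 \<longleftrightarrow> x = y"
  proof
    assume "sup_dist act M d \<Omega> x y = 0"
    then have "d x y \<le> 0" using dist_le_sup_dist[OF xy assms] by simp
    then show "x = y" using xy nonneg[of x y] zero[of x y] by linarith
  next
    assume "x = y"
    then show "sup_dist act M d \<Omega> x y = 0" using xy assms act_in by (auto simp: sup_dist_def image_constant_conv)
  qed
next
  fix x y z assume xyz: "x \<in> M" "y \<in> M" "z \<in> M"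
  have ne: "\<Omega> \<noteq> {}" using assms by auto
  have a: "d (act \<gamma> x) (act \<gamma> y) \<le> sup_dist act M d \<Omega> x y" if "\<gamma> \<in> \<Omega>" "x \<in> M" "y \<in> M" for \<gamma> x y
    using sup_dist_le_iff[OF that(2,3) ne, of "sup_dist act M d \<Omega> x y"] that(1) by simp
  show "sup_dist act M d \<Omega> x z \<le> sup_dist act M d \<Omega> x y + sup_dist act M d \<Omega> y z"
    unfolding sup_dist_le_iff[OF xyz(1,3) ne]
  proof
    fix \<gamma> assume "\<gamma> \<in> \<Omega>"
    then show "d (act \<gamma> x) (act \<gamma> z) \<le> sup_dist act M d \<Omega> x y + sup_dist act M d \<Omega> y z"
      using triangle[of "act \<gamma> x" "act \<gamma> y" "act \<gamma> z"] xyz act_in a[of \<gamma> x y] a[of \<gamma> y z]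
      by fastforce
  qed
qed

text \<open>
  The metric \<open>sup_dist\<close> dominates \<open>d\<close>, so its topology is finer; continuous coordinates for
  \<open>d\<close> are therefore admissible in the definition of \<open>widim\<close> for \<open>sup_dist\<close>.
\<close>

lemma continuous_map_sup_dist:
  assumes "0 \<in> \<Omega>" "continuous_map mtopology X f"
  shows "continuous_map (Metric_space.mtopology M (sup_dist act M d \<Omega>)) X f"
proof -
  interpret S: Metric_space M "sup_dist act M d \<Omega>" by (rule Metric_space_sup_dist[OF assms(1)])
  have "openin S.mtopology U" if U: "openin mtopology U" for U
    unfolding S.openin_mtopology
  proof (intro conjI allI impI)
    show "U \<subseteq> M" using U unfolding openin_mtopology by blast
    fix x assume x: "x \<in> U"
    then obtain r where "r > 0" "mball x r \<subseteq> U"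
      using U x unfolding openin_mtopology by meson
    moreover have "S.mball x r \<subseteq> mball x r"
      using dist_le_sup_dist assms(1) unfolding mball_def S.mball_def by (auto intro: le_less_trans)
    ultimately show "\<exists>r>0. S.mball x r \<subseteq> U" by (meson subset_trans)
  qed
  then show ?thesis using assms(2) by (auto simp: continuous_map_def)
qed

lemma widim_square_le:
  fixes \<Phi> :: "('a \<Rightarrow> real) set"
  assumes fin: "finite \<Phi>" and L: "L > 0"
    and cont: "\<And>\<phi>. \<phi> \<in> \<Phi> \<Longrightarrow> continuous_map mtopology euclideanreal \<phi>"
    and range: "\<And>\<phi> x. \<phi> \<in> \<Phi> \<Longrightarrow> x \<in> M \<Longrightarrow> \<phi> x \<in> {0..1}"
    and dim: "\<And>x. x \<in> M \<Longrightarrow> card {\<phi> \<in> \<Phi>. \<phi> x \<notin> {0, 1}} \<le> k"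
    and fibre: "\<And>x y \<gamma>. x \<in> M \<Longrightarrow> y \<in> M \<Longrightarrow> (\<And>\<phi>. \<phi> \<in> \<Phi> \<Longrightarrow> \<phi> x = \<phi> y) \<Longrightarrow> \<gamma> \<in> square L \<Longrightarrow>
      d (act \<gamma> x) (act \<gamma> y) \<le> \<epsilon>"
  shows "widim \<epsilon> M (sup_dist act M d (square L)) \<le> k"
proof -
  have 0: "0 \<in> square L" using L by (simp add: square_def)
  show ?thesis
  proof (rule widim_le_cubical[where \<Phi> = \<Phi>, OF Metric_space_sup_dist[OF 0] fin])
    fix \<phi> assume "\<phi> \<in> \<Phi>"
    then show "continuous_map (Metric_space.mtopology M (sup_dist act M d (square L))) euclideanreal \<phi>"
      by (intro continuous_map_sup_dist[OF 0] cont)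
  next
    fix x y assume "x \<in> M" "y \<in> M" "\<And>\<phi>. \<phi> \<in> \<Phi> \<Longrightarrow> \<phi> x = \<phi> y"
    then show "sup_dist act M d (square L) x y \<le> \<epsilon>"
      using fibre 0 by (subst sup_dist_le_iff) auto
  qed (use range dim in blast)+
qed

end

text \<open>
  Distance to the complement of \<open>W\<close>, cut off at 1. For open \<open>W\<close> this is a continuous function
  with values in the unit interval that is positive exactly on \<open>W\<close>.
\<close>

definition (in Metric_space) dist_out :: "'a set \<Rightarrow> 'a \<Rightarrow> real" where
  "dist_out W x = (if M - W = {} then 1 else min 1 (INF y\<in>M - W. d x y))"

context Metric_space begin

lemma dist_out_range: "dist_out W x \<in> {0..1}"
  by (auto simp: dist_out_def intro!: cINF_greatest)

lemma dist_out_outside: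
  assumes "x \<in> M - W" shows "dist_out W x = 0"
proof -
  have "(INF y\<in>M - W. d x y) \<le> d x x"
    by (rule cINF_lower) (use assms in \<open>auto intro!: bdd_belowI[of _ 0]\<close>)
  then have "(INF y\<in>M - W. d x y) \<le> 0" using assms by simp
  moreover have "M - W \<noteq> {}" using assms by blast
  ultimately have "dist_out W x \<le> 0" by (simp add: dist_out_def)
  then show ?thesis using dist_out_range[of W x] by simp
qed

lemma dist_out_inside:
  assumes "openin mtopology W" "x \<in> W" shows "dist_out W x > 0"
proof -
  obtain r where r: "r > 0" "mball x r \<subseteq> W" using assms openin_mtopology by blast
  have "x \<in> M" using assms openin_mtopology by blast
  have "r \<le> d x y" if "y \<in> M - W" for y
    using that r(2) \<open>x \<in> M\<close> in_mball[of y x r] by (metis DiffD1 DiffD2 leI subsetD)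
  then have "r \<le> (INF y\<in>M - W. d x y)" if "M - W \<noteq> {}"
    using that by (intro cINF_greatest) auto
  then show ?thesis using r(1) by (cases "M - W = {}") (simp_all only: dist_out_def if_True if_False, auto)
qed

lemma dist_out_diff:
  assumes "x \<in> M" "y \<in> M" shows "dist_out W x \<le> dist_out W y + d x y"
proof (cases "M - W = {}")
  case False
  have "(INF z\<in>M - W. d x z) - d x y \<le> (INF z\<in>M - W. d y z)"
  proof (rule cINF_greatest[OF False])
    fix z assume z: "z \<in> M - W"
    have "(INF z\<in>M - W. d x z) \<le> d x z"
      by (rule cINF_lower[OF _ z]) (auto intro!: bdd_belowI[of _ 0])
    then show "(INF z\<in>M - W. d x z) - d x y \<le> d y z" using triangle[of x y z] assms z by auto
  qed
  then show ?thesis using False nonneg[of x y]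
    by (simp only: dist_out_def if_False)
qed (simp add: dist_out_def)

lemma continuous_map_dist_out: "continuous_map mtopology euclideanreal (dist_out W)"
proof -
  have "\<bar>dist_out W x - dist_out W y\<bar> \<le> d x y" if "x \<in> M" "y \<in> M" for x y
    using dist_out_diff[of x y W] dist_out_diff[of y x W] that by (auto simp: commute)
  then have "\<exists>\<delta>>0. \<forall>y. y \<in> M \<and> d x y < \<delta> \<longrightarrow> dist (dist_out W x) (dist_out W y) < \<epsilon>"
    if "x \<in> M" "\<epsilon> > 0" for x \<epsilon>
    using that by (intro exI[of _ \<epsilon>]) (auto simp: dist_real_def intro: le_less_trans)
  then show ?thesis
    using metric_continuous_map[OF Met_TC.Metric_space_axioms, of "dist_out W"] by (auto simp: mtopology_is_euclidean)
qed

end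

context planar_flow begin

section \<open>Encoding by finitely many parameters\<close>

text \<open>
  Coordinates are kept as a set of functions instead of an indexed family, so that putting families
  together is the union and moving them by the flow is an image.
\<close>

definition cubical_family :: "nat \<Rightarrow> ('a \<Rightarrow> real) set \<Rightarrow> bool" where
  "cubical_family m \<Phi> \<longleftrightarrow> finite \<Phi> \<and>
     (\<forall>\<phi>\<in>\<Phi>. continuous_map mtopology euclideanreal \<phi> \<and> \<phi> ` M \<subseteq> {0..1}) \<and>
     (\<forall>x\<in>M. card {\<phi> \<in> \<Phi>. \<phi> x \<notin> {0, 1}} \<le> m)"

text \<open>
  Near \<open>X\<close> a point is determined by at most \<open>m\<close> parameters up to \<open>\<epsilon>\<close> on the square of
  side \<open>l\<close>. Only one of the two points compared is required to lie near \<open>X\<close>: the parameters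
  have to recognize being near \<open>X\<close>. This makes the notion additive.
\<close>

definition encodable :: "real \<Rightarrow> nat \<Rightarrow> nat \<Rightarrow> 'a set \<Rightarrow> bool" where
  "encodable \<epsilon> l m X \<longleftrightarrow> (\<exists>\<Phi> W. cubical_family m \<Phi> \<and> openin mtopology W \<and> X \<subseteq> W \<and>
     (\<forall>x\<in>W. \<forall>y\<in>M. (\<forall>\<phi>\<in>\<Phi>. \<phi> x = \<phi> y) \<longrightarrow> (\<forall>\<gamma>\<in>square l. d (act \<gamma> x) (act \<gamma> y) \<le> \<epsilon>)))"

lemma encodable_Un:
  assumes "encodable \<epsilon> l m X" "encodable \<epsilon> l m' X'"
  shows "encodable \<epsilon> l (m + m') (X \<union> X')"
proof -
  obtain \<Phi> W where 1: "cubical_family m \<Phi>" "openin mtopology W" "X \<subseteq> W"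
     "\<forall>x\<in>W. \<forall>y\<in>M. (\<forall>\<phi>\<in>\<Phi>. \<phi> x = \<phi> y) \<longrightarrow> (\<forall>\<gamma>\<in>square l. d (act \<gamma> x) (act \<gamma> y) \<le> \<epsilon>)"
    using assms(1) unfolding encodable_def by blast
  obtain \<Phi>' W' where 2: "cubical_family m' \<Phi>'" "openin mtopology W'" "X' \<subseteq> W'"
     "\<forall>x\<in>W'. \<forall>y\<in>M. (\<forall>\<phi>\<in>\<Phi>'. \<phi> x = \<phi> y) \<longrightarrow> (\<forall>\<gamma>\<in>square l. d (act \<gamma> x) (act \<gamma> y) \<le> \<epsilon>)"
    using assms(2) unfolding encodable_def by blast
  have "cubical_family (m + m') (\<Phi> \<union> \<Phi>')"
    unfolding cubical_family_def
  proof (intro conjI ballI)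
    fix x assume x: "x \<in> M"
    have "{\<phi> \<in> \<Phi> \<union> \<Phi>'. \<phi> x \<notin> {0, 1}} = {\<phi> \<in> \<Phi>. \<phi> x \<notin> {0, 1}} \<union> {\<phi> \<in> \<Phi>'. \<phi> x \<notin> {0, 1}}" by blast
    then have "card {\<phi> \<in> \<Phi> \<union> \<Phi>'. \<phi> x \<notin> {0, 1}} \<le> card {\<phi> \<in> \<Phi>. \<phi> x \<notin> {0, 1}} + card {\<phi> \<in> \<Phi>'. \<phi> x \<notin> {0, 1}}"
      by (simp only: card_Un_le)
    also have "\<dots> \<le> m + m'" using 1(1) 2(1) x unfolding cubical_family_def by (meson add_mono)
    finally show "card {\<phi> \<in> \<Phi> \<union> \<Phi>'. \<phi> x \<notin> {0, 1}} \<le> m + m'" .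
  qed (use 1(1) 2(1) in \<open>unfold cubical_family_def, blast\<close>)+
  moreover have "openin mtopology (W \<union> W')" using 1(2) 2(2) by (rule openin_Un)
  moreover have "X \<union> X' \<subseteq> W \<union> W'" using 1(3) 2(3) by blast
  moreover have "\<forall>x\<in>W \<union> W'. \<forall>y\<in>M. (\<forall>\<phi>\<in>\<Phi> \<union> \<Phi>'. \<phi> x = \<phi> y) \<longrightarrow>
      (\<forall>\<gamma>\<in>square l. d (act \<gamma> x) (act \<gamma> y) \<le> \<epsilon>)"
    unfolding ball_Un using 1(4) 2(4) by meson
  ultimately show ?thesis unfolding encodable_def by blast
qed

lemma act_uniform_square:
  assumes "0 < \<epsilon>"
  obtains \<delta> where "\<delta> > 0"
    "\<And>x y \<gamma>. x \<in> M \<Longrightarrow> y \<in> M \<Longrightarrow> \<gamma> \<in> square l \<Longrightarrow> d x y < \<delta> \<Longrightarrow> d (act \<gamma> x) (act \<gamma> y) < \<epsilon>"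
proof -
  have "\<gamma> \<in> cball 0 (2 * real l)" if "\<gamma> \<in> square l" for \<gamma>
    using that cmod_le[of \<gamma>] by (simp add: square_def)
  then show thesis using act_uniform[OF compact_cball assms, of 0 "2 * real l"] that by metis
qed

lemma small_open_cover:
  assumes "0 < \<epsilon>"
  obtains \<O> where "finite \<O>" "\<And>V. V \<in> \<O> \<Longrightarrow> openin mtopology V" "\<Union>\<O> = M"
    "\<And>V x y \<gamma>. V \<in> \<O> \<Longrightarrow> x \<in> V \<Longrightarrow> y \<in> V \<Longrightarrow> \<gamma> \<in> square l \<Longrightarrow> d (act \<gamma> x) (act \<gamma> y) \<le> \<epsilon>"
proof -
  obtain \<delta> where \<delta>: "\<delta> > 0"
    "\<And>x y \<gamma>. x \<in> M \<Longrightarrow> y \<in> M \<Longrightarrow> \<gamma> \<in> square l \<Longrightarrow> d x y < \<delta> \<Longrightarrow> d (act \<gamma> x) (act \<gamma> y) < \<epsilon>"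
    using act_uniform_square[OF assms] by metis
  have "compactin mtopology M" using compact unfolding compact_space_def by simp
  moreover have "M \<subseteq> \<Union>((\<lambda>x. mball x (\<delta> / 2)) ` M)" using \<delta>(1) by auto
  ultimately obtain \<O> where \<O>: "finite \<O>" "\<O> \<subseteq> (\<lambda>x. mball x (\<delta> / 2)) ` M" "M \<subseteq> \<Union>\<O>"
    using compactinD[of mtopology M "(\<lambda>x. mball x (\<delta> / 2)) ` M"] by blast
  show thesis
  proof (rule that[of \<O>])
    show "\<And>V. V \<in> \<O> \<Longrightarrow> openin mtopology V" using \<O>(2) by blast
    show "\<Union>\<O> = M" using \<O>(2,3) mball_subset_mspace by blast
    fix V x y \<gamma> assume *: "V \<in> \<O>" "x \<in> V" "y \<in> V" "\<gamma> \<in> square l"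
    then obtain z where "V = mball z (\<delta> / 2)" using \<O>(2) by blast
    then have "x \<in> M" "y \<in> M" "z \<in> M" "d z x < \<delta> / 2" "d z y < \<delta> / 2" using *(2,3) by auto
    then have "d x y < \<delta>" using triangle[of x z y] commute[of x z] by linarith
    then show "d (act \<gamma> x) (act \<gamma> y) \<le> \<epsilon>" using \<delta>(2) * \<open>x \<in> M\<close> \<open>y \<in> M\<close> by (meson less_imp_le)
  qed (rule \<O>(1))
qed

lemma openin_super_sublevel:
  assumes "continuous_map mtopology euclideanreal f"
  shows "openin mtopology {x \<in> M. f x > (c :: real)}" "openin mtopology {x \<in> M. f x < c}"
  using openin_continuous_map_preimage[OF assms, of "{c<..}"]
    openin_continuous_map_preimage[OF assms, of "{..<c}"] by auto

text \<open>
  Let \<open>\<W>\<close> be open sets of \<open>M\<close>, small for the distance along the square, whose traces cover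
  \<open>X\<close> with multiplicity at most \<open>n + 1\<close>. The functions \<open>dist_out W\<close> would be the required
  coordinates if at most \<open>n + 1\<close> of them were nonzero everywhere and not only on \<open>X\<close>. To achieve
  this, each is multiplied by a factor that vanishes as soon as \<open>n + 1\<close> others are at least as
  large and that is positive on \<open>X\<close>. Two points with the same nonzero coordinate lie in the same
  small set.
\<close>

lemma encodable_of_covering_dim:
  assumes X: "closedin mtopology X" and dim: "covering_dim_le (subtopology mtopology X) n"
    and \<epsilon>: "0 < \<epsilon>"
  shows "encodable \<epsilon> l (n + 1) X"
proof -
  have XM: "X \<subseteq> M" using closedin_subset[OF X] by simp
  obtain \<O> where \<O>: "finite \<O>" "\<And>V. V \<in> \<O> \<Longrightarrow> openin mtopology V" "\<Union>\<O> = M"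
    "\<And>V x y \<gamma>. V \<in> \<O> \<Longrightarrow> x \<in> V \<Longrightarrow> y \<in> V \<Longrightarrow> \<gamma> \<in> square l \<Longrightarrow> d (act \<gamma> x) (act \<gamma> y) \<le> \<epsilon>"
    using small_open_cover[OF \<epsilon>] by blast
  have "open_cover (subtopology mtopology X) ((\<lambda>V. V \<inter> X) ` \<O>)"
    unfolding open_cover_def using \<O>(2,3) XM by (auto simp: openin_subtopology)
  moreover have ts: "topspace (subtopology mtopology X) = X" using XM by auto
  ultimately obtain \<V> where \<V>: "open_cover (subtopology mtopology X) \<V>"
      "\<And>V. V \<in> \<V> \<Longrightarrow> \<exists>U\<in>(\<lambda>V. V \<inter> X) ` \<O>. V \<subseteq> U"
      "\<And>x. x \<in> X \<Longrightarrow> finite {V \<in> \<V>. x \<in> V} \<and> card {V \<in> \<V>. x \<in> V} \<le> n + 1"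
    using dim unfolding covering_dim_le_def ts by meson
  have "compactin (subtopology mtopology X) X"
    using closedin_compact_space[OF compact X] by (simp add: compactin_subtopology)
  then obtain \<V>' where \<V>': "finite \<V>'" "\<V>' \<subseteq> \<V>" "X \<subseteq> \<Union>\<V>'"
    using compactinD[of "subtopology mtopology X" X \<V>] \<V>(1) XM unfolding open_cover_def by auto
  have "\<forall>V\<in>\<V>'. \<exists>W. openin mtopology W \<and> W \<inter> X = V \<and> (\<exists>U\<in>\<O>. W \<subseteq> U)"
  proof
    fix V assume "V \<in> \<V>'"
    then have V: "V \<in> \<V>" using \<V>'(2) by blast
    then have "openin (subtopology mtopology X) V" using \<V>(1) unfolding open_cover_def by blast
    then obtain W where "openin mtopology W" "V = W \<inter> X" by (auto simp: openin_subtopology)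
    moreover obtain U where "U \<in> \<O>" "V \<subseteq> U \<inter> X" using \<V>(2)[OF V] by blast
    ultimately show "\<exists>W. openin mtopology W \<and> W \<inter> X = V \<and> (\<exists>U\<in>\<O>. W \<subseteq> U)"
      using \<O>(2) by (intro exI[of _ "W \<inter> U"]) blast
  qed
  then obtain ext where ext: "\<And>V. V \<in> \<V>' \<Longrightarrow> openin mtopology (ext V) \<and> ext V \<inter> X = V \<and> (\<exists>U\<in>\<O>. ext V \<subseteq> U)"
    by metis
  define \<W> where "\<W> = ext ` \<V>'"
  have fin: "finite \<W>" using \<V>'(1) by (simp add: \<W>_def)
  have mult: "card {W \<in> \<W>. x \<in> W} \<le> n + 1" if "x \<in> X" for x
  proof -
    have "{W \<in> \<W>. x \<in> W} \<subseteq> ext ` {V \<in> \<V>. x \<in> V}"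
      unfolding \<W>_def using ext \<V>'(2) \<open>x \<in> X\<close> by blast
    then have "card {W \<in> \<W>. x \<in> W} \<le> card {V \<in> \<V>. x \<in> V}"
      using \<V>(3)[OF that] by (meson card_image_le card_mono finite_imageI order_trans)
    then show ?thesis using \<V>(3)[OF that] by linarith
  qed
  \<comment> \<open>This vanishes if and only if \<open>dist_out W x\<close> is at most all \<open>dist_out V x\<close> with \<open>V \<in> T\<close>.\<close>
  let ?gap = "\<lambda>W T x. \<Sum>V\<in>T. max 0 (dist_out W x - dist_out V x)"
  let ?\<T> = "\<lambda>W. {T. T \<subseteq> \<W> - {W} \<and> card T = n + 1}"
  define \<theta> where "\<theta> W x = min 1 (dist_out W x *
      (\<Prod>T\<in>?\<T> W. ?gap W T x))" for W x
  have fT: "finite (?\<T> W)" for W using fin by simp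
  have nonneg': "0 \<le> \<theta> W x" for W x
    using dist_out_range[of W x] by (auto simp: \<theta>_def intro!: mult_nonneg_nonneg prod_nonneg sum_nonneg)
  have pos: "dist_out W x > 0 \<and> (\<forall>T\<in>?\<T> W. ?gap W T x \<noteq> 0)"
    if "\<theta> W x > 0" for W x
  proof -
    have "dist_out W x \<noteq> 0 \<and> (\<Prod>T\<in>?\<T> W. ?gap W T x) \<noteq> 0"
      using that by (auto simp: \<theta>_def)
    then show ?thesis using dist_out_range[of W x] fT by (auto simp: prod_zero_iff less_le)
  qed
  have cont: "continuous_map mtopology euclideanreal (\<theta> W)" for W
    unfolding \<theta>_def using fT fin
    by (auto intro!: continuous_map_real_min continuous_map_real_mult continuous_map_prod continuous_map_sum
        continuous_map_real_max continuous_map_diff continuous_map_dist_out[unfolded eta_contract_eq] intro: finite_subset)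
  \<comment> \<open>Among \<open>n + 2\<close> sets with positive coordinate the one with the least distance has a vanishing factor.\<close>
  have count: "card {W \<in> \<W>. \<theta> W x > 0} \<le> n + 1" for x
  proof (rule ccontr)
    assume "\<not> ?thesis"
    then obtain Q where Q: "Q \<subseteq> {W \<in> \<W>. \<theta> W x > 0}" "card Q = n + 2" "finite Q"
      using obtain_subset_with_card_n[of "n + 2" "{W \<in> \<W>. \<theta> W x > 0}"] by auto
    then have "Q \<noteq> {}" by auto
    then obtain W where W: "W \<in> Q" "\<And>V. V \<in> Q \<Longrightarrow> dist_out W x \<le> dist_out V x"
      using arg_min_if_finite[OF Q(3), of "\<lambda>W. dist_out W x"] by (metis not_le)
    have "Q - {W} \<in> ?\<T> W" using Q W(1) by auto
    moreover have "?gap W (Q - {W}) x = 0"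
      using W(2) by (intro sum.neutral) auto
    ultimately show False using pos[of W x] W(1) Q(1) by blast
  qed
  \<comment> \<open>On \<open>X\<close> one of any \<open>n + 1\<close> other sets does not contain the point, so that its distance is 0.\<close>
  have pos_on_X: "\<exists>W\<in>\<W>. \<theta> W x > 0" if x: "x \<in> X" for x
  proof -
    obtain V0 where V0: "V0 \<in> \<V>'" "x \<in> V0" using \<V>'(3) x by blast
    then have "x \<in> ext V0" using ext[OF V0(1)] by blast
    then obtain W where W: "W \<in> \<W>" "x \<in> W" using V0(1) unfolding \<W>_def by blast
    have op: "openin mtopology V" if "V \<in> \<W>" for V using ext that by (auto simp: \<W>_def)
    have "?gap W T x > 0" if T: "T \<in> ?\<T> W" for T
    proof -
      have fT: "finite T" using T fin by (auto intro: finite_subset)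
      have "\<exists>V\<in>T. x \<notin> V"
      proof (rule ccontr)
        assume "\<not> ?thesis"
        then have "insert W T \<subseteq> {W \<in> \<W>. x \<in> W}" using T W by auto
        then have "card (insert W T) \<le> n + 1"
          using mult[OF x] fin by (intro order_trans[OF card_mono mult[OF x]]) auto
        moreover have "W \<notin> T" using T by blast
        then have "card (insert W T) = n + 2" using T fT by simp
        ultimately show False by simp
      qed
      then obtain V where V: "V \<in> T" "x \<notin> V" by blast
      have "0 < max 0 (dist_out W x - dist_out V x)"
        using dist_out_inside[OF op[OF W(1)] W(2)] dist_out_outside[of x V] V(2) x XM by auto
      also have "\<dots> \<le> ?gap W T x"
        by (rule member_le_sum[OF V(1)]) (use fT in auto)
      finally show ?thesis .
    qed
    then have "\<theta> W x > 0" using dist_out_inside[OF op[OF W(1)] W(2)]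
      unfolding \<theta>_def by (auto intro!: mult_pos_pos prod_pos)
    then show ?thesis using W(1) by blast
  qed
  have cub: "cubical_family (n + 1) (\<theta> ` \<W>)"
    unfolding cubical_family_def
  proof (intro conjI ballI)
    show "finite (\<theta> ` \<W>)" using fin by simp
    fix x assume "x \<in> M"
    have "{\<phi> \<in> \<theta> ` \<W>. \<phi> x \<notin> {0, 1}} \<subseteq> \<theta> ` {W \<in> \<W>. \<theta> W x > 0}"
      using nonneg'[of _ x] by (auto simp: less_le)
    then have "card {\<phi> \<in> \<theta> ` \<W>. \<phi> x \<notin> {0, 1}} \<le> card {W \<in> \<W>. \<theta> W x > 0}"
      using fin by (intro order_trans[OF card_mono card_image_le]) auto
    then show "card {\<phi> \<in> \<theta> ` \<W>. \<phi> x \<notin> {0, 1}} \<le> n + 1" using count[of x] by linarith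
  next
    fix \<phi> assume "\<phi> \<in> \<theta> ` \<W>"
    then show "continuous_map mtopology euclideanreal \<phi>" "\<phi> ` M \<subseteq> {0..1}"
      using cont nonneg' by (auto simp: \<theta>_def)
  qed
  have op: "openin mtopology (\<Union>W\<in>\<W>. {x \<in> M. \<theta> W x > 0})"
    using openin_super_sublevel(1)[OF cont] by blast
  show ?thesis
    unfolding encodable_def
  proof (intro exI conjI ballI impI)
    show "cubical_family (n + 1) (\<theta> ` \<W>)" "openin mtopology (\<Union>W\<in>\<W>. {x \<in> M. \<theta> W x > 0})"
      by (fact cub op)+
    show "X \<subseteq> (\<Union>W\<in>\<W>. {x \<in> M. \<theta> W x > 0})" using pos_on_X XM by blast
    fix x y \<gamma>
    assume x: "x \<in> (\<Union>W\<in>\<W>. {x \<in> M. \<theta> W x > 0})" and y: "y \<in> M"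
      and eq: "\<forall>\<phi>\<in>\<theta> ` \<W>. \<phi> x = \<phi> y" and \<gamma>: "\<gamma> \<in> square l"
    then obtain W where W: "W \<in> \<W>" "x \<in> M" "\<theta> W x > 0" by blast
    then have "\<theta> W y > 0" using eq by simp
    then have "x \<in> W" "y \<in> W"
      using pos[OF W(3)] pos[of W y] dist_out_outside[of _ W] W(2) y by force+
    moreover obtain U where "U \<in> \<O>" "W \<subseteq> U" using W(1) ext unfolding \<W>_def by blast
    ultimately show "d (act \<gamma> x) (act \<gamma> y) \<le> \<epsilon>" using \<O>(4) \<gamma> by blast
  qed
qed

lemma limitin_real:
  assumes "continuous_map mtopology euclideanreal f" "limitin mtopology s l F"
  shows "((\<lambda>n. f (s n)) \<longlongrightarrow> f l) F"
  using continuous_map_limit[OF assms] by (simp add: comp_def)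

text \<open>
  If the coordinates separate the points of \<open>X\<close>, then by compactness they nearly separate points
  that are close to \<open>X\<close>. The distance to \<open>X\<close> is added to the coordinates, so that points with
  the same coordinates are equally close to \<open>X\<close>.
\<close>

lemma encodable_of_separating:
  assumes X: "closedin mtopology X" and fin: "finite \<Psi>"
    and cont: "\<And>\<psi>. \<psi> \<in> \<Psi> \<Longrightarrow> continuous_map mtopology euclideanreal \<psi>"
    and range: "\<And>\<psi>. \<psi> \<in> \<Psi> \<Longrightarrow> \<psi> ` M \<subseteq> {0..1}"
    and sep: "\<And>x y. x \<in> X \<Longrightarrow> y \<in> X \<Longrightarrow> (\<And>\<psi>. \<psi> \<in> \<Psi> \<Longrightarrow> \<psi> x = \<psi> y) \<Longrightarrow> x = y"
    and \<epsilon>: "0 < \<epsilon>"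
  shows "encodable \<epsilon> l (card \<Psi> + 1) X"
proof -
  have XM: "X \<subseteq> M" using closedin_subset[OF X] by simp
  define D where "D = dist_out (M - X)"
  have D0: "x \<in> X" if "x \<in> M" "D x = 0" for x
    using that dist_out_inside[of "M - X" x] X by (force simp: D_def closedin_def)
  have contD: "continuous_map mtopology euclideanreal D" unfolding D_def by (rule continuous_map_dist_out)
  obtain c where c: "c > 0" "\<And>x y \<gamma>. x \<in> M \<Longrightarrow> y \<in> M \<Longrightarrow> D x < c \<Longrightarrow> D y < c \<Longrightarrow>
     (\<forall>\<psi>\<in>\<Psi>. \<psi> x = \<psi> y) \<Longrightarrow> \<gamma> \<in> square l \<Longrightarrow> d (act \<gamma> x) (act \<gamma> y) \<le> \<epsilon>"
  proof (rule ccontr)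
    assume "\<not> thesis"
    then have "\<forall>n. \<exists>x y \<gamma>. x \<in> M \<and> y \<in> M \<and> D x < inverse (real (Suc n)) \<and> D y < inverse (real (Suc n)) \<and>
        (\<forall>\<psi>\<in>\<Psi>. \<psi> x = \<psi> y) \<and> \<gamma> \<in> square l \<and> \<not> d (act \<gamma> x) (act \<gamma> y) \<le> \<epsilon>"
      using that by (metis inverse_positive_iff_positive of_nat_0_less_iff zero_less_Suc)
    then obtain x y g where *: "\<And>n. x n \<in> M" "\<And>n. y n \<in> M" "\<And>n. D (x n) < inverse (real (Suc n))"
        "\<And>n. D (y n) < inverse (real (Suc n))" "\<And>n. \<forall>\<psi>\<in>\<Psi>. \<psi> (x n) = \<psi> (y n)"
        "\<And>n. g n \<in> square l" "\<And>n. \<not> d (act (g n) (x n)) (act (g n) (y n)) \<le> \<epsilon>"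
      by metis
    obtain a r1 where a: "a \<in> M" "strict_mono r1" "limitin mtopology (\<lambda>n. x (r1 n)) a sequentially"
      using convergent_subsequence[of x] *(1) by auto
    obtain b r2 where b: "b \<in> M" "strict_mono r2" "limitin mtopology (\<lambda>n. y (r1 (r2 n))) b sequentially"
      using convergent_subsequence[of "\<lambda>n. y (r1 n)"] *(2) by auto
    define r where "r = (\<lambda>n. r1 (r2 n))"
    have r: "strict_mono r" using a(2) b(2) by (auto simp: r_def strict_mono_def)
    have xa: "limitin mtopology (\<lambda>n. x (r n)) a sequentially"
      using limitin_subseq[OF a(3) b(2)] by (simp add: r_def)
    have yb: "limitin mtopology (\<lambda>n. y (r n)) b sequentially" using b(3) by (simp add: r_def)
    have inv: "(\<lambda>n. inverse (real (Suc (r n)))) \<longlonglongrightarrow> 0"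
      using LIMSEQ_subseq_LIMSEQ[OF LIMSEQ_inverse_real_of_nat r] by (simp add: comp_def)
    have D: "D z \<ge> 0" for z unfolding D_def using dist_out_range[of "M - X" z] by simp
    have "(\<lambda>n. D (x (r n))) \<longlonglongrightarrow> 0" "(\<lambda>n. D (y (r n))) \<longlonglongrightarrow> 0"
      by (rule Lim_null_comparison[OF _ inv], use *(3,4) D in \<open>auto intro!: always_eventually less_imp_le\<close>)+
    then have "D a = 0" "D b = 0"
      using limitin_real[OF contD xa] limitin_real[OF contD yb] LIMSEQ_unique by blast+
    then have X: "a \<in> X" "b \<in> X" using D0 a(1) b(1) by auto
    have "a = b"
    proof (rule sep[OF X])
      fix \<psi> assume \<psi>: "\<psi> \<in> \<Psi>"
      have "(\<lambda>n. \<psi> (x (r n))) \<longlonglongrightarrow> \<psi> a" using limitin_real[OF cont[OF \<psi>] xa] .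
      moreover have "(\<lambda>n. \<psi> (x (r n))) \<longlonglongrightarrow> \<psi> b"
        using limitin_real[OF cont[OF \<psi>] yb] bspec[OF *(5) \<psi>] by simp
      ultimately show "\<psi> a = \<psi> b" by (rule LIMSEQ_unique)
    qed
    then have "(\<lambda>n. d (x (r n)) (y (r n))) \<longlonglongrightarrow> 0" using limits_dist[OF xa] yb by simp
    obtain \<delta> where \<delta>: "\<delta> > 0"
      "\<And>x y \<gamma>. x \<in> M \<Longrightarrow> y \<in> M \<Longrightarrow> \<gamma> \<in> square l \<Longrightarrow> d x y < \<delta> \<Longrightarrow> d (act \<gamma> x) (act \<gamma> y) < \<epsilon>"
      using act_uniform_square[OF \<epsilon>] by metis
    obtain n where "d (x (r n)) (y (r n)) < \<delta>"
      using order_tendstoD(2)[OF \<open>(\<lambda>n. d (x (r n)) (y (r n))) \<longlonglongrightarrow> 0\<close> \<delta>(1)]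
      by (auto simp: eventually_sequentially)
    then show False using \<delta>(2) *(1,2,6,7) by (meson less_imp_le)
  qed
  have "cubical_family (card \<Psi> + 1) (insert D \<Psi>)"
    unfolding cubical_family_def
  proof (intro conjI ballI)
    fix x
    have "card {\<phi> \<in> insert D \<Psi>. \<phi> x \<notin> {0, 1}} \<le> card (insert D \<Psi>)"
      by (rule card_mono) (use fin in auto)
    also have "\<dots> \<le> card \<Psi> + 1" using fin by (simp add: card_insert_if)
    finally show "card {\<phi> \<in> insert D \<Psi>. \<phi> x \<notin> {0, 1}} \<le> card \<Psi> + 1" .
  next
    fix \<phi> assume "\<phi> \<in> insert D \<Psi>"
    then show "continuous_map mtopology euclideanreal \<phi>" "\<phi> ` M \<subseteq> {0..1}"
      using cont contD range dist_out_range[of "M - X"] unfolding D_def by blast+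
  qed (use fin in auto)
  moreover have "openin mtopology {x \<in> M. D x < c}" by (rule openin_super_sublevel[OF contD])
  moreover have "X \<subseteq> {x \<in> M. D x < c}"
    using dist_out_outside[of _ "M - X"] XM c(1) by (auto simp: D_def)
  ultimately show ?thesis
    unfolding encodable_def
    by (intro exI[of _ "insert D \<Psi>"] exI[of _ "{x \<in> M. D x < c}"] conjI ballI impI) (use c(2) in auto)
qed

section \<open>Visits to a set and growth of widim\<close>

text \<open>
  Visits are counted along the integer lattice. The side lengths of tiles are integers, so the corners
  of tiles lie in this lattice.
\<close>

definition visits :: "'a set \<Rightarrow> nat \<Rightarrow> 'a \<Rightarrow> (nat \<times> nat) set" where
  "visits A K x = {(p, q) \<in> {..<K} \<times> {..<K}. act (Complex (real p) (real q)) x \<in> A}"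

lemma finite_visits [simp]: "finite (visits A K x)"
  by (rule finite_subset[of _ "{..<K} \<times> {..<K}"]) (auto simp: visits_def)

lemma card_visits_subdivide:
  assumes K: "0 < K" and x: "x \<in> M"
  shows "card (visits A (N * K) x) \<le>
    (\<Sum>(i, j)\<in>{..<N} \<times> {..<N}. card (visits A K (act (Complex (real (i * K)) (real (j * K))) x)))"
proof -
  let ?V = "\<lambda>i j. visits A K (act (Complex (real (i * K)) (real (j * K))) x)"
  let ?S = "\<lambda>(i, j). (\<lambda>(p, q). (p + i * K, q + j * K)) ` ?V i j"
  have "visits A (N * K) x \<subseteq> (\<Union>ij\<in>{..<N} \<times> {..<N}. ?S ij)"
  proof
    fix v assume "v \<in> visits A (N * K) x"
    then obtain p q where v: "v = (p, q)" "p < N * K" "q < N * K" "act (Complex p q) x \<in> A" by (auto simp: visits_def)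
    have *: "n div K < N" if "n < N * K" for n using that by (rule less_mult_imp_div_less)
    have "real (n mod K) + real (n div K * K) = real n" for n
      by (simp only: mod_div_mult_eq flip: of_nat_add)
    then have "(p mod K, q mod K) \<in> ?V (p div K) (q div K)"
      using v(4) K by (simp only: visits_def act_act[OF x] complex_add) simp
    then have "v \<in> ?S (p div K, q div K)"
      unfolding v(1) split_conv
      by (intro image_eqI[of _ _ "(p mod K, q mod K)"]) (simp_all only: split_conv mod_div_mult_eq)
    then show "v \<in> (\<Union>ij\<in>{..<N} \<times> {..<N}. ?S ij)" using * v(2,3) by blast
  qed
  then have "card (visits A (N * K) x) \<le> card (\<Union>ij\<in>{..<N} \<times> {..<N}. ?S ij)"
    by (intro card_mono) auto
  also have "\<dots> \<le> (\<Sum>ij\<in>{..<N} \<times> {..<N}. card (?S ij))" by (rule card_UN_le) auto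
  also have "\<dots> \<le> (\<Sum>(i, j)\<in>{..<N} \<times> {..<N}. card (?V i j))"
    by (intro sum_mono) (auto intro!: card_image_le)
  finally show ?thesis .
qed

text \<open>
  The factor 4 accounts for the small squares that stick out of the large one: for \<open>L \<ge> K\<close> all
  small squares needed to cover it lie in a square of side at most \<open>2 * L\<close>.
\<close>

lemma card_visits_scale:
  assumes K: "0 < K" "K \<le> L" and \<delta>: "\<And>x. x \<in> M \<Longrightarrow> real (card (visits A K x)) \<le> \<delta> * (real K)\<^sup>2"
    and x: "x \<in> M"
  shows "real (card (visits A L x)) \<le> 4 * \<delta> * (real L)\<^sup>2"
proof -
  define N where "N = L div K + 1"
  have \<delta>0: "0 \<le> \<delta>" using \<delta>[OF x] K(1) by (smt (verit) of_nat_0_le_iff of_nat_0_less_iff zero_le_mult_iff zero_less_power)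
  have NK: "N * K = L div K * K + K" by (simp add: N_def)
  also have "\<dots> \<le> 2 * L" using K(2) div_times_less_eq_dividend[of L K] by linarith
  finally have "real (N * K) \<le> real (2 * L)" by (rule of_nat_mono)
  then have NK2: "real N * real K \<le> 2 * real L" by simp
  have "L \<le> N * K" unfolding NK using div_mult_mod_eq[of L K] mod_less_divisor[OF K(1), of L] by linarith
  then have "visits A L x \<subseteq> visits A (N * K) x" by (auto simp: visits_def)
  then have "card (visits A L x) \<le> card (visits A (N * K) x)" by (intro card_mono) simp_all
  from order_trans[OF this card_visits_subdivide[OF K(1) x]]
  have "real (card (visits A L x)) \<le>
      (\<Sum>(i, j)\<in>{..<N} \<times> {..<N}. real (card (visits A K (act (Complex (real (i * K)) (real (j * K))) x))))"
    unfolding split_def of_nat_sum[symmetric] of_nat_le_iff .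
  also have "\<dots> \<le> (\<Sum>ij\<in>{..<N} \<times> {..<N}. \<delta> * (real K)\<^sup>2)"
    using \<delta> act_in[OF x] by (intro sum_mono) (auto simp: split_def)
  also have "\<dots> = \<delta> * (real N * real K)\<^sup>2" by (simp add: power2_eq_square)
  also have "\<dots> \<le> \<delta> * (2 * real L)\<^sup>2"
    using NK2 \<delta>0 by (intro mult_left_mono power_mono) auto
  finally show ?thesis by (simp add: power2_eq_square)
qed

lemma positive_on_closedin_bounded_below:
  assumes X: "closedin mtopology X" and f: "continuous_map mtopology euclideanreal f"
    and pos: "\<And>x. x \<in> X \<Longrightarrow> f x > 0"
  obtains c where "0 < c" "c \<le> 1" "\<And>x. x \<in> X \<Longrightarrow> c < f x"
proof (cases "X = {}")
  case False
  have "compact (f ` X)"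
    using image_compactin[OF closedin_compact_space[OF compact X] f] by simp
  then obtain y where y: "y \<in> f ` X" "\<And>z. z \<in> f ` X \<Longrightarrow> y \<le> z"
    using compact_attains_inf[of "f ` X"] False by auto
  then have "y > 0" using pos by auto
  show thesis
  proof (rule that[of "min 1 (y / 2)"])
    fix x assume "x \<in> X"
    then have "y \<le> f x" using y(2) by blast
    then show "min 1 (y / 2) < f x" using \<open>y > 0\<close> by linarith
  qed (use \<open>y > 0\<close> in auto)
qed (use that[of 1] in auto)

text \<open>
  On every tile of side \<open>l\<close> the \<open>m\<close> parameters valid near \<open>X\<close> are used, and in addition
  all functions \<open>\<xi> V\<close>. The latter vanish except on the closed set \<open>A\<close> away from \<open>X\<close>, so
  that they count only on the tiles whose corner is a visit to \<open>A\<close>. There are about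
  \<open>L\<^sup>2 / l\<^sup>2\<close> tiles and at most \<open>\<delta> L\<^sup>2\<close> visits, up to factors 4. The side \<open>l\<close> is chosen
  first, to make the contribution of the parameters near \<open>X\<close> small; the number of functions
  \<open>\<xi> V\<close> depends on \<open>l\<close>, and \<open>\<delta>\<close> is chosen accordingly.
\<close>

lemma widim_growth:
  assumes X: "closedin mtopology X"
    and enc: "\<And>l. encodable \<epsilon> l m X" and \<epsilon>: "0 < \<epsilon>"
    and negligible: "\<And>A \<delta>. closedin mtopology A \<Longrightarrow> A \<inter> X = {} \<Longrightarrow> 0 < \<delta> \<Longrightarrow>
       \<exists>K>0. \<forall>x\<in>M. real (card (visits A K x)) \<le> \<delta> * (real K)\<^sup>2"
    and \<eta>: "0 < \<eta>"
  obtains L0 where "\<And>L. L \<ge> L0 \<Longrightarrow> real (widim \<epsilon> M (sup_dist act M d (square L))) \<le> \<eta> * (real L)\<^sup>2"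
proof -
  obtain l :: nat where l: "l > 0" "real l \<ge> 8 * real m / \<eta>"
  proof
    show "real (nat \<lceil>8 * real m / \<eta>\<rceil> + 1) \<ge> 8 * real m / \<eta>" by linarith
  qed simp
  have lm: "4 * real m / (real l)\<^sup>2 \<le> \<eta> / 2"
  proof -
    have "8 * real m \<le> \<eta> * real l" using l(2) \<eta> by (simp add: field_simps)
    also have "\<dots> \<le> \<eta> * (real l)\<^sup>2" using l(1) \<eta> by (intro mult_left_mono) (auto simp: power2_eq_square)
    finally show ?thesis using l(1) by (simp add: field_simps)
  qed
  obtain \<Phi> W where \<Phi>: "cubical_family m \<Phi>" and W: "openin mtopology W" "X \<subseteq> W"
    and fib: "\<forall>x\<in>W. \<forall>y\<in>M. (\<forall>\<phi>\<in>\<Phi>. \<phi> x = \<phi> y) \<longrightarrow> (\<forall>\<gamma>\<in>square l. d (act \<gamma> x) (act \<gamma> y) \<le> \<epsilon>)"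
    using enc[of l] unfolding encodable_def by blast
  obtain c where c: "0 < c" "c \<le> 1" "\<And>x. x \<in> X \<Longrightarrow> c < dist_out W x"
    using positive_on_closedin_bounded_below[OF X continuous_map_dist_out[of W]] dist_out_inside[OF W(1)] W(2) by blast
  obtain \<O> where \<O>: "finite \<O>" "\<And>V. V \<in> \<O> \<Longrightarrow> openin mtopology V" "\<Union>\<O> = M"
    "\<And>V x y \<gamma>. V \<in> \<O> \<Longrightarrow> x \<in> V \<Longrightarrow> y \<in> V \<Longrightarrow> \<gamma> \<in> square l \<Longrightarrow> d (act \<gamma> x) (act \<gamma> y) \<le> \<epsilon>"
    using small_open_cover[OF \<epsilon>] by blast
  \<comment> \<open>\<open>A\<close> is a neighbourhood of the complement of \<open>W\<close> that is disjoint from \<open>X\<close>.\<close>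
  define A where "A = {x \<in> M. dist_out W x \<le> c}"
  have clA: "closedin mtopology A"
    using closedin_continuous_map_preimage[OF continuous_map_dist_out[of W], of "{..c}"] by (simp add: A_def)
  have AX: "A \<inter> X = {}" using c(3) by (force simp: A_def)
  define \<delta> where "\<delta> = \<eta> / (8 * (real (card \<O>) + 1))"
  have \<delta>0: "\<delta> > 0" using \<eta> by (simp add: \<delta>_def)
  obtain K where K: "K > 0" "\<And>x. x \<in> M \<Longrightarrow> real (card (visits A K x)) \<le> \<delta> * (real K)\<^sup>2"
    using negligible[OF clA AX \<delta>0] by blast
  \<comment> \<open>\<open>\<xi> V\<close> vanishes outside \<open>A\<close> and is positive on the points of \<open>V\<close> outside \<open>W\<close>.\<close>
  define \<xi> where "\<xi> V x = max 0 (c - dist_out W x) * dist_out V x" for V x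
  have \<xi>01: "\<xi> V x \<in> {0..1}" for V x
    using c(1,2) dist_out_range[of W x] dist_out_range[of V x] by (auto simp: \<xi>_def intro!: mult_le_one)
  have cont\<xi>: "continuous_map mtopology euclideanreal (\<xi> V)" for V
    unfolding \<xi>_def
    by (intro continuous_map_real_mult continuous_map_real_max continuous_map_diff continuous_map_dist_out[unfolded eta_contract_eq]) auto
  have finO: "finite (\<xi> ` \<O>)" and fin\<Phi>: "finite \<Phi>" using \<O>(1) \<Phi> by (auto simp: cubical_family_def)
  have fib': "d (act \<gamma> x) (act \<gamma> y) \<le> \<epsilon>"
    if x: "x \<in> M" and y: "y \<in> M" and eq: "\<And>\<phi>. \<phi> \<in> \<Phi> \<union> \<xi> ` \<O> \<Longrightarrow> \<phi> x = \<phi> y" and \<gamma>: "\<gamma> \<in> square l" for x y \<gamma>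
  proof (cases "x \<in> W")
    case True
    then show ?thesis using fib y \<gamma> eq by blast
  next
    case False
    obtain V where V: "V \<in> \<O>" "x \<in> V" using \<O>(3) x by blast
    have "\<xi> V x > 0"
      using dist_out_inside[OF \<O>(2)[OF V(1)] V(2)] dist_out_outside[of x W] False x c(1) by (simp add: \<xi>_def)
    moreover have "\<xi> V x = \<xi> V y" using eq V(1) by blast
    ultimately have "dist_out V y \<noteq> 0" by (auto simp: \<xi>_def)
    then have "y \<in> V" using dist_out_outside[of y V] y by blast
    then show ?thesis using \<O>(4) V \<gamma> by blast
  qed
  show thesis
  proof (rule that)
    fix L assume L: "L \<ge> max K l"
    define N where "N = L div l + 1"
    define T where "T = (\<lambda>(i, j). (i * l, j * l)) ` ({..<N} \<times> {..<N}) \<inter> {..<L} \<times> {..<L}"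
    define a where "a = (\<lambda>(p, q). Complex (real p) (real q))"
    have finT: "finite T" by (simp add: T_def)
    have cardT: "real (card T) \<le> 4 * (real L)\<^sup>2 / (real l)\<^sup>2"
    proof -
      have "card T \<le> card ((\<lambda>(i, j). (i * l, j * l)) ` ({..<N} \<times> {..<N}))"
        unfolding T_def by (intro card_mono) auto
      also have "\<dots> \<le> card ({..<N} \<times> {..<N})" by (intro card_image_le) auto
      finally have "real (card T) \<le> (real N)\<^sup>2" by (simp add: power2_eq_square flip: of_nat_mult)
      also have "(real N)\<^sup>2 \<le> (2 * real L / real l)\<^sup>2"
      proof (rule power_mono)
        have "N * l = L div l * l + l" by (simp add: N_def)
        also have "\<dots> \<le> 2 * L" using L div_times_less_eq_dividend[of L l] by linarith
        finally have "real (N * l) \<le> real (2 * L)" by (rule of_nat_mono)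
        then show "real N \<le> 2 * real L / real l" using l(1) by (simp add: field_simps)
      qed simp
      finally show ?thesis by (simp add: power_divide power_mult_distrib)
    qed
    define \<Theta> where "\<Theta> = (\<Union>t\<in>T. (\<lambda>\<phi> x. \<phi> (act (a t) x)) ` (\<Phi> \<union> \<xi> ` \<O>))"
    have "widim \<epsilon> M (sup_dist act M d (square L)) \<le> nat \<lfloor>\<eta> * (real L)\<^sup>2\<rfloor>"
    proof (rule widim_square_le[where \<Phi> = \<Theta>])
      show "finite \<Theta>" using finT finO fin\<Phi> by (auto simp: \<Theta>_def)
      show "0 < L" using L l(1) by simp
      fix \<theta> assume "\<theta> \<in> \<Theta>"
      then obtain t \<phi> where t: "\<theta> = (\<lambda>x. \<phi> (act (a t) x))" "\<phi> \<in> \<Phi> \<union> \<xi> ` \<O>" by (auto simp: \<Theta>_def)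
      have "continuous_map mtopology euclideanreal \<phi>"
        using t(2) \<Phi> cont\<xi> unfolding cubical_family_def by blast
      then show "continuous_map mtopology euclideanreal \<theta>"
        using continuous_map_compose[OF continuous_map_act] unfolding t(1) comp_def by blast
      fix x assume "x \<in> M"
      have "\<phi> ` M \<subseteq> {0..1}" using t(2) \<Phi> \<xi>01 unfolding cubical_family_def by blast
      then show "\<theta> x \<in> {0..1}" using act_in[OF \<open>x \<in> M\<close>] unfolding t(1) by blast
    next
      fix x assume x: "x \<in> M"
      let ?P = "\<lambda>t. (\<lambda>\<phi> x. \<phi> (act (a t) x)) ` {\<phi> \<in> \<Phi>. \<phi> (act (a t) x) \<notin> {0, 1}}"
      let ?Q = "\<lambda>t. (\<lambda>\<phi> x. \<phi> (act (a t) x)) ` \<xi> ` \<O>"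
      have "{\<theta> \<in> \<Theta>. \<theta> x \<notin> {0, 1}} \<subseteq> (\<Union>t\<in>T. ?P t) \<union> (\<Union>t\<in>visits A L x. ?Q t)"
      proof
        fix \<theta> assume "\<theta> \<in> {\<theta> \<in> \<Theta>. \<theta> x \<notin> {0, 1}}"
        then obtain t \<phi> where t: "t \<in> T" "\<theta> = (\<lambda>x. \<phi> (act (a t) x))" "\<phi> \<in> \<Phi> \<union> \<xi> ` \<O>" "\<phi> (act (a t) x) \<notin> {0, 1}"
          unfolding \<Theta>_def by auto
        show "\<theta> \<in> (\<Union>t\<in>T. ?P t) \<union> (\<Union>t\<in>visits A L x. ?Q t)"
        proof (cases "\<phi> \<in> \<Phi>")
          case True
          then have "\<theta> \<in> ?P t" using t(2,4) by blast
          then show ?thesis using t(1) by blast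
        next
          case False
          then have \<phi>: "\<phi> \<in> \<xi> ` \<O>" using t(3) by blast
          then have "dist_out W (act (a t) x) \<le> c" using t(4) by (auto simp: \<xi>_def max_def split: if_splits)
          then have "act (a t) x \<in> A" using act_in[OF x] by (simp add: A_def)
          then have "t \<in> visits A L x" using t(1) by (auto simp: T_def visits_def a_def)
          moreover have "\<theta> \<in> ?Q t" unfolding t(2) using \<phi> by (rule imageI)
          ultimately show ?thesis by blast
        qed
      qed
      then have "card {\<theta> \<in> \<Theta>. \<theta> x \<notin> {0, 1}} \<le> card ((\<Union>t\<in>T. ?P t) \<union> (\<Union>t\<in>visits A L x. ?Q t))"
        using finT fin\<Phi> finO by (intro card_mono) auto
      also have "\<dots> \<le> card (\<Union>t\<in>T. ?P t) + card (\<Union>t\<in>visits A L x. ?Q t)" by (rule card_Un_le)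
      also have "\<dots> \<le> (\<Sum>t\<in>T. card (?P t)) + (\<Sum>t\<in>visits A L x. card (?Q t))"
        by (intro add_mono card_UN_le finT finite_visits)
      also have "\<dots> \<le> (\<Sum>t\<in>T. m) + (\<Sum>t\<in>visits A L x. card \<O>)"
      proof (intro add_mono sum_mono)
        fix t
        have "card (?P t) \<le> card {\<phi> \<in> \<Phi>. \<phi> (act (a t) x) \<notin> {0, 1}}"
          using fin\<Phi> by (intro card_image_le) auto
        also have "\<dots> \<le> m" using \<Phi> act_in[OF x] unfolding cubical_family_def by blast
        finally show "card (?P t) \<le> m" .
        show "card (?Q t) \<le> card \<O>"
          using card_image_le[OF finO] card_image_le[OF \<O>(1)] by (rule order_trans)
      qed
      finally have "card {\<theta> \<in> \<Theta>. \<theta> x \<notin> {0, 1}} \<le> card T * m + card (visits A L x) * card \<O>" by simp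
      from of_nat_mono[OF this, where 'a = real] have "real (card {\<theta> \<in> \<Theta>. \<theta> x \<notin> {0, 1}}) \<le> real (card T) * m + real (card (visits A L x)) * card \<O>"
        by simp
      also have "\<dots> \<le> 4 * (real L)\<^sup>2 / (real l)\<^sup>2 * m + 4 * \<delta> * (real L)\<^sup>2 * card \<O>"
        using cardT card_visits_scale[OF K(1) _ K(2) x, of L] L
        by (intro add_mono mult_right_mono) auto
      also have "\<dots> = (real L)\<^sup>2 * (4 * real m / (real l)\<^sup>2) + (real L)\<^sup>2 * (4 * \<delta> * card \<O>)" by simp
      also have "\<dots> \<le> (real L)\<^sup>2 * (\<eta> / 2) + (real L)\<^sup>2 * (\<eta> / 2)"
        using lm \<eta> by (intro add_mono mult_left_mono) (auto simp: \<delta>_def field_simps)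
      finally have "real (card {\<theta> \<in> \<Theta>. \<theta> x \<notin> {0, 1}}) \<le> \<eta> * (real L)\<^sup>2" by (simp add: algebra_simps)
      then show "card {\<theta> \<in> \<Theta>. \<theta> x \<notin> {0, 1}} \<le> nat \<lfloor>\<eta> * (real L)\<^sup>2\<rfloor>" by (rule le_nat_floor)
    next
      fix x y \<gamma> assume x: "x \<in> M" and y: "y \<in> M" and eq: "\<And>\<theta>. \<theta> \<in> \<Theta> \<Longrightarrow> \<theta> x = \<theta> y" and \<gamma>: "\<gamma> \<in> square L"
      \<comment> \<open>Each coordinate of \<open>\<gamma>\<close> is the sum of a multiple of \<open>l\<close> and a remainder below \<open>l\<close>.\<close>
      have tile: "\<exists>i<N. i * l < L \<and> 0 \<le> r - real (i * l) \<and> r - real (i * l) < real l" if r: "0 \<le> r" "r < real L" for r :: real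
      proof -
        define i where "i = nat \<lfloor>r / real l\<rfloor>"
        have i: "real i \<le> r / real l" "r / real l < real i + 1"
          using r l(1) by (auto simp: i_def)
        then have 1: "real (i * l) \<le> r" "r < real (i * l) + real l" using l(1) by (auto simp: field_simps)
        then have "real (i * l) < real L" using r by linarith
        then have 2: "i * l < L" by (simp only: of_nat_less_iff)
        then have "i < N" unfolding N_def
          using div_le_mono[of "i * l" L l] l(1) by simp
        then show ?thesis using 1 2 by auto
      qed
      obtain i where i: "i < N" "i * l < L" "0 \<le> Re \<gamma> - real (i * l)" "Re \<gamma> - real (i * l) < real l"
        using tile[of "Re \<gamma>"] \<gamma> by (auto simp: square_def)
      obtain j where j: "j < N" "j * l < L" "0 \<le> Im \<gamma> - real (j * l)" "Im \<gamma> - real (j * l) < real l"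
        using tile[of "Im \<gamma>"] \<gamma> by (auto simp: square_def)
      define t where "t = (i * l, j * l)"
      have t: "t \<in> T" using i j by (auto simp: T_def t_def)
      have \<gamma>': "\<gamma> - a t \<in> square l" using i j by (simp add: square_def a_def t_def)
      have "d (act (\<gamma> - a t) (act (a t) x)) (act (\<gamma> - a t) (act (a t) y)) \<le> \<epsilon>"
      proof (rule fib'[OF act_in[OF x] act_in[OF y] _ \<gamma>'])
        fix \<phi> assume "\<phi> \<in> \<Phi> \<union> \<xi> ` \<O>"
        then have "(\<lambda>x. \<phi> (act (a t) x)) \<in> \<Theta>" unfolding \<Theta>_def using t by blast
        from eq[OF this] show "\<phi> (act (a t) x) = \<phi> (act (a t) y)" .
      qed
      then show "d (act \<gamma> x) (act \<gamma> y) \<le> \<epsilon>" by (simp add: act_act x y)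
    qed
    from of_nat_mono[OF this, where 'a = real]
    show "real (widim \<epsilon> M (sup_dist act M d (square L))) \<le> \<eta> * (real L)\<^sup>2"
      by (rule order_trans[OF _ of_nat_floor]) (use \<eta> in simp)
  qed
qed

lemma mean_dim_eq_0:
  assumes X: "closedin mtopology X"
    and enc: "\<And>\<epsilon> l. 0 < \<epsilon> \<Longrightarrow> encodable \<epsilon> l m X"
    and negligible: "\<And>A \<delta>. closedin mtopology A \<Longrightarrow> A \<inter> X = {} \<Longrightarrow> 0 < \<delta> \<Longrightarrow>
       \<exists>K>0. \<forall>x\<in>M. real (card (visits A K x)) \<le> \<delta> * (real K)\<^sup>2"
  shows "mean_dim act M d = 0"
proof -
  have "mean_widim act \<epsilon> M d = 0" if \<epsilon>: "0 < \<epsilon>" for \<epsilon>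
  proof -
    let ?w = "\<lambda>n. 1 / (real n)\<^sup>2 * real (widim \<epsilon> M (sup_dist act M d (square n)))"
    have "?w \<longlonglongrightarrow> 0"
    proof (rule LIMSEQ_I)
      fix r :: real assume "0 < r"
      then obtain L0 where L0: "\<And>L. L \<ge> L0 \<Longrightarrow>
          real (widim \<epsilon> M (sup_dist act M d (square L))) \<le> r / 2 * (real L)\<^sup>2"
        using widim_growth[OF X enc[OF \<epsilon>] \<epsilon> negligible, of "r / 2"] by (metis half_gt_zero)
      have "norm (?w n - 0) < r" if "n \<ge> max L0 1" for n
      proof -
        have "?w n \<le> r / 2" using L0[of n] that by (simp add: field_simps)
        moreover have "0 \<le> ?w n" by simp
        ultimately show ?thesis using \<open>0 < r\<close> by (simp only: diff_zero real_norm_def abs_of_nonneg)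
      qed
      then show "\<exists>no. \<forall>n\<ge>no. norm (?w n - 0) < r" by blast
    qed
    then have "(\<lambda>n. ereal (?w n)) \<longlonglongrightarrow> ereal 0" by (simp only: lim_ereal)
    then show ?thesis unfolding mean_widim_def by (metis limI zero_ereal_def)
  qed
  then have "((\<lambda>\<epsilon>. mean_widim act \<epsilon> M d) \<longlongrightarrow> 0) (at_right 0)"
    by (intro tendsto_eventually) (auto simp: eventually_at_right_less[THEN eventually_mono])
  then show ?thesis unfolding mean_dim_def by (simp add: tendsto_Lim)
qed

section \<open>Recurrence\<close>

definition nearby_visits :: "'a set \<Rightarrow> nat \<Rightarrow> 'a \<Rightarrow> (int \<times> int) set" where
  "nearby_visits A R x = {(p, q) \<in> {- int R<..<int R} \<times> {- int R<..<int R}.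
     act (Complex (of_int p) (of_int q)) x \<in> A}"

lemma finite_nearby_visits [simp]: "finite (nearby_visits A R x)"
  by (rule finite_subset[of _ "{- int R<..<int R} \<times> {- int R<..<int R}"]) (auto simp: nearby_visits_def)

text \<open>
  If a square of side \<open>2 ^ Suc k\<close> has visits of density above \<open>\<delta>\<close>, then so has one of its four
  quarters. Descending through the quarters ends at a visit all of whose dyadic squares are densely
  visited. The dyadic square of side \<open>2 ^ j\<close> that contains a point lies within \<open>2 ^ j\<close> of the
  point in both coordinates, which is why the visits near it are counted in squares centred at it.
\<close>

lemma dense_dyadic_point:
  assumes "x \<in> M" "real (card (visits A (2 ^ k) x)) > \<delta> * 4 ^ k" "0 \<le> \<delta>"
  shows "\<exists>p q. p < 2 ^ k \<and> q < 2 ^ k \<and> act (Complex (real p) (real q)) x \<in> A \<and>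
    (\<forall>j\<le>k. \<delta> * 4 ^ j \<le> real (card (nearby_visits A (2 ^ j) (act (Complex (real p) (real q)) x))))"
  using assms
proof (induction k arbitrary: x)
  case 0
  have "Complex 0 0 = 0" by (simp add: complex_eq_iff)
  then have a0: "act (Complex 0 0) x = x" using act_0[OF 0(1)] by simp
  have sub: "visits A 1 x \<subseteq> {(0, 0)}" by (auto simp: visits_def)
  have "visits A 1 x \<noteq> {}" using 0 by auto
  then have v: "visits A 1 x = {(0, 0)}" using sub by blast
  then have "(0, 0) \<in> visits A 1 x" by simp
  then have xA: "x \<in> A" by (simp add: visits_def a0)
  have "\<delta> < 1" using 0 v by simp
  have "nearby_visits A 1 x = {(0, 0)}" using xA by (auto simp: nearby_visits_def a0)
  then show ?case using xA \<open>\<delta> < 1\<close> by (intro exI[of _ 0]) (simp add: a0)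
next
  case (Suc k)
  let ?K = "2 ^ k :: nat"
  let ?a = "\<lambda>(i, j). Complex (real (i * ?K)) (real (j * ?K))"
  have "\<exists>ij\<in>{..<2} \<times> {..<2}. real (card (visits A ?K (act (?a ij) x))) > \<delta> * 4 ^ k"
  proof (rule ccontr)
    assume "\<not> ?thesis"
    then have le: "real (card (visits A ?K (act (?a ij) x))) \<le> \<delta> * 4 ^ k" if "ij \<in> {..<2} \<times> {..<2}" for ij
      using that by (meson not_le)
    have "card (visits A (2 ^ Suc k) x) \<le> (\<Sum>ij\<in>{..<2} \<times> {..<2}. card (visits A ?K (act (?a ij) x)))"
      using card_visits_subdivide[OF _ Suc.prems(1), of ?K A 2] by (simp add: split_def)
    from of_nat_mono[OF this, where 'a = real]
    have "real (card (visits A (2 ^ Suc k) x)) \<le> (\<Sum>ij\<in>{..<2} \<times> {..<2}. real (card (visits A ?K (act (?a ij) x))))"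
      by (simp only: of_nat_sum)
    also have "\<dots> \<le> (\<Sum>ij\<in>{..<2::nat} \<times> {..<2::nat}. \<delta> * 4 ^ k)" by (rule sum_mono) (rule le)
    also have "\<dots> = \<delta> * 4 ^ Suc k" by simp
    finally show False using Suc.prems(2) by simp
  qed
  then obtain i j where ij: "i < 2" "j < 2" "real (card (visits A ?K (act (?a (i, j)) x))) > \<delta> * 4 ^ k"
    by blast
  define b where "b = ?a (i, j)"
  obtain p q where pq: "p < ?K" "q < ?K" "act (Complex (real p) (real q)) (act b x) \<in> A"
    "\<And>j. j \<le> k \<Longrightarrow> \<delta> * 4 ^ j \<le> real (card (nearby_visits A (2 ^ j) (act (Complex (real p) (real q)) (act b x))))"
    using Suc.IH[OF act_in[OF Suc.prems(1)] ij(3) Suc.prems(3)] unfolding b_def by blast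
  define P Q where "P = p + i * ?K" and "Q = q + j * ?K"
  have eq: "act (Complex (real p) (real q)) (act b x) = act (Complex (real P) (real Q)) x"
    by (simp add: act_act[OF Suc.prems(1)] b_def P_def Q_def complex_add)
  have PQ: "P < 2 ^ Suc k" "Q < 2 ^ Suc k"
    using pq(1,2) ij(1,2) by (auto simp: P_def Q_def less_2_cases_iff)
  define y where "y = act (Complex (real P) (real Q)) x"
  have "(\<lambda>(u, v). (int u - int P, int v - int Q)) ` visits A (2 ^ Suc k) x \<subseteq> nearby_visits A (2 ^ Suc k) y"
  proof (rule image_subsetI)
    fix w assume "w \<in> visits A (2 ^ Suc k) x"
    then obtain u v where w: "w = (u, v)" "u < 2 ^ Suc k" "v < 2 ^ Suc k" "act (Complex u v) x \<in> A"
      by (auto simp: visits_def)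
    have "act (Complex (of_int (int u - int P)) (of_int (int v - int Q))) y = act (Complex u v) x"
      by (simp add: y_def act_act[OF Suc.prems(1)] complex_add)
    moreover have "int u - int P \<in> {- int (2 ^ Suc k)<..<int (2 ^ Suc k)}" "int v - int Q \<in> {- int (2 ^ Suc k)<..<int (2 ^ Suc k)}"
      using w(2,3) PQ unfolding greaterThanLessThan_iff by linarith+
    ultimately show "(case w of (u, v) \<Rightarrow> (int u - int P, int v - int Q)) \<in> nearby_visits A (2 ^ Suc k) y"
      unfolding w(1) nearby_visits_def using w(4) by simp
  qed
  then have "card ((\<lambda>(u, v). (int u - int P, int v - int Q)) ` visits A (2 ^ Suc k) x) \<le> card (nearby_visits A (2 ^ Suc k) y)"
    by (intro card_mono) auto
  moreover have "card ((\<lambda>(u, v). (int u - int P, int v - int Q)) ` visits A (2 ^ Suc k) x) = card (visits A (2 ^ Suc k) x)"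
    by (intro card_image) (auto simp: inj_on_def)
  ultimately have "\<delta> * 4 ^ Suc k \<le> real (card (nearby_visits A (2 ^ Suc k) y))" using Suc.prems(2) by linarith
  then have "\<delta> * 4 ^ j \<le> real (card (nearby_visits A (2 ^ j) y))" if "j \<le> Suc k" for j
    using that pq(4)[of j] unfolding eq y_def by (cases "j = Suc k") auto
  then show ?case using PQ pq(3) unfolding eq y_def by blast
qed

text \<open>
  The points given by the dyadic descent at scale \<open>k\<close> are good at all scales up to \<open>k\<close>. A limit
  of them as \<open>k\<close> grows is good at all scales: since \<open>A\<close> is closed, visits persist in the limit,
  and at a fixed scale only finitely many lattice points are involved.
\<close>

lemma recurrent_point:
  assumes A: "closedin mtopology A" and \<delta>: "0 < \<delta>"
    and dense: "\<And>K. 0 < K \<Longrightarrow> \<exists>x\<in>M. real (card (visits A K x)) > \<delta> * (real K)\<^sup>2"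
  obtains g where "g \<in> A" "\<And>j. \<delta> * 4 ^ j \<le> real (card (nearby_visits A (2 ^ j) g))"
proof -
  have AM: "A \<subseteq> M" using closedin_subset[OF A] by simp
  have "\<exists>g\<in>A. \<forall>j\<le>k. \<delta> * 4 ^ j \<le> real (card (nearby_visits A (2 ^ j) g))" for k
  proof -
    obtain x where "x \<in> M" "real (card (visits A (2 ^ k) x)) > \<delta> * (real (2 ^ k))\<^sup>2"
      using dense[of "2 ^ k"] by auto
    moreover have "(real (2 ^ k))\<^sup>2 = 4 ^ k" by (simp add: power2_eq_square flip: power_mult_distrib)
    ultimately show ?thesis using dense_dyadic_point[where x = x and \<delta> = \<delta> and A = A and k = k] \<delta> by auto
  qed
  then obtain s where s: "\<And>k. s k \<in> A"
     "\<And>k j. j \<le> k \<Longrightarrow> \<delta> * 4 ^ j \<le> real (card (nearby_visits A (2 ^ j) (s k)))"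
    by metis
  obtain g r where g: "g \<in> M" "strict_mono r" "limitin mtopology (\<lambda>n. s (r n)) g sequentially"
  proof (rule convergent_subsequence[of s])
    show "range s \<subseteq> M" using s(1) AM by blast
  qed blast
  have "g \<in> A"
    by (rule limitin_closedin[OF g(3) A]) (use s(1) in auto)
  moreover have "\<delta> * 4 ^ j \<le> real (card (nearby_visits A (2 ^ j) g))" for j
  proof -
    let ?B = "{- int (2 ^ j)<..<int (2 ^ j)} \<times> {- int (2 ^ j)<..<int (2 ^ j)}"
    let ?v = "\<lambda>pq :: int \<times> int. Complex (of_int (fst pq)) (of_int (snd pq))"
    have "\<forall>\<^sub>F n in sequentially. act (?v pq) (s (r n)) \<in> A \<longrightarrow> act (?v pq) g \<in> A" for pq
    proof (cases "act (?v pq) g \<in> A")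
      case False
      have "limitin mtopology (\<lambda>n. act (?v pq) (s (r n))) (act (?v pq) g) sequentially"
        by (rule act_limit[OF g(3)]) (use s(1) AM in auto)
      moreover have "openin mtopology (M - A)" using A by (simp add: closedin_def)
      ultimately have "\<forall>\<^sub>F n in sequentially. act (?v pq) (s (r n)) \<in> M - A"
        using False act_in[OF g(1)] unfolding limitin_def by blast
      then show ?thesis by eventually_elim auto
    qed auto
    then have "\<forall>\<^sub>F n in sequentially. \<forall>pq\<in>?B. act (?v pq) (s (r n)) \<in> A \<longrightarrow> act (?v pq) g \<in> A"
      by (intro eventually_ball_finite) auto
    moreover have "\<forall>\<^sub>F n in sequentially. j \<le> r n"
      using eventually_ge_at_top[of j] by eventually_elim (use seq_suble[OF g(2)] in \<open>auto intro: order_trans\<close>)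
    ultimately have "\<forall>\<^sub>F n in sequentially. \<delta> * 4 ^ j \<le> real (card (nearby_visits A (2 ^ j) g))"
    proof eventually_elim
      case (elim n)
      have "nearby_visits A (2 ^ j) (s (r n)) \<subseteq> nearby_visits A (2 ^ j) g"
        using elim(1) by (auto simp: nearby_visits_def)
      then have "card (nearby_visits A (2 ^ j) (s (r n))) \<le> card (nearby_visits A (2 ^ j) g)"
        by (intro card_mono) auto
      then show ?case using s(2)[OF elim(2)] by linarith
    qed
    then show ?thesis by simp
  qed
  ultimately show thesis by (rule that)
qed

end

section \<open>Projective space as a space of projection matrices\<close>

definition nsq :: "complex ^ 'n::finite \<Rightarrow> real" where
  "nsq Z = (\<Sum>l\<in>UNIV. (cmod (Z $ l))\<^sup>2)"

lemma nsq_nonneg: "0 \<le> nsq Z"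
  by (simp add: nsq_def sum_nonneg)

lemma nsq_pos_iff: "0 < nsq Z \<longleftrightarrow> Z \<noteq> 0"
proof -
  have "nsq Z = 0 \<longleftrightarrow> Z = 0"
    unfolding nsq_def by (subst sum_nonneg_eq_0_iff) (auto simp: vec_eq_iff)
  then show ?thesis using nsq_nonneg[of Z] by (auto simp: less_le)
qed

lemma nsq_smult: "nsq (c *s Z) = (cmod c)\<^sup>2 * nsq Z"
  by (simp add: nsq_def norm_mult power_mult_distrib sum_distrib_left)

lemma component_sq_le_nsq: "(cmod (Z $ j))\<^sup>2 \<le> nsq Z"
  unfolding nsq_def by (rule member_le_sum) auto

lemma continuous_on_nsq [continuous_intros]: "continuous_on S nsq"
  unfolding nsq_def by (intro continuous_intros)

text \<open>
  The entries of the orthogonal projection onto the line spanned by \<open>Z\<close>. They embed projective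
  space in the matrices, and the affine coordinates are quotients of them.
\<close>

lift_definition proj_entry :: "'n::finite \<Rightarrow> 'n \<Rightarrow> 'n cp \<Rightarrow> complex"
  is "\<lambda>j k Z. Z $ j * cnj (Z $ k) / of_real (nsq Z)"
proof -
  fix j k :: 'n and Z W :: "complex ^ 'n"
  assume "cp_rel Z W"
  then obtain c where "c \<noteq> 0" "W = c *s Z" by (auto simp: cp_rel_def)
  moreover have "complex_of_real ((cmod c)\<^sup>2) = c * cnj c" by (rule complex_norm_square)
  ultimately show "Z $ j * cnj (Z $ k) / of_real (nsq Z) = W $ j * cnj (W $ k) / of_real (nsq W)"
    by (simp add: nsq_smult del: of_real_power)
qed

lemma cp_rel_refl: "Z \<noteq> 0 \<Longrightarrow> cp_rel Z Z"
  unfolding cp_rel_def by (auto intro!: exI[of _ 1])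

lemma cp_cases [cases type: cp]:
  obtains Z where "Z \<noteq> 0" "p = abs_cp Z"
proof -
  have "cp_rel (rep_cp p) (rep_cp p)" "abs_cp (rep_cp p) = p"
    by (rule Quotient3_rep_reflp[OF Quotient3_cp], rule Quotient3_abs_rep[OF Quotient3_cp])
  then show thesis using that[of "rep_cp p"] by (auto simp: cp_rel_def)
qed

lemma abs_cp_eq_iff: "Z \<noteq> 0 \<Longrightarrow> W \<noteq> 0 \<Longrightarrow> abs_cp Z = abs_cp W \<longleftrightarrow> (\<exists>c. c \<noteq> 0 \<and> W = c *s Z)"
  using Quotient_rel[OF Quotient_cp, of Z W] cp_rel_refl[of Z] cp_rel_refl[of W] by (auto simp: cp_rel_def)

lemma proj_entry_abs: "Z \<noteq> 0 \<Longrightarrow> proj_entry j k (abs_cp Z) = Z $ j * cnj (Z $ k) / of_real (nsq Z)"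
  by (rule proj_entry.abs_eq) (rule cp_rel_refl)

lemma in_chart_abs: "Z \<noteq> 0 \<Longrightarrow> in_chart i (abs_cp Z) \<longleftrightarrow> Z $ i \<noteq> 0"
  by (rule in_chart.abs_eq) (rule cp_rel_refl)

lemma chart_coords_abs: "Z \<noteq> 0 \<Longrightarrow> chart_coords i (abs_cp Z) = (\<chi> j. Z $ j / Z $ i)"
  by (rule chart_coords.abs_eq) (rule cp_rel_refl)

lemma ex_in_chart: "\<exists>i. in_chart i p"
  by (cases p) (auto simp: in_chart_abs vec_eq_iff)

lemma in_chart_iff: "in_chart i p \<longleftrightarrow> proj_entry i i p \<noteq> 0"
proof (cases p)
  case (1 Z)
  then show ?thesis using nsq_pos_iff[of Z] by (simp add: in_chart_abs proj_entry_abs)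
qed

lemma chart_coords_eq: "chart_coords i p $ j = proj_entry j i p / proj_entry i i p"
proof (cases p)
  case (1 Z)
  then show ?thesis using nsq_pos_iff[of Z] by (cases "Z $ i = 0") (simp_all add: chart_coords_abs proj_entry_abs)
qed

lemma chart_coords_self: "in_chart i p \<Longrightarrow> chart_coords i p $ i = 1"
  by (simp add: chart_coords_eq in_chart_iff)

lemma chart_coords_nonzero: "in_chart i p \<Longrightarrow> chart_coords i p \<noteq> 0"
  using chart_coords_self[of i p] by auto

text \<open>
  The affine coordinates, with 1 as the component of the chart itself, are homogeneous coordinates of
  the point. In this way \<open>chart_coords i\<close> serves as a local lift to nonzero vectors.
\<close>

lemma abs_chart_coords:
  assumes "in_chart i p" shows "abs_cp (chart_coords i p) = p"
proof (cases p)
  case (1 Z)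
  then have Zi: "Z $ i \<noteq> 0" using assms by (simp add: in_chart_abs)
  have "Z = (Z $ i) *s chart_coords i p" using 1 Zi by (simp add: chart_coords_abs vec_eq_iff)
  then show ?thesis
    using 1 Zi abs_cp_eq_iff[OF chart_coords_nonzero[OF assms] 1(1)] by blast
qed

lemma proj_entry_chart:
  assumes "in_chart i p"
  shows "proj_entry j k p = chart_coords i p $ j * cnj (chart_coords i p $ k) / of_real (nsq (chart_coords i p))"
  using proj_entry_abs[OF chart_coords_nonzero[OF assms], of j k] abs_chart_coords[OF assms] by simp

lemma norm_proj_entry_le: "norm (proj_entry j k p) \<le> 1"
proof (cases p)
  case (1 Z)
  have "cmod (Z $ j) \<le> sqrt (nsq Z)" "cmod (Z $ k) \<le> sqrt (nsq Z)"
    by (intro real_le_rsqrt component_sq_le_nsq)+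
  then have "cmod (Z $ j) * cmod (Z $ k) \<le> sqrt (nsq Z) * sqrt (nsq Z)" by (intro mult_mono) (auto simp: nsq_nonneg)
  then show ?thesis using 1 nsq_pos_iff[of Z] nsq_nonneg[of Z]
    by (simp add: proj_entry_abs norm_mult norm_divide)
qed

lemma proj_entry_inj:
  assumes "\<And>j k. proj_entry j k p = proj_entry j k q" shows "p = q"
proof -
  obtain i where "in_chart i p" using ex_in_chart by blast
  then have i: "in_chart i p" "in_chart i q" using assms by (auto simp: in_chart_iff)
  have "chart_coords i p = chart_coords i q" using assms by (simp add: vec_eq_iff chart_coords_eq)
  then have "abs_cp (chart_coords i p) = abs_cp (chart_coords i q)" by (rule arg_cong)
  then show ?thesis unfolding abs_chart_coords[OF i(1)] abs_chart_coords[OF i(2)] .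
qed

lemma continuous_on_proj_entry: "continuous_on UNIV (proj_entry j k :: 'n::finite cp \<Rightarrow> complex)"
  unfolding continuous_on_open_vimage[OF open_UNIV]
proof (intro allI impI)
  fix B :: "complex set" assume B: "open B"
  have "continuous_on (- {0 :: complex ^ 'n}) (\<lambda>Z. Z $ j * cnj (Z $ k) / of_real (nsq Z))"
    by (intro continuous_intros) (auto simp: nsq_pos_iff[symmetric] less_le)
  then have "open ((\<lambda>Z. Z $ j * cnj (Z $ k) / of_real (nsq Z)) -` B \<inter> - {0 :: complex ^ 'n})"
    using B by (subst (asm) continuous_on_open_vimage) auto
  also have "(\<lambda>Z. Z $ j * cnj (Z $ k) / of_real (nsq Z)) -` B \<inter> - {0 :: complex ^ 'n} =
      {Z. Z \<noteq> 0 \<and> abs_cp Z \<in> proj_entry j k -` B}"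
    by (auto simp: proj_entry_abs)
  finally show "open (proj_entry j k -` B \<inter> UNIV)" by (simp add: open_cp_def)
qed

text \<open>
  The embedding by matrix entries is a homeomorphism onto its image: convergence of the entries gives
  convergence of affine coordinates, hence of homogeneous coordinates.
\<close>

lemma tendsto_cp:
  assumes "\<And>j k. ((\<lambda>n. proj_entry j k (s n)) \<longlongrightarrow> proj_entry j k p) F"
  shows "(s \<longlongrightarrow> p) F"
proof (rule topological_tendstoI)
  fix U :: "'a cp set" assume U: "open U" "p \<in> U"
  obtain i where i: "in_chart i p" using ex_in_chart by blast
  have "((\<lambda>n. chart_coords i (s n)) \<longlongrightarrow> chart_coords i p) F"
    by (rule vec_tendstoI) (auto simp: chart_coords_eq intro!: tendsto_divide assms i[unfolded in_chart_iff])
  moreover have "open {Z. Z \<noteq> 0 \<and> abs_cp Z \<in> U}" using U(1) by (simp add: open_cp_def)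
  moreover have "chart_coords i p \<in> {Z. Z \<noteq> 0 \<and> abs_cp Z \<in> U}"
    using U(2) i by (simp add: abs_chart_coords chart_coords_nonzero)
  ultimately have "\<forall>\<^sub>F n in F. chart_coords i (s n) \<in> {Z. Z \<noteq> 0 \<and> abs_cp Z \<in> U}"
    by (rule topological_tendstoD)
  moreover have "\<forall>\<^sub>F n in F. in_chart i (s n)"
    unfolding in_chart_iff by (rule tendsto_imp_eventually_ne[OF assms]) (use i in \<open>simp add: in_chart_iff\<close>)
  ultimately show "\<forall>\<^sub>F n in F. s n \<in> U"
    by eventually_elim (simp add: abs_chart_coords)
qed

text \<open>
  The image of the embedding is closed. The trace of the limit matrix is 1, so one of its diagonal
  entries is nonzero, and the corresponding column divided by this entry gives homogeneous coordinates
  of the point.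
\<close>

lemma proj_entry_limit:
  fixes s :: "nat \<Rightarrow> 'n::finite cp"
  assumes "\<And>j k. (\<lambda>n. proj_entry j k (s n)) \<longlonglongrightarrow> G j k"
  obtains p where "\<And>j k. proj_entry j k p = G j k"
proof -
  have tr: "(\<Sum>i\<in>UNIV. proj_entry i i p) = 1" for p :: "'n cp"
  proof (cases p)
    case (1 Z)
    have "(\<Sum>i\<in>UNIV. proj_entry i i p) = (\<Sum>i\<in>UNIV. Z $ i * cnj (Z $ i)) / of_real (nsq Z)"
      using 1 by (simp add: proj_entry_abs sum_divide_distrib)
    also have "(\<Sum>i\<in>UNIV. Z $ i * cnj (Z $ i)) = of_real (nsq Z)"
      by (simp add: nsq_def complex_norm_square[symmetric])
    finally show ?thesis using 1 nsq_pos_iff[of Z] by simp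
  qed
  have "(\<lambda>n. \<Sum>i\<in>UNIV. proj_entry i i (s n)) \<longlonglongrightarrow> (\<Sum>i\<in>UNIV. G i i)" by (intro tendsto_sum assms)
  then have "(\<Sum>i\<in>UNIV. G i i) = 1" unfolding tr by (simp add: LIMSEQ_const_iff)
  then have "(\<Sum>i\<in>UNIV. G i i) \<noteq> 0" by simp
  then have "\<exists>i. G i i \<noteq> 0" using sum.not_neutral_contains_not_neutral by blast
  then obtain i where i: "G i i \<noteq> 0" by blast
  define w where "w = (\<chi> j. G j i / G i i)"
  have "w $ i = 1" using i by (simp add: w_def)
  then have w0: "w \<noteq> 0" by auto
  have lim: "(\<lambda>n. chart_coords i (s n)) \<longlonglongrightarrow> w"
    by (rule vec_tendstoI) (auto simp: chart_coords_eq w_def intro!: tendsto_divide assms i)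
  have ev: "\<forall>\<^sub>F n in sequentially. in_chart i (s n)"
    unfolding in_chart_iff by (rule tendsto_imp_eventually_ne[OF assms i])
  show thesis
  proof (rule that[of "abs_cp w"])
    fix j k
    have "(\<lambda>n. nsq (chart_coords i (s n))) \<longlonglongrightarrow> nsq w"
      using continuous_on_tendsto_compose[OF continuous_on_nsq[of UNIV] lim] by simp
    then have "(\<lambda>n. chart_coords i (s n) $ j * cnj (chart_coords i (s n) $ k) / of_real (nsq (chart_coords i (s n))))
        \<longlonglongrightarrow> w $ j * cnj (w $ k) / of_real (nsq w)"
      using nsq_pos_iff[of w] w0 by (intro tendsto_intros lim) auto
    then have "(\<lambda>n. proj_entry j k (s n)) \<longlonglongrightarrow> w $ j * cnj (w $ k) / of_real (nsq w)"
      by (rule Lim_transform_eventually) (use ev in \<open>auto elim: eventually_mono simp: proj_entry_chart\<close>)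
    then show "proj_entry j k (abs_cp w) = G j k"
      using LIMSEQ_unique[OF _ assms] w0 by (simp add: proj_entry_abs)
  qed
qed

section \<open>The Fubini--Study density\<close>

definition cdot :: "complex ^ 'n::finite \<Rightarrow> complex ^ 'n \<Rightarrow> complex" where
  "cdot u w = (\<Sum>l\<in>UNIV. u $ l * cnj (w $ l))"

text \<open>
  The component of the tangent vector \<open>u\<close> orthogonal to the complex line through \<open>w\<close>.
\<close>

definition perp :: "complex ^ 'n::finite \<Rightarrow> complex ^ 'n \<Rightarrow> complex ^ 'n" where
  "perp w u = u - (cdot u w / of_real (nsq w)) *s w"

text \<open>
  The density of the Fubini--Study form along a lift of a curve with value \<open>w\<close> and derivative
  \<open>u\<close>. As only the component of \<open>u\<close> orthogonal to \<open>w\<close> enters, it is the same for all lifts.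
\<close>

definition fs_density :: "complex ^ 'n::finite \<Rightarrow> complex ^ 'n \<Rightarrow> real" where
  "fs_density w u = nsq (perp w u) / (pi * nsq w)"

lemma cdot_self: "cdot w w = of_real (nsq w)"
  unfolding cdot_def nsq_def of_real_sum by (intro sum.cong refl) (rule complex_norm_square[symmetric])

lemma cdot_smult: "cdot (c *s u) (a *s w) = c * cnj a * cdot u w"
  by (simp add: cdot_def sum_distrib_left mult_ac)

lemma cdot_add: "cdot (u + v) w = cdot u w + cdot v w"
  by (simp add: cdot_def sum.distrib algebra_simps)

lemma cdot_diff: "cdot (u - v) w = cdot u w - cdot v w"
  by (simp add: cdot_def sum_subtractf algebra_simps)

lemma cdot_cnj: "cdot w u = cnj (cdot u w)"
  by (simp add: cdot_def mult.commute)

lemma cdot_perp: "w \<noteq> 0 \<Longrightarrow> cdot (perp w u) w = 0"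
  using cdot_smult[of "cdot u w / of_real (nsq w)" w 1 w] nsq_pos_iff[of w]
  by (simp add: perp_def cdot_diff cdot_self)

lemma nsq_perp:
  assumes "w \<noteq> 0"
  shows "nsq (perp w u) = nsq u - (cmod (cdot u w))\<^sup>2 / nsq w"
proof -
  let ?p = "perp w u" let ?t = "cdot u w / of_real (nsq w)"
  have 0: "cdot ?p (?t *s w) = 0" using cdot_smult[of 1 ?p ?t w] cdot_perp[OF assms] by simp
  have "cdot ?p ?p = cdot ?p (u - ?t *s w)" by (simp add: perp_def)
  also have "\<dots> = cdot ?p u"
    using 0 unfolding cdot_def by (simp add: algebra_simps sum_subtractf sum.distrib)
  also have "\<dots> = cdot u u - ?t * cdot w u"
    using cdot_smult[of ?t w 1 u] by (simp add: perp_def cdot_diff)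
  also have "\<dots> = of_real (nsq u) - cdot u w * cnj (cdot u w) / of_real (nsq w)"
    by (simp add: cdot_self cdot_cnj[of w u])
  also have "\<dots> = of_real (nsq u - (cmod (cdot u w))\<^sup>2 / nsq w)"
    by (simp add: complex_norm_square del: of_real_power)
  finally show ?thesis unfolding cdot_self of_real_eq_iff .
qed

text \<open>
  Another lift of the same curve is \<open>a w\<close> with a function \<open>a\<close>, and \<open>b\<close> is the derivative
  of \<open>a\<close>. The orthogonal component of the derivative is multiplied by \<open>a\<close>.
\<close>

lemma fs_density_change:
  assumes "w \<noteq> 0" "a \<noteq> 0"
  shows "fs_density (a *s w) (a *s u + b *s w) = fs_density w u"
proof -
  have n: "complex_of_real (nsq (a *s w)) = a * cnj a * of_real (nsq w)"
    by (simp add: nsq_smult complex_norm_square[symmetric] del: of_real_power)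
  have "cdot (a *s u + b *s w) (a *s w) = a * cnj a * cdot u w + b * cnj a * of_real (nsq w)"
    by (simp add: cdot_add cdot_smult cdot_self)
  moreover have "of_real (nsq w) \<noteq> (0 :: complex)" using nsq_pos_iff[of w] assms by simp
  ultimately have "cdot (a *s u + b *s w) (a *s w) / of_real (nsq (a *s w)) = cdot u w / of_real (nsq w) + b / a"
    unfolding n using assms by (simp add: divide_simps) (simp add: algebra_simps)
  then have "perp (a *s w) (a *s u + b *s w) = a *s perp w u"
    using assms by (simp add: perp_def vec_eq_iff field_simps)
  then show ?thesis using assms by (simp add: fs_density_def nsq_smult)
qed

lemma has_derivative_vec_nth [derivative_intros]:
  "(f has_derivative f') F \<Longrightarrow> ((\<lambda>x. f x $ i) has_derivative (\<lambda>h. f' h $ i)) F"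
  by (rule bounded_linear.has_derivative[OF bounded_linear_vec_nth])

lemma has_derivative_vec_componentwise:
  fixes f :: "'a::real_normed_vector \<Rightarrow> complex ^ 'n::finite"
  assumes "\<And>j. ((\<lambda>x. f x $ j) has_derivative (\<lambda>h. f' h $ j)) (at x within S)"
  shows "(f has_derivative f') (at x within S)"
proof (subst has_derivative_componentwise_within, rule ballI)
  fix b :: "complex ^ 'n" assume "b \<in> Basis"
  then obtain j c where b: "b = axis j c" by (auto simp: Basis_vec_def)
  show "((\<lambda>x. f x \<bullet> b) has_derivative (\<lambda>x. f' x \<bullet> b)) (at x within S)"
    unfolding b inner_axis by (intro has_derivative_inner_left assms)
qed

definition affine_sq :: "'n::finite \<Rightarrow> complex ^ 'n \<Rightarrow> real" where
  "affine_sq i w = (\<Sum>j\<in>UNIV - {i}. w $ j \<bullet> w $ j)"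

lemma affine_sq_nonneg: "0 \<le> affine_sq i w"
  by (simp add: affine_sq_def sum_nonneg)

lemma has_derivative_affine_sq:
  "(affine_sq i has_derivative (\<lambda>h. \<Sum>j\<in>UNIV - {i}. 2 * (h $ j \<bullet> w $ j))) (at w)"
  unfolding affine_sq_def[abs_def]
  by (rule derivative_eq_intros refl ext | simp add: inner_commute)+

lemma FS_potential_eq: "FS_potential i w = of_real (ln (1 + affine_sq i w))"
  by (simp add: FS_potential_def affine_sq_def power2_norm_eq_inner)

lemma sum_inner_axis:
  fixes c :: complex
  shows "(\<Sum>j\<in>UNIV - {i}. 2 * (axis k c $ j \<bullet> w $ j)) = (if k = i then 0 else 2 * (c \<bullet> w $ k))"
proof -
  have "(\<Sum>j\<in>UNIV - {i}. 2 * (axis k c $ j \<bullet> w $ j)) = (\<Sum>j\<in>UNIV - {i}. if j = k then 2 * (c \<bullet> w $ k) else 0)"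
    by (intro sum.cong) (auto simp: axis_def)
  then show ?thesis by (simp add: sum.delta)
qed

text \<open>
  $\partial/\partial\bar z_k$ of $\log(1 + \sum_j z_j \bar z_j)$ is $z_k / (1 + \sum_j |z_j|^2)$.
\<close>

lemma wirtinger_bar_potential:
  "wirtinger_bar k (FS_potential i) w = (if k = i then 0 else w $ k / of_real (1 + affine_sq i w))"
proof -
  let ?s = "1 + affine_sq i w"
  have s: "?s > 0" using affine_sq_nonneg[of i w] by linarith
  have "(FS_potential i has_derivative
      (\<lambda>h. of_real (inverse ?s * (\<Sum>j\<in>UNIV - {i}. 2 * (h $ j \<bullet> w $ j))))) (at w)"
    unfolding FS_potential_eq[abs_def]
    by (rule derivative_eq_intros has_derivative_affine_sq refl ext s | simp)+
  then have D: "frechet_derivative (FS_potential i) (at w) =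
      (\<lambda>h. of_real (inverse ?s * (\<Sum>j\<in>UNIV - {i}. 2 * (h $ j \<bullet> w $ j))))"
    by (rule frechet_derivative_at[symmetric])
  have r: "1 \<bullet> z = Re z" "\<i> \<bullet> z = Im z" for z by (simp_all add: inner_complex_def)
  have c: "complex_of_real (inverse ?s * (2 * Re z)) + \<i> * of_real (inverse ?s * (2 * Im z)) =
      2 * (z / of_real ?s)" for z
    using s by (simp add: complex_eq_iff field_simps Re_divide_of_real Im_divide_of_real del: of_real_add)
  show ?thesis
  proof (cases "k = i")
    case True
    then show ?thesis unfolding wirtinger_bar_def D sum_inner_axis by simp
  next
    case False
    then show ?thesis unfolding wirtinger_bar_def D sum_inner_axis r by (simp only: if_False c) (simp del: of_real_add)
  qed
qed

lemma wirtinger_wirtinger_bar_potential: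
  "wirtinger j (wirtinger_bar k (FS_potential i)) w =
    (if j = i \<or> k = i then 0 else (if j = k then 1 else 0) / of_real (1 + affine_sq i w)
       - w $ k * cnj (w $ j) / (of_real (1 + affine_sq i w))\<^sup>2)"
proof (cases "k = i")
  case True
  then have "wirtinger_bar k (FS_potential i) = (\<lambda>w. 0)" by (simp add: wirtinger_bar_potential fun_eq_iff)
  then show ?thesis using True by (simp add: wirtinger_def)
next
  case False
  let ?s = "1 + affine_sq i w"
  have s: "?s > 0" using affine_sq_nonneg[of i w] by linarith
  then have sne: "complex_of_real ?s \<noteq> 0" by (simp only: of_real_eq_0_iff)
  have eq: "wirtinger_bar k (FS_potential i) = (\<lambda>w. w $ k / of_real (1 + affine_sq i w))"
    using False by (simp add: wirtinger_bar_potential fun_eq_iff)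
  have "((\<lambda>w. w $ k / of_real (1 + affine_sq i w)) has_derivative
      (\<lambda>h. h $ k / of_real ?s - w $ k * of_real (\<Sum>j\<in>UNIV - {i}. 2 * (h $ j \<bullet> w $ j)) / (of_real ?s)\<^sup>2)) (at w)"
    using sne by (auto intro!: derivative_eq_intros has_derivative_affine_sq ext
      simp del: of_real_add of_real_sum simp: divide_simps power2_eq_square)
  then have D: "frechet_derivative (wirtinger_bar k (FS_potential i)) (at w) =
      (\<lambda>h. h $ k / of_real ?s - w $ k * of_real (\<Sum>j\<in>UNIV - {i}. 2 * (h $ j \<bullet> w $ j)) / (of_real ?s)\<^sup>2)"
    unfolding eq by (rule frechet_derivative_at[symmetric])
  have c: "complex_of_real (2 * Re z) - \<i> * of_real (2 * Im z) = 2 * cnj z" for z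
    by (simp add: complex_eq_iff)
  have r: "1 \<bullet> z = Re z" "\<i> \<bullet> z = Im z" for z by (simp_all add: inner_complex_def)
  show ?thesis
  proof (cases "j = i")
    case True
    then show ?thesis using False unfolding wirtinger_def D sum_inner_axis by (simp add: axis_def)
  next
    case j: False
    have "wirtinger j (wirtinger_bar k (FS_potential i)) w =
       ((axis j 1 $ k - \<i> * axis j \<i> $ k) / of_real ?s
        - w $ k * (of_real (2 * Re (w $ j)) - \<i> * of_real (2 * Im (w $ j))) / (of_real ?s)\<^sup>2) / 2"
      unfolding wirtinger_def D sum_inner_axis r using j sne
      by (simp add: field_simps del: of_real_add of_real_mult)
    also have "\<dots> = (if j = k then 1 else 0) / of_real ?s - w $ k * cnj (w $ j) / (of_real ?s)\<^sup>2"
      unfolding c by (simp add: axis_def field_simps del: of_real_add)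
    finally show ?thesis using j False by simp
  qed
qed

text \<open>
  On \<open>u\<close> and \<open>\<i> u\<close> the antisymmetrized products collapse to multiples of
  $u_j \bar u_k$, and the form becomes the Hermitian form with matrix
  $\delta_{jk} / |w|^2 - \bar w_j w_k / |w|^4$ at \<open>u\<close>, up to the factor \<open>1 / pi\<close>. The
  component \<open>u $ i = 0\<close> makes the omission of the index \<open>i\<close> in the potential harmless.
\<close>

lemma FS_form_eq:
  fixes w u v :: "complex ^ 'n::finite"
  assumes w: "w $ i = 1" and u: "u $ i = 0" and v: "v = \<i> *s u"
  shows "FS_form i w u v = of_real (fs_density w u)"
proof -
  let ?s = "complex_of_real (nsq w)"
  have "nsq w = (cmod (w $ i))\<^sup>2 + (\<Sum>j\<in>UNIV - {i}. (cmod (w $ j))\<^sup>2)"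
    unfolding nsq_def by (rule sum.remove) auto
  then have s: "1 + affine_sq i w = nsq w" using w by (simp add: affine_sq_def power2_norm_eq_inner)
  have w0: "w \<noteq> 0" using w by auto
  have s0: "?s \<noteq> 0" using nsq_pos_iff[of w] w0 by simp
  let ?H = "\<lambda>j k. wirtinger j (wirtinger_bar k (FS_potential i)) w"
  have trm: "?H j k * (u $ j * cnj (v $ k) - v $ j * cnj (u $ k)) = - 2 * \<i> *
      ((if j = k then u $ j * cnj (u $ k) / ?s else 0) - (u $ j * cnj (w $ j)) * (w $ k * cnj (u $ k)) / ?s\<^sup>2)" for j k
  proof -
    have uv: "u $ j * cnj (v $ k) - v $ j * cnj (u $ k) = - 2 * \<i> * (u $ j * cnj (u $ k))"
      by (simp add: v)
    show ?thesis
    proof (cases "j = i \<or> k = i")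
      case True
      then show ?thesis unfolding uv using u by auto
    next
      case False
      then show ?thesis unfolding uv wirtinger_wirtinger_bar_potential s by (simp add: field_simps)
    qed
  qed
  have c: "cdot w u = cnj (cdot u w)" by (rule cdot_cnj)
  have "(\<Sum>j\<in>UNIV. \<Sum>k\<in>UNIV. ?H j k * (u $ j * cnj (v $ k) - v $ j * cnj (u $ k))) =
     - 2 * \<i> * ((\<Sum>j\<in>UNIV. \<Sum>k\<in>UNIV. if j = k then u $ j * cnj (u $ k) / ?s else 0)
       - (\<Sum>j\<in>UNIV. \<Sum>k\<in>UNIV. (u $ j * cnj (w $ j)) * (w $ k * cnj (u $ k)) / ?s\<^sup>2))"
    unfolding trm by (simp only: sum_subtractf flip: sum_distrib_left)
  also have "(\<Sum>j\<in>UNIV. \<Sum>k\<in>UNIV. if j = k then u $ j * cnj (u $ k) / ?s else 0) = cdot u u / ?s"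
    by (simp add: cdot_def sum_divide_distrib)
  also have "(\<Sum>j\<in>UNIV. \<Sum>k\<in>UNIV. (u $ j * cnj (w $ j)) * (w $ k * cnj (u $ k)) / ?s\<^sup>2) = cdot u w * cdot w u / ?s\<^sup>2"
    by (simp add: cdot_def sum_product sum_divide_distrib)
  also have "cdot u u / ?s - cdot u w * cdot w u / ?s\<^sup>2 = of_real (nsq (perp w u) / nsq w)"
    unfolding c nsq_perp[OF w0] complex_norm_square[symmetric] cdot_self using s0
    by (simp add: field_simps power2_eq_square)
  finally show ?thesis unfolding FS_form_def by (simp add: fs_density_def field_simps)
qed

section \<open>Holomorphic curves in charts\<close>

definition chart_deriv :: "'n::finite \<Rightarrow> (complex \<Rightarrow> 'n cp) \<Rightarrow> complex \<Rightarrow> complex ^ 'n" where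
  "chart_deriv i f z = (\<chi> j. deriv (\<lambda>\<zeta>. chart_coords i (f \<zeta>) $ j) z)"

lemma continuous_on_proj_entry_curve:
  assumes "continuous_on S f" shows "continuous_on S (\<lambda>z. proj_entry j k (f z))"
  using continuous_on_compose2[OF continuous_on_proj_entry assms] by simp

lemma open_chart_domain:
  assumes "holomorphic_curve f" shows "open {z. in_chart i (f z)}"
proof -
  have "open ((\<lambda>z. proj_entry i i (f z)) -` (- {0}))"
    using assms by (intro open_vimage continuous_on_proj_entry_curve) (auto simp: holomorphic_curve_def)
  then show ?thesis by (simp add: in_chart_iff vimage_def)
qed

lemma chart_has_field_derivative:
  assumes "holomorphic_curve f" "in_chart i (f z)"
  shows "((\<lambda>\<zeta>. chart_coords i (f \<zeta>) $ j) has_field_derivative chart_deriv i f z $ j) (at z)"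
  using assms open_chart_domain[OF assms(1), of i] unfolding holomorphic_curve_def chart_deriv_def
  by (auto intro!: holomorphic_derivI[of _ "{z. in_chart i (f z)}"])

lemma chart_has_derivative:
  assumes "holomorphic_curve f" "in_chart i (f z)"
  shows "((\<lambda>\<zeta>. chart_coords i (f \<zeta>)) has_derivative (\<lambda>h. h *s chart_deriv i f z)) (at z)"
proof (rule has_derivative_vec_componentwise)
  fix j
  show "((\<lambda>\<zeta>. chart_coords i (f \<zeta>) $ j) has_derivative (\<lambda>h. (h *s chart_deriv i f z) $ j)) (at z)"
    using chart_has_field_derivative[OF assms, of j]
    by (simp add: has_field_derivative_def mult_commute_abs)
qed

lemma chart_deriv_self:
  assumes "holomorphic_curve f" "in_chart i (f z)"
  shows "chart_deriv i f z $ i = 0"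
proof -
  have "((\<lambda>\<zeta>. 1) has_field_derivative chart_deriv i f z $ i) (at z)"
    by (rule has_field_derivative_transform_within_open[OF chart_has_field_derivative[OF assms] open_chart_domain[OF assms(1)]])
       (use assms(2) in \<open>auto simp: chart_coords_self\<close>)
  then show ?thesis using DERIV_unique DERIV_const by blast
qed

lemma chart_deriv_change:
  assumes f: "holomorphic_curve f" and i: "in_chart i (f z)" and k: "in_chart k (f z)"
  shows "fs_density (chart_coords k (f z)) (chart_deriv k f z) = fs_density (chart_coords i (f z)) (chart_deriv i f z)"
proof -
  let ?w = "\<lambda>\<zeta>. chart_coords i (f \<zeta>)"
  have wk: "?w z $ k \<noteq> 0" using i k by (simp add: chart_coords_eq in_chart_iff)
       (metis abs_chart_coords chart_coords_eq chart_coords_nonzero div_0 i in_chart_abs in_chart_iff k)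
  define a where "a = inverse (?w z $ k)"
  define b where "b = - (chart_deriv i f z $ k) * a\<^sup>2"
  have ratio: "chart_coords k (f \<zeta>) $ j = ?w \<zeta> $ j / ?w \<zeta> $ k" if "in_chart i (f \<zeta>)" for \<zeta> j
    using chart_coords_abs[OF chart_coords_nonzero[OF that], of k] abs_chart_coords[OF that] by simp
  have "chart_coords k (f z) = a *s ?w z" using ratio[OF i] by (simp add: vec_eq_iff a_def divide_inverse)
  moreover have "chart_deriv k f z $ j = a * chart_deriv i f z $ j + b * ?w z $ j" for j
  proof -
    have "((\<lambda>\<zeta>. ?w \<zeta> $ j / ?w \<zeta> $ k) has_field_derivative a * chart_deriv i f z $ j + b * ?w z $ j) (at z)"
      using wk by (auto intro!: derivative_eq_intros chart_has_field_derivative[OF f i] simp: a_def b_def field_simps power2_eq_square)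
    moreover have "((\<lambda>\<zeta>. ?w \<zeta> $ j / ?w \<zeta> $ k) has_field_derivative chart_deriv k f z $ j) (at z)"
      by (rule has_field_derivative_transform_within_open[OF chart_has_field_derivative[OF f k] open_chart_domain[OF f]])
         (use i ratio in auto)
    ultimately show ?thesis using DERIV_unique by blast
  qed
  then have "chart_deriv k f z = a *s chart_deriv i f z + b *s ?w z" by (simp add: vec_eq_iff)
  ultimately show ?thesis
    using fs_density_change[OF chart_coords_nonzero[OF i], of a] wk by (simp add: a_def)
qed

lemma fs_density_nonneg: "0 \<le> fs_density w u"
  by (simp add: fs_density_def nsq_nonneg)

text \<open>
  The definition of \<open>df_norm\<close> uses an arbitrary chart around the point; by the invariance of
  \<open>fs_density\<close> any other chart may be used.
\<close>

lemma df_norm_eq: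
  assumes f: "holomorphic_curve f" and i: "in_chart i (f z)"
  shows "df_norm f z = sqrt (fs_density (chart_coords i (f z)) (chart_deriv i f z))"
proof -
  define k where "k = (SOME i. in_chart i (f z))"
  have k: "in_chart k (f z)" unfolding k_def using i by (rule someI)
  have D: "frechet_derivative (\<lambda>\<zeta>. chart_coords k (f \<zeta>)) (at z) = (\<lambda>h. h *s chart_deriv k f z)"
    by (rule frechet_derivative_at[symmetric, OF chart_has_derivative[OF f k]])
  have "FS_pullback f z 1 \<i> = of_real (fs_density (chart_coords k (f z)) (chart_deriv k f z))"
    unfolding FS_pullback_def Let_def k_def[symmetric] D vec.scale_one
    by (rule FS_form_eq) (use chart_coords_self[OF k] chart_deriv_self[OF f k] in simp_all)
  then show ?thesis unfolding df_norm_def by (simp add: chart_deriv_change[OF f i k])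
qed

lemma df_norm_sq:
  assumes f: "holomorphic_curve f" and i: "in_chart i (f z)"
  shows "(df_norm f z)\<^sup>2 = fs_density (chart_coords i (f z)) (chart_deriv i f z)"
  using df_norm_eq[OF assms] fs_density_nonneg by simp

section \<open>Brody curves are equi-Lipschitz\<close>

text \<open>
  The part of the derivative \<open>u\<close> of the lift that is parallel to the lift does not move the line, so
  it drops out of the derivative of the projection. What remains is linear in \<open>perp w u\<close>, whose
  norm relative to \<open>w\<close> is \<open>sqrt pi * df_norm f z\<close>.
\<close>

lemma proj_entry_has_derivative:
  fixes f :: "complex \<Rightarrow> 'n::finite cp"
  assumes f: "holomorphic_curve f"
  obtains D where "((\<lambda>\<zeta>. proj_entry j k (f \<zeta>)) has_derivative D) (at z)"
    "\<And>h. norm (D h) \<le> 2 * sqrt pi * df_norm f z * norm h"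
proof -
  obtain i where i: "in_chart i (f z)" using ex_in_chart by blast
  let ?F = "\<lambda>\<zeta>. chart_coords i (f \<zeta>)"
  define w where "w = ?F z"
  define u where "u = chart_deriv i f z"
  have w0: "w \<noteq> 0" unfolding w_def by (rule chart_coords_nonzero[OF i])
  have n0: "nsq w > 0" using w0 nsq_pos_iff by blast
  then have c0: "complex_of_real (nsq w) \<noteq> 0" by simp
  define t where "t = cdot u w / of_real (nsq w)"
  define p where "p = perp w u"
  have up: "u $ l = p $ l + t * w $ l" for l by (simp add: p_def perp_def t_def)
  have dF: "(?F has_derivative (\<lambda>h. h *s u)) (at z)" unfolding u_def by (rule chart_has_derivative[OF f i])
  have dn: "((\<lambda>\<zeta>. nsq (?F \<zeta>)) has_derivative (\<lambda>h. 2 * Re (h * t) * nsq w)) (at z)"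
  proof -
    have "((\<lambda>\<zeta>. \<Sum>l\<in>UNIV. ?F \<zeta> $ l \<bullet> ?F \<zeta> $ l) has_derivative (\<lambda>h. \<Sum>l\<in>UNIV. w $ l \<bullet> (h * u $ l) + (h * u $ l) \<bullet> w $ l)) (at z)"
      using has_derivative_vec_nth[OF dF] unfolding w_def
      by (intro has_derivative_sum has_derivative_inner) auto
    moreover have "(\<Sum>l\<in>UNIV. w $ l \<bullet> (h * u $ l) + (h * u $ l) \<bullet> w $ l) = 2 * Re (h * t) * nsq w" for h
    proof -
      have "(\<Sum>l\<in>UNIV. w $ l \<bullet> (h * u $ l) + (h * u $ l) \<bullet> w $ l) = (\<Sum>l\<in>UNIV. 2 * Re (h * (u $ l * cnj (w $ l))))"
        by (intro sum.cong refl) (simp add: inner_complex_def algebra_simps)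
      also have "\<dots> = 2 * Re (h * cdot u w)"
        by (simp add: cdot_def sum_distrib_left Re_sum)
      also have "cdot u w = t * of_real (nsq w)" using n0 by (simp add: t_def)
      finally show ?thesis by (simp add: algebra_simps)
    qed
    ultimately show ?thesis by (simp add: nsq_def power2_norm_eq_inner)
  qed
  define D where "D h = (p $ j * h * cnj (w $ k) + w $ j * cnj (p $ k * h)) / of_real (nsq w)" for h
  have num: "((\<lambda>\<zeta>. ?F \<zeta> $ j * cnj (?F \<zeta> $ k)) has_derivative
      (\<lambda>h. w $ j * cnj (h * u $ k) + (h * u $ j) * cnj (w $ k))) (at z)"
    using has_derivative_mult[OF has_derivative_vec_nth[OF dF, of j] has_derivative_cnj[OF has_derivative_vec_nth[OF dF, of k]]]
    by (simp add: w_def)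
  have den: "((\<lambda>\<zeta>. complex_of_real (nsq (?F \<zeta>))) has_derivative (\<lambda>h. of_real (2 * Re (h * t) * nsq w))) (at z)"
    by (rule has_derivative_of_real[OF dn])
  have "((\<lambda>\<zeta>. ?F \<zeta> $ j * cnj (?F \<zeta> $ k) / of_real (nsq (?F \<zeta>))) has_derivative
      (\<lambda>h. ((w $ j * cnj (h * u $ k) + (h * u $ j) * cnj (w $ k)) * of_real (nsq w)
        - w $ j * cnj (w $ k) * of_real (2 * Re (h * t) * nsq w)) / (of_real (nsq w) * of_real (nsq w)))) (at z)"
    using has_derivative_divide'[OF num den] c0 by (simp only: w_def[symmetric] not_False_eq_True simp_thms)
  moreover have "((w $ j * cnj (h * u $ k) + (h * u $ j) * cnj (w $ k)) * of_real (nsq w)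
        - w $ j * cnj (w $ k) * of_real (2 * Re (h * t) * nsq w)) / (of_real (nsq w) * of_real (nsq w)) = D h" for h
  proof -
    have "complex_of_real (2 * Re (h * t) * nsq w) = (h * t + cnj h * cnj t) * of_real (nsq w)"
      by (simp add: complex_eq_iff)
    then show ?thesis unfolding D_def up using c0 by (simp add: field_simps)
  qed
  ultimately have d: "((\<lambda>\<zeta>. ?F \<zeta> $ j * cnj (?F \<zeta> $ k) / of_real (nsq (?F \<zeta>))) has_derivative D) (at z)" by simp
  have "((\<lambda>\<zeta>. proj_entry j k (f \<zeta>)) has_derivative D) (at z)"
    by (rule has_derivative_transform_within_open[OF d open_chart_domain[OF f]]) (use i in \<open>auto simp: proj_entry_chart\<close>)
  moreover have "norm (D h) \<le> 2 * sqrt pi * df_norm f z * norm h" for h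
  proof -
    have le: "cmod (x $ l) \<le> sqrt (nsq x)" for x :: "complex ^ 'n" and l by (intro real_le_rsqrt component_sq_le_nsq)
    have "cmod (p $ j * h * cnj (w $ k) + w $ j * cnj (p $ k * h)) \<le> cmod (p $ j * h * cnj (w $ k)) + cmod (w $ j * cnj (p $ k * h))"
      by (rule norm_triangle_ineq)
    also have "\<dots> = (cmod (p $ j) * cmod (w $ k) + cmod (w $ j) * cmod (p $ k)) * cmod h"
      by (simp add: norm_mult algebra_simps)
    also have "\<dots> \<le> (sqrt (nsq p) * sqrt (nsq w) + sqrt (nsq w) * sqrt (nsq p)) * cmod h"
      using le nsq_nonneg by (intro mult_right_mono add_mono mult_mono) auto
    finally have "norm (D h) \<le> (2 * sqrt (nsq p) * sqrt (nsq w)) * cmod h / nsq w"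
      using n0 by (simp add: D_def norm_divide divide_right_mono)
    also have "\<dots> = 2 * (sqrt (nsq p) / sqrt (nsq w)) * cmod h"
      using n0 by (simp add: field_simps)
    also have "sqrt (nsq p) / sqrt (nsq w) = sqrt pi * df_norm f z"
      unfolding df_norm_eq[OF f i] fs_density_def w_def[symmetric] u_def[symmetric] p_def[symmetric]
      by (simp add: real_sqrt_divide real_sqrt_mult)
    finally show ?thesis by simp
  qed
  ultimately show thesis by (rule that)
qed

text \<open>
  The constant 4 is a bound for \<open>2 * sqrt pi\<close>.
\<close>

lemma proj_entry_lipschitz:
  assumes f: "holomorphic_curve f" and B: "\<And>z. df_norm f z \<le> B"
  shows "norm (proj_entry j k (f z) - proj_entry j k (f w)) \<le> 4 * B * norm (z - w)"
proof -
  have "\<exists>D. ((\<lambda>\<zeta>. proj_entry j k (f \<zeta>)) has_derivative D) (at z) \<and>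
    (\<forall>h. norm (D h) \<le> 2 * sqrt pi * df_norm f z * norm h)" for z
    using proj_entry_has_derivative[OF f] by metis
  then obtain D where D: "\<And>z. ((\<lambda>\<zeta>. proj_entry j k (f \<zeta>)) has_derivative D z) (at z)"
    "\<And>z h. norm (D z h) \<le> 2 * sqrt pi * df_norm f z * norm h" by metis
  have "sqrt pi \<le> sqrt 4" using pi_less_4 by (intro real_sqrt_le_mono) simp
  then have pi2: "2 * sqrt pi \<le> 4" by simp
  show ?thesis
  proof (rule differentiable_bound[OF convex_UNIV, where f' = D])
    fix x
    obtain i where i: "in_chart i (f x)" using ex_in_chart by blast
    have nn: "0 \<le> df_norm f x" by (simp add: df_norm_eq[OF f i] fs_density_nonneg)
    show "onorm (D x) \<le> 4 * B"
    proof (rule onorm_le)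
      fix h :: complex
      have "2 * sqrt pi * df_norm f x \<le> 4 * B" using pi2 nn B[of x] by (intro mult_mono) auto
      then have "2 * sqrt pi * df_norm f x * norm h \<le> 4 * B * norm h" by (rule mult_right_mono) simp
      then show "norm (D x h) \<le> 4 * B * norm h" using D(2)[of x h] by linarith
    qed
  qed (use D(1) in auto)
qed

lemma brody_lipschitz:
  assumes "f \<in> brody_curves"
  shows "norm (proj_entry j k (f z) - proj_entry j k (f w)) \<le> 4 * norm (z - w)"
  using proj_entry_lipschitz[of f 1] assms by (simp add: brody_curves_def)

lemma df_norm_nonneg: "holomorphic_curve f \<Longrightarrow> 0 \<le> df_norm f z"
  using ex_in_chart[of "f z"] by (auto simp: df_norm_eq fs_density_nonneg)

text \<open>
  Pointwise convergence is uniform on finite nets of a compact set, and the Lipschitz bound extends it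
  to the whole set.
\<close>

lemma equilipschitz_uniform_limit:
  fixes g :: "nat \<Rightarrow> complex \<Rightarrow> complex"
  assumes K: "compact K" and L: "0 \<le> L" and lip: "\<And>n z w. norm (g n z - g n w) \<le> L * norm (z - w)"
    and lim: "\<And>z. (\<lambda>n. g n z) \<longlonglongrightarrow> l z"
  shows "uniform_limit K g l sequentially"
proof (rule uniform_limitI)
  fix e :: real assume e: "0 < e"
  define \<rho> where "\<rho> = e / (4 * (L + 1))"
  have \<rho>: "0 < \<rho>" "L * \<rho> < e / 4" using e L by (auto simp: \<rho>_def field_simps)
  have lipl: "norm (l z - l w) \<le> L * norm (z - w)" for z w
    by (rule LIMSEQ_le_const2[OF tendsto_norm[OF tendsto_diff[OF lim lim]]]) (use lip in blast)
  have "K \<subseteq> (\<Union>c\<in>K. ball c \<rho>)" using \<rho>(1) by auto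
  then obtain C where C: "C \<subseteq> K" "finite C" "K \<subseteq> (\<Union>c\<in>C. ball c \<rho>)"
    using compactE_image[OF K, of K "\<lambda>c. ball c \<rho>"] by auto
  have "\<forall>\<^sub>F n in sequentially. \<forall>c\<in>C. dist (g n c) (l c) < e / 4"
    using C(2) e by (intro eventually_ball_finite ballI tendstoD[OF lim]) auto
  then show "\<forall>\<^sub>F n in sequentially. \<forall>z\<in>K. dist (g n z) (l z) < e"
  proof eventually_elim
    case (elim n)
    show ?case
    proof
      fix z assume "z \<in> K"
      then obtain c where c: "c \<in> C" "dist c z < \<rho>" using C(3) by auto
      have "norm (g n z - g n c) \<le> L * dist c z" "norm (l z - l c) \<le> L * dist c z"
        using lip[of n z c] lipl[of z c] by (simp_all add: dist_norm norm_minus_commute)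
      moreover have "dist (g n z) (l z) \<le> norm (g n z - g n c) + dist (g n c) (l c) + norm (l z - l c)"
        by norm
      moreover have "L * dist c z < e / 4"
        using mult_left_mono[OF less_imp_le[OF c(2)] L] \<rho>(2) by linarith
      ultimately show "dist (g n z) (l z) < e" using bspec[OF elim c(1)] e by linarith
    qed
  qed
qed

lemma tendsto_fs_density:
  assumes w: "(w \<longlongrightarrow> w0) F" and u: "(u \<longlongrightarrow> u0) F" and "w0 \<noteq> 0"
  shows "((\<lambda>n. fs_density (w n) (u n)) \<longlongrightarrow> fs_density w0 u0) F"
proof -
  have n0: "nsq w0 > 0" using assms(3) nsq_pos_iff by blast
  have nw: "((\<lambda>n. nsq (w n)) \<longlongrightarrow> nsq w0) F"
    unfolding nsq_def by (intro tendsto_intros w)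
  have c: "((\<lambda>n. cdot (u n) (w n) / of_real (nsq (w n))) \<longlongrightarrow> cdot u0 w0 / of_real (nsq w0)) F"
    unfolding cdot_def using n0 by (intro tendsto_intros w u nw) simp
  have p: "((\<lambda>n. perp (w n) (u n) $ l) \<longlongrightarrow> perp w0 u0 $ l) F" for l
    unfolding perp_def vector_minus_component vector_smult_component by (intro tendsto_intros w u c)
  have "((\<lambda>n. nsq (perp (w n) (u n))) \<longlongrightarrow> nsq (perp w0 u0)) F"
    unfolding nsq_def by (intro tendsto_intros p)
  then show ?thesis unfolding fs_density_def using n0 by (intro tendsto_intros nw) auto
qed

section \<open>Pointwise limits of Brody curves\<close>

context
  fixes F :: "nat \<Rightarrow> complex \<Rightarrow> 'n::finite cp" and f :: "complex \<Rightarrow> 'n cp"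
  assumes F: "\<And>n. F n \<in> brody_curves"
    and lim: "\<And>z j k. (\<lambda>n. proj_entry j k (F n z)) \<longlonglongrightarrow> proj_entry j k (f z)"
begin

lemma curve_holomorphic: "holomorphic_curve (F n)"
  using F[of n] by (simp add: brody_curves_def)

lemma limit_lipschitz: "norm (proj_entry j k (f z) - proj_entry j k (f w)) \<le> 4 * norm (z - w)"
  by (rule LIMSEQ_le_const2[OF tendsto_norm[OF tendsto_diff[OF lim lim]]]) (use brody_lipschitz[OF F] in blast)

lemma limit_continuous: "continuous_on UNIV f"
proof -
  have "continuous_on UNIV (\<lambda>z. proj_entry j k (f z))" for j k
    by (rule lipschitz_on_continuous_on[of 4]) (use limit_lipschitz in \<open>auto simp: lipschitz_on_def dist_norm\<close>)
  then have "(f \<longlongrightarrow> f z) (at z)" for z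
    by (intro tendsto_cp) (auto simp: continuous_on_def)
  then show ?thesis by (simp add: continuous_on_def)
qed

text \<open>
  The Lipschitz bound keeps the diagonal entry that defines the chart away from 0 on a disc of radius
  independent of \<open>n\<close>. On this disc the affine coordinates are quotients with denominators bounded
  below, and thus converge uniformly.
\<close>

lemma limit_in_chart:
  assumes i: "in_chart i (f z0)"
  obtains r where "0 < r" "\<And>z. z \<in> cball z0 r \<Longrightarrow> in_chart i (f z)"
    "\<forall>\<^sub>F n in sequentially. \<forall>z\<in>cball z0 r. in_chart i (F n z)"
    "\<And>j. uniform_limit (cball z0 r) (\<lambda>n z. chart_coords i (F n z) $ j) (\<lambda>z. chart_coords i (f z) $ j) sequentially"
proof -
  define m where "m = norm (proj_entry i i (f z0))"
  have m: "m > 0" using i by (simp add: m_def in_chart_iff)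
  \<comment> \<open>With Lipschitz constant 4 the entry varies by at most \<open>m / 4\<close> on the disc.\<close>
  define r where "r = m / 16"
  have r: "r > 0" using m by (simp add: r_def)
  have low: "m / 2 \<le> norm (proj_entry i i (f z))" if "z \<in> cball z0 r" for z
  proof -
    have "norm (proj_entry i i (f z0) - proj_entry i i (f z)) \<le> 4 * r"
      using limit_lipschitz[of i i z0 z] that by (simp add: dist_norm)
    then show ?thesis
      using norm_triangle_sub[of "proj_entry i i (f z0)" "proj_entry i i (f z)"] m
      unfolding r_def m_def[symmetric] by linarith
  qed
  have ev: "\<forall>\<^sub>F n in sequentially. 3 / 4 * m < norm (proj_entry i i (F n z0))"
    by (rule order_tendstoD(1)[OF tendsto_norm[OF lim]]) (use m in \<open>simp add: m_def[symmetric]\<close>)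
  have ul: "uniform_limit (cball z0 r) (\<lambda>n z. proj_entry j k (F n z)) (\<lambda>z. proj_entry j k (f z)) sequentially" for j k
    by (rule equilipschitz_uniform_limit[OF compact_cball, of 4]) (use brody_lipschitz[OF F] lim in auto)
  show thesis
  proof (rule that[OF r])
    show "in_chart i (f z)" if "z \<in> cball z0 r" for z using low[OF that] m by (auto simp: in_chart_iff)
    show "\<forall>\<^sub>F n in sequentially. \<forall>z\<in>cball z0 r. in_chart i (F n z)"
      using ev
    proof eventually_elim
      case (elim n)
      show ?case
      proof
        fix z assume "z \<in> cball z0 r"
        then have "norm (proj_entry i i (F n z0) - proj_entry i i (F n z)) \<le> 4 * r"
          using brody_lipschitz[OF F, of i i n z0 z] by (simp add: dist_norm)
        then have "norm (proj_entry i i (F n z)) > 0"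
          using elim norm_triangle_sub[of "proj_entry i i (F n z0)" "proj_entry i i (F n z)"] m
          unfolding r_def by linarith
        then show "in_chart i (F n z)" by (simp add: in_chart_iff)
      qed
    qed
    show "uniform_limit (cball z0 r) (\<lambda>n z. chart_coords i (F n z) $ j) (\<lambda>z. chart_coords i (f z) $ j) sequentially" for j
      unfolding chart_coords_eq
      by (rule uniform_lim_divide[OF ul ul _ low]) (use m norm_proj_entry_le in \<open>auto simp: bounded_iff\<close>)
  qed
qed

lemma holomorphic_curve_chart_subset:
  assumes "holomorphic_curve g" "\<forall>z\<in>S. in_chart i (g z)"
  shows "(\<lambda>z. chart_coords i (g z) $ j) holomorphic_on S"
  using assms unfolding holomorphic_curve_def by (auto intro: holomorphic_on_subset)

lemma limit_holomorphic: "holomorphic_curve f"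
  unfolding holomorphic_curve_def
proof (intro conjI allI limit_continuous)
  fix i j
  show "(\<lambda>z. chart_coords i (f z) $ j) holomorphic_on {z. in_chart i (f z)}"
    unfolding holomorphic_on_def
  proof
    fix z assume "z \<in> {z. in_chart i (f z)}"
    then have i: "in_chart i (f z)" by simp
    obtain r where r: "0 < r" "\<And>\<zeta>. \<zeta> \<in> cball z r \<Longrightarrow> in_chart i (f \<zeta>)"
      "\<forall>\<^sub>F n in sequentially. \<forall>\<zeta>\<in>cball z r. in_chart i (F n \<zeta>)"
      "\<And>j. uniform_limit (cball z r) (\<lambda>n z. chart_coords i (F n z) $ j) (\<lambda>z. chart_coords i (f z) $ j) sequentially"
      by (rule limit_in_chart[OF i]) (rule that)
    have "\<forall>\<^sub>F n in sequentially. continuous_on (cball z r) (\<lambda>z. chart_coords i (F n z) $ j) \<and>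
        (\<lambda>z. chart_coords i (F n z) $ j) holomorphic_on ball z r"
      using r(3)
    proof eventually_elim
      case (elim n)
      then have "(\<lambda>z. chart_coords i (F n z) $ j) holomorphic_on cball z r"
        by (rule holomorphic_curve_chart_subset[OF curve_holomorphic])
      then show ?case
        using holomorphic_on_imp_continuous_on holomorphic_on_subset[OF _ ball_subset_cball] by simp
    qed
    then have "(\<lambda>z. chart_coords i (f z) $ j) holomorphic_on ball z r"
      using holomorphic_uniform_limit[OF _ r(4)] by auto
    then have "(\<lambda>z. chart_coords i (f z) $ j) field_differentiable at z"
      by (rule holomorphic_on_imp_differentiable_at) (use r(1) in auto)
    then show "(\<lambda>z. chart_coords i (f z) $ j) field_differentiable at z within {z. in_chart i (f z)}"
      by (rule field_differentiable_at_within)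
  qed
qed

text \<open>
  Affine coordinates converge uniformly near the point, so by Cauchy's estimates their derivatives
  converge as well, and \<open>df_norm\<close> is a continuous function of both.
\<close>

lemma limit_df_norm: "(\<lambda>n. df_norm (F n) z) \<longlonglongrightarrow> df_norm f z"
proof -
  obtain i where i: "in_chart i (f z)" using ex_in_chart by blast
  obtain r where r: "0 < r" "\<And>\<zeta>. \<zeta> \<in> cball z r \<Longrightarrow> in_chart i (f \<zeta>)"
    "\<forall>\<^sub>F n in sequentially. \<forall>\<zeta>\<in>cball z r. in_chart i (F n \<zeta>)"
    "\<And>j. uniform_limit (cball z r) (\<lambda>n z. chart_coords i (F n z) $ j) (\<lambda>z. chart_coords i (f z) $ j) sequentially"
    by (rule limit_in_chart[OF i]) (rule that)
  have "(\<lambda>n. chart_deriv i (F n) z $ j) \<longlonglongrightarrow> chart_deriv i f z $ j" for j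
  proof -
    have "\<forall>\<^sub>F n in sequentially. (\<lambda>z. chart_coords i (F n z) $ j) holomorphic_on ball z r"
      using r(3)
    proof eventually_elim
      case (elim n)
      then have "\<forall>z\<in>ball z r. in_chart i (F n z)" by auto
      then show ?case by (rule holomorphic_curve_chart_subset[OF curve_holomorphic])
    qed
    from higher_deriv_complex_uniform_limit[OF uniform_limit_on_subset[OF r(4) ball_subset_cball] this, of z 1]
    show ?thesis using r(1) by (simp add: chart_deriv_def)
  qed
  then have u: "(\<lambda>n. chart_deriv i (F n) z) \<longlonglongrightarrow> chart_deriv i f z" by (rule vec_tendstoI)
  have w: "(\<lambda>n. chart_coords i (F n z)) \<longlonglongrightarrow> chart_coords i (f z)"
    by (rule vec_tendstoI) (use i in \<open>auto simp: chart_coords_eq in_chart_iff intro!: tendsto_divide lim\<close>)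
  have "(\<lambda>n. sqrt (fs_density (chart_coords i (F n z)) (chart_deriv i (F n) z))) \<longlonglongrightarrow> df_norm f z"
    unfolding df_norm_eq[OF limit_holomorphic i]
    by (intro tendsto_real_sqrt tendsto_fs_density u w chart_coords_nonzero i)
  then show ?thesis
  proof (rule Lim_transform_eventually)
    show "\<forall>\<^sub>F n in sequentially. sqrt (fs_density (chart_coords i (F n z)) (chart_deriv i (F n) z)) = df_norm (F n) z"
      using r(3)
    proof eventually_elim
      case (elim n)
      then show ?case using r(1) by (intro df_norm_eq[symmetric] curve_holomorphic) auto
    qed
  qed
qed

lemma limit_brody: "f \<in> brody_curves"
proof -
  have "df_norm f z \<le> 1" for z
    by (rule LIMSEQ_le_const2[OF limit_df_norm]) (use F in \<open>auto simp: brody_curves_def\<close>)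
  then show ?thesis using limit_holomorphic by (simp add: brody_curves_def)
qed

end

section \<open>Compactness of the space of Brody curves\<close>

lemma norm_le_sum_components:
  fixes x :: "'a::real_normed_vector ^ 'n::finite"
  shows "norm x \<le> (\<Sum>i\<in>UNIV. norm (x $ i))"
  unfolding norm_vec_def by (rule L2_set_le_sum) simp

text \<open>
  Ascoli's argument: a diagonal subsequence of the matrix entries converges on a countable dense set,
  and hence everywhere by the common Lipschitz bound. The limits are again matrices of points because
  the image of the embedding is closed.
\<close>

lemma brody_convergent_subsequence:
  fixes F :: "nat \<Rightarrow> complex \<Rightarrow> 'n::finite cp"
  assumes F: "\<And>n. F n \<in> brody_curves"
  obtains f r where "f \<in> brody_curves" "strict_mono (r :: nat \<Rightarrow> nat)"
    "\<And>z j k. (\<lambda>n. proj_entry j k (F (r n) z)) \<longlonglongrightarrow> proj_entry j k (f z)"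
proof -
  obtain Q :: "complex set" where Q: "countable Q" "\<And>X. open X \<Longrightarrow> X \<noteq> {} \<Longrightarrow> \<exists>d\<in>Q. d \<in> X"
    using countable_dense_setE by blast
  define g :: "nat \<Rightarrow> complex \<Rightarrow> complex ^ 'n ^ 'n" where "g n z = (\<chi> j k. proj_entry j k (F n z))" for n z
  have bound: "norm (g n z) \<le> (\<Sum>j\<in>(UNIV :: 'n set). \<Sum>k\<in>(UNIV :: 'n set). 1)" for n z
  proof -
    have "norm (g n z) \<le> (\<Sum>j\<in>UNIV. norm (g n z $ j))" by (rule norm_le_sum_components)
    also have "\<dots> \<le> (\<Sum>j\<in>UNIV. \<Sum>k\<in>UNIV. norm (g n z $ j $ k))"
      by (intro sum_mono norm_le_sum_components)
    also have "\<dots> \<le> (\<Sum>j\<in>(UNIV :: 'n set). \<Sum>k\<in>(UNIV :: 'n set). 1)"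
      by (intro sum_mono) (simp add: g_def norm_proj_entry_le)
    finally show ?thesis .
  qed
  obtain r :: "nat \<Rightarrow> nat" where r: "strict_mono r" "\<And>z. z \<in> Q \<Longrightarrow> \<exists>l. (\<lambda>n. g (r n) z) \<longlonglongrightarrow> l"
    by (rule function_convergent_subsequence[where f = g, OF Q(1) bound]) (rule that)
  have "convergent (\<lambda>n. proj_entry j k (F (r n) z))" for j k z
  proof (rule Cauchy_convergent, rule metric_CauchyI)
    fix e :: real assume e: "0 < e"
    obtain q where q: "q \<in> Q" "dist z q < e / 16" using Q(2)[of "ball z (e / 16)"] e by auto
    obtain l where "(\<lambda>n. g (r n) q) \<longlonglongrightarrow> l" using r(2)[OF q(1)] by blast
    then have "(\<lambda>n. g (r n) q $ j $ k) \<longlonglongrightarrow> l $ j $ k" by (intro tendsto_vec_nth)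
    then have "(\<lambda>n. proj_entry j k (F (r n) q)) \<longlonglongrightarrow> l $ j $ k" by (simp add: g_def)
    then have "Cauchy (\<lambda>n. proj_entry j k (F (r n) q))" by (rule LIMSEQ_imp_Cauchy)
    then obtain N where N: "\<And>m n. m \<ge> N \<Longrightarrow> n \<ge> N \<Longrightarrow>
        dist (proj_entry j k (F (r m) q)) (proj_entry j k (F (r n) q)) < e / 4"
      using metric_CauchyD[of "\<lambda>n. proj_entry j k (F (r n) q)" "e / 4"] e by auto
    have "dist (proj_entry j k (F (r m) z)) (proj_entry j k (F (r n) z)) < e" if mn: "m \<ge> N" "n \<ge> N" for m n
    proof -
      have "dist (proj_entry j k (F (r i) z)) (proj_entry j k (F (r i) q)) \<le> 4 * dist z q" for i
        using brody_lipschitz[OF F, of j k "r i" z q] by (simp add: dist_norm)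
      from this[of m] this[of n] show ?thesis
        using N[OF mn] q(2) e
          dist_triangle[of "proj_entry j k (F (r m) z)" "proj_entry j k (F (r n) z)" "proj_entry j k (F (r m) q)"]
          dist_triangle[of "proj_entry j k (F (r m) q)" "proj_entry j k (F (r n) z)" "proj_entry j k (F (r n) q)"]
          dist_commute[of "proj_entry j k (F (r n) z)" "proj_entry j k (F (r n) q)"]
        by linarith
    qed
    then show "\<exists>N. \<forall>m\<ge>N. \<forall>n\<ge>N. dist (proj_entry j k (F (r m) z)) (proj_entry j k (F (r n) z)) < e" by blast
  qed
  then have L: "(\<lambda>n. proj_entry j k (F (r n) z)) \<longlonglongrightarrow> lim (\<lambda>n. proj_entry j k (F (r n) z))" for j k z
    by (simp add: convergent_LIMSEQ_iff)
  have "\<exists>p. \<forall>j k. (\<lambda>n. proj_entry j k (F (r n) z)) \<longlonglongrightarrow> proj_entry j k p" for z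
  proof -
    obtain p where p: "\<And>j k. proj_entry j k p = lim (\<lambda>n. proj_entry j k (F (r n) z))"
      by (rule proj_entry_limit[OF L]) (rule that)
    then show ?thesis using L by (intro exI[of _ p]) simp
  qed
  then obtain f where f: "\<And>z j k. (\<lambda>n. proj_entry j k (F (r n) z)) \<longlonglongrightarrow> proj_entry j k (f z)" by metis
  have "f \<in> brody_curves" by (rule limit_brody[of "\<lambda>n. F (r n)"]) (rule F f)+
  then show thesis using r(1) f by (rule that)
qed

lemma continuous_curve: "f \<in> brody_curves \<Longrightarrow> continuous_on UNIV f"
  by (simp add: brody_curves_def holomorphic_curve_def)

lemma topspace_compact_open: "topspace compact_open_topology = {f. continuous_on UNIV f}"
proof -
  have "{f :: 'a \<Rightarrow> 'b. continuous_on UNIV f} \<in> {{f. continuous_on UNIV f \<and> f ` K \<subseteq> U} | K U. compact K \<and> open U}"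
    by (intro CollectI exI[of _ "{}"]) auto
  then show ?thesis unfolding compact_open_topology_def topology_generated_by_topspace by auto
qed

lemma topspace_brody: "topspace brody_topology = brody_curves"
  unfolding brody_topology_def by (auto simp: topspace_compact_open continuous_curve)

lemma limitin_topology_generated_by:
  assumes "l \<in> \<Union>\<S>" "\<And>U. U \<in> \<S> \<Longrightarrow> l \<in> U \<Longrightarrow> \<forall>\<^sub>F n in F. s n \<in> U"
  shows "limitin (topology_generated_by \<S>) s l F"
  unfolding limitin_def
proof (intro conjI allI impI; (elim conjE)?)
  show "l \<in> topspace (topology_generated_by \<S>)" using assms(1) by simp
  fix U assume "openin (topology_generated_by \<S>) U" "l \<in> U"
  then show "\<forall>\<^sub>F n in F. s n \<in> U"
    unfolding openin_topology_generated_by_iff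
  proof (induction rule: generate_topology_on.induct)
    case (Int a b)
    then show ?case by (auto intro: eventually_conj)
  next
    case (UN K)
    then obtain k where "k \<in> K" "l \<in> k" by blast
    then have "\<forall>\<^sub>F n in F. s n \<in> k" using UN.IH by blast
    then show ?case by eventually_elim (use \<open>k \<in> K\<close> in blast)
  qed (use assms(2) in auto)
qed

text \<open>
  If the curves did not eventually map a compact set \<open>K\<close> into the open set \<open>U\<close>, there would be
  points of \<open>K\<close> mapped outside \<open>U\<close>. They subconverge to some \<open>z\<close>, and by the common
  Lipschitz bound their images converge to \<open>f z \<in> U\<close>.
\<close>

lemma limitin_brody_iff:
  fixes F :: "nat \<Rightarrow> complex \<Rightarrow> 'n::finite cp"
  assumes F: "\<And>n. F n \<in> brody_curves" and f: "f \<in> brody_curves"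
  shows "limitin brody_topology F f sequentially \<longleftrightarrow>
    (\<forall>z j k. (\<lambda>n. proj_entry j k (F n z)) \<longlonglongrightarrow> proj_entry j k (f z))"
proof
  assume "limitin brody_topology F f sequentially"
  then have L: "limitin compact_open_topology F f sequentially"
    unfolding brody_topology_def limitin_subtopology by blast
  show "\<forall>z j k. (\<lambda>n. proj_entry j k (F n z)) \<longlonglongrightarrow> proj_entry j k (f z)"
  proof (intro allI)
    fix z j k
    have "(\<lambda>n. F n z) \<longlonglongrightarrow> f z"
    proof (rule topological_tendstoI)
      fix U :: "'n cp set" assume U: "open U" "f z \<in> U"
      let ?V = "{g. continuous_on UNIV g \<and> g ` {z} \<subseteq> U}"
      have "openin compact_open_topology ?V"
        unfolding compact_open_topology_def using U(1)
        by (intro topology_generated_by_Basis CollectI exI[of _ "{z}"] exI[of _ U]) simp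
      then have "\<forall>\<^sub>F n in sequentially. F n \<in> ?V"
        using L U(2) continuous_curve[OF f] unfolding limitin_def by auto
      then show "\<forall>\<^sub>F n in sequentially. F n z \<in> U" by eventually_elim auto
    qed
    then show "(\<lambda>n. proj_entry j k (F n z)) \<longlonglongrightarrow> proj_entry j k (f z)"
      using continuous_on_tendsto_compose[OF continuous_on_proj_entry] by fastforce
  qed
next
  assume lim: "\<forall>z j k. (\<lambda>n. proj_entry j k (F n z)) \<longlonglongrightarrow> proj_entry j k (f z)"
  have "limitin compact_open_topology F f sequentially"
    unfolding compact_open_topology_def
  proof (rule limitin_topology_generated_by)
    show "f \<in> \<Union> {{f. continuous_on UNIV f \<and> f ` K \<subseteq> U} |K U. compact K \<and> open U}"
      using continuous_curve[OF f]
      unfolding topspace_compact_open[unfolded compact_open_topology_def topology_generated_by_topspace] by simp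
    fix V assume "V \<in> {{f. continuous_on UNIV f \<and> f ` K \<subseteq> U} |K U. compact K \<and> open U}" "f \<in> V"
    then obtain K U where KU: "V = {f. continuous_on UNIV f \<and> f ` K \<subseteq> U}" "compact K" "open U" "f ` K \<subseteq> U" by auto
    show "\<forall>\<^sub>F n in sequentially. F n \<in> V"
    proof (rule ccontr)
      assume "\<not> ?thesis"
      then have "\<exists>\<^sub>F n in sequentially. F n \<notin> V" by (simp add: frequently_def)
      then obtain r :: "nat \<Rightarrow> nat" where r: "strict_mono r" "\<And>n. F (r n) \<notin> V"
        using infinite_enumerate[of "{n. F n \<notin> V}"] by (auto simp: frequently_cofinite[symmetric] cofinite_eq_sequentially)
      have "\<forall>n. \<exists>z\<in>K. F (r n) z \<notin> U" using r(2) KU(1) continuous_curve[OF F] by auto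
      then obtain x where x: "\<And>n. x n \<in> K" "\<And>n. F (r n) (x n) \<notin> U" by metis
      obtain z q where q: "z \<in> K" "strict_mono (q :: nat \<Rightarrow> nat)" "(\<lambda>n. x (q n)) \<longlonglongrightarrow> z"
        using KU(2) x(1) unfolding compact_def comp_def by meson
      have "(\<lambda>n. F (r (q n)) (x (q n))) \<longlonglongrightarrow> f z"
      proof (rule tendsto_cp)
        fix j k
        have sm: "strict_mono (\<lambda>n. r (q n))" using r(1) q(2) by (auto simp: strict_mono_def)
        have 1: "(\<lambda>n. proj_entry j k (F (r (q n)) z)) \<longlonglongrightarrow> proj_entry j k (f z)"
          using LIMSEQ_subseq_LIMSEQ[OF lim[rule_format] sm] by (simp add: comp_def)
        have "(\<lambda>n. 4 * norm (x (q n) - z)) \<longlonglongrightarrow> 0"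
          using tendsto_mult_left[OF tendsto_norm[OF LIM_zero[OF q(3)]], of 4] by simp
        then have "(\<lambda>n. proj_entry j k (F (r (q n)) (x (q n))) - proj_entry j k (F (r (q n)) z)) \<longlonglongrightarrow> 0"
          by (rule Lim_null_comparison[rotated]) (use brody_lipschitz[OF F] in auto)
        from tendsto_add[OF this 1] show "(\<lambda>n. proj_entry j k (F (r (q n)) (x (q n)))) \<longlonglongrightarrow> proj_entry j k (f z)" by simp
      qed
      moreover have "f z \<in> U" using KU(4) q(1) by blast
      ultimately have "\<forall>\<^sub>F n in sequentially. F (r (q n)) (x (q n)) \<in> U" using KU(3) by (metis topological_tendstoD)
      then show False using x(2) by (auto simp: eventually_sequentially)
    qed
  qed
  then show "limitin brody_topology F f sequentially"
    unfolding brody_topology_def limitin_subtopology using F f by auto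
qed

section \<open>Energy\<close>

lemma continuous_on_df_norm_sq:
  assumes f: "holomorphic_curve f"
  shows "continuous_on S (\<lambda>z. (df_norm f z)\<^sup>2)"
proof -
  have "((\<lambda>z. (df_norm f z)\<^sup>2) \<longlongrightarrow> (df_norm f z0)\<^sup>2) (at z0)" for z0
  proof -
    obtain i where i: "in_chart i (f z0)" using ex_in_chart by blast
    let ?U = "{z. in_chart i (f z)}"
    have U: "open ?U" by (rule open_chart_domain[OF f])
    have hol: "(\<lambda>z. chart_coords i (f z) $ j) holomorphic_on ?U" for j
      using f by (simp add: holomorphic_curve_def)
    have "(\<lambda>z. chart_coords i (f z) $ j) \<midarrow>z0\<rightarrow> chart_coords i (f z0) $ j" for j
      using holomorphic_on_imp_continuous_on[OF hol] U i by (auto simp: continuous_on_eq_continuous_at isCont_def)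
    then have w: "(\<lambda>z. chart_coords i (f z)) \<midarrow>z0\<rightarrow> chart_coords i (f z0)" by (rule vec_tendstoI)
    have "(\<lambda>z. chart_deriv i f z $ j) \<midarrow>z0\<rightarrow> chart_deriv i f z0 $ j" for j
      using holomorphic_on_imp_continuous_on[OF holomorphic_deriv[OF hol U]] U i
      by (auto simp: continuous_on_eq_continuous_at isCont_def chart_deriv_def)
    then have u: "(\<lambda>z. chart_deriv i f z) \<midarrow>z0\<rightarrow> chart_deriv i f z0" by (rule vec_tendstoI)
    have "(\<lambda>z. fs_density (chart_coords i (f z)) (chart_deriv i f z)) \<midarrow>z0\<rightarrow> (df_norm f z0)\<^sup>2"
      unfolding df_norm_sq[OF f i] by (intro tendsto_fs_density w u chart_coords_nonzero i)
    then show ?thesis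
    proof (rule Lim_transform_eventually)
      have "\<forall>\<^sub>F z in at z0. z \<in> ?U" using U i by (intro eventually_at_in_open') auto
      then show "\<forall>\<^sub>F z in at z0. fs_density (chart_coords i (f z)) (chart_deriv i f z) = (df_norm f z)\<^sup>2"
        by eventually_elim (simp add: df_norm_sq[OF f])
    qed
  qed
  then show ?thesis by (intro continuous_at_imp_continuous_on) (simp add: isCont_def)
qed

lemma integrable_df_norm_sq:
  assumes "holomorphic_curve f" "S \<in> lmeasurable" "bounded S"
  shows "(\<lambda>z. (df_norm f z)\<^sup>2) integrable_on S"
proof -
  obtain a b where ab: "S \<subseteq> cbox a b" using bounded_subset_cbox_symmetric[OF assms(3)] by blast
  have "(\<lambda>z. (df_norm f z)\<^sup>2) absolutely_integrable_on cbox a b"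
    by (rule absolutely_integrable_continuous) (rule continuous_on_df_norm_sq[OF assms(1)])
  then have "(\<lambda>z. (df_norm f z)\<^sup>2) absolutely_integrable_on S"
    by (rule set_integrable_subset) (use assms(2) ab in auto)
  then show ?thesis by (simp add: absolutely_integrable_on_def)
qed

text \<open>
  The set of points near which \<open>f\<close> equals \<open>p\<close> is open, and it is closed by the identity theorem
  in a chart around a limit point.
\<close>

lemma constant_of_locally_constant:
  fixes f :: "complex \<Rightarrow> 'n::finite cp"
  assumes f: "holomorphic_curve f" and r: "0 < r" and eq: "\<And>z. z \<in> ball a r \<Longrightarrow> f z = p"
  shows "f = (\<lambda>_. p)"
proof -
  define S where "S = {z. \<exists>e>0. \<forall>w\<in>ball z e. f w = p}"
  have S: "z \<in> S" if e: "0 < e" and const: "\<And>w. w \<in> ball b e \<Longrightarrow> f w = p" and z: "z \<in> ball b e" for z b e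
  proof -
    obtain e' where "e' > 0" "ball z e' \<subseteq> ball b e" using z open_contains_ball_eq[OF open_ball] by blast
    then show ?thesis using const unfolding S_def by blast
  qed
  have "open S"
    unfolding open_contains_ball
  proof
    fix z assume "z \<in> S"
    then obtain e where e: "e > 0" "\<forall>w\<in>ball z e. f w = p" by (auto simp: S_def)
    then have "ball z e \<subseteq> S" using S[of e z] by blast
    then show "\<exists>e>0. ball z e \<subseteq> S" using e(1) by blast
  qed
  moreover have "closed S"
    unfolding closed_limpt
  proof (intro allI impI)
    fix z assume z: "z islimpt S"
    obtain i where i: "in_chart i (f z)" using ex_in_chart by blast
    obtain e where e: "e > 0" "ball z e \<subseteq> {z. in_chart i (f z)}"
      using open_contains_ball_eq[OF open_chart_domain[OF f, of i]] i by blast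
    obtain s where s: "s \<in> S" "s \<in> ball z e"
      using z e(1) unfolding islimpt_approachable by (auto simp: dist_commute)
    obtain e1 where e1: "e1 > 0" "\<forall>w\<in>ball s e1. f w = p" using s(1) by (auto simp: S_def)
    obtain e2 where e2: "e2 > 0" "ball s e2 \<subseteq> ball z e" using s(2) open_contains_ball_eq[OF open_ball] by blast
    let ?V = "ball s (min e1 e2)"
    have V: "?V \<subseteq> ball z e" "\<And>w. w \<in> ?V \<Longrightarrow> f w = p" using e1 e2 by auto
    have "chart_coords i (f w) $ j = chart_coords i p $ j" if w: "w \<in> ball z e" for w j
    proof (rule analytic_continuation_open[where s = ?V and s' = "ball z e" and z = w
          and f = "\<lambda>z. chart_coords i (f z) $ j" and g = "\<lambda>_. chart_coords i p $ j"])
      show "(\<lambda>z. chart_coords i (f z) $ j) holomorphic_on ball z e"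
        using f e(2) unfolding holomorphic_curve_def by (blast intro: holomorphic_on_subset)
      show "?V \<noteq> {}" using e1(1) e2(1) by simp
      show "\<And>z. z \<in> ?V \<Longrightarrow> chart_coords i (f z) $ j = chart_coords i p $ j" using V(2) by simp
    qed (use V(1) w in simp_all)
    then have cc: "chart_coords i (f w) = chart_coords i p" if "w \<in> ball z e" for w using that by (simp add: vec_eq_iff)
    have ip: "in_chart i p" using e(2) s(2) V(2)[of s] e1(1) e2(1) by auto
    have "f w = p" if w: "w \<in> ball z e" for w
    proof -
      have "in_chart i (f w)" using e(2) w by blast
      then have "f w = abs_cp (chart_coords i (f w))" by (rule abs_chart_coords[symmetric])
      also have "\<dots> = p" unfolding cc[OF w] by (rule abs_chart_coords[OF ip])
      finally show ?thesis .
    qed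
    then show "z \<in> S" using S[of e z z] e(1) by simp
  qed
  moreover have "a \<in> S" using S[of r a a] r eq by simp
  ultimately have "S = UNIV" using connected_UNIV unfolding connected_clopen by auto
  show ?thesis
  proof
    fix z
    have "z \<in> S" using \<open>S = UNIV\<close> by simp
    then show "f z = p" by (auto simp: S_def)
  qed
qed

lemma constant_of_df_norm_zero:
  fixes f :: "complex \<Rightarrow> 'n::finite cp"
  assumes f: "holomorphic_curve f" and r: "0 < r" and eq: "\<And>z. z \<in> ball a r \<Longrightarrow> df_norm f z = 0"
  shows "f = (\<lambda>_. f a)"
proof (rule constant_of_locally_constant[OF f r])
  fix z assume z: "z \<in> ball a r"
  show "f z = f a"
  proof (rule proj_entry_inj)
    fix j k
    have "((\<lambda>\<zeta>. proj_entry j k (f \<zeta>)) has_derivative (\<lambda>h. 0)) (at x within ball a r)" if x: "x \<in> ball a r" for x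
    proof -
      obtain D where D: "((\<lambda>\<zeta>. proj_entry j k (f \<zeta>)) has_derivative D) (at x)"
        "\<And>h. norm (D h) \<le> 2 * sqrt pi * df_norm f x * norm h"
        by (rule proj_entry_has_derivative[OF f]) (rule that)
      have "D = (\<lambda>h. 0)" using D(2) eq[OF x] by (simp add: fun_eq_iff)
      then show ?thesis using D(1) by (simp add: has_derivative_at_withinI)
    qed
    from has_derivative_zero_constant[OF convex_ball this]
    obtain c where "\<forall>x\<in>ball a r. proj_entry j k (f x) = c" by blast
    then show "proj_entry j k (f z) = proj_entry j k (f a)" using z r by simp
  qed
qed

lemma df_norm_translate:
  assumes f: "holomorphic_curve f" and t: "holomorphic_curve (translate a f)"
  shows "df_norm (translate a f) z = df_norm f (z + a)"
proof -
  obtain i where i: "in_chart i (f (z + a))" using ex_in_chart by blast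
  then have i': "in_chart i (translate a f z)" by (simp add: translate_def)
  have "chart_deriv i (translate a f) z $ j = chart_deriv i f (z + a) $ j" for j
  proof (rule DERIV_unique[OF chart_has_field_derivative[OF t i']])
    show "((\<lambda>\<zeta>. chart_coords i (translate a f \<zeta>) $ j) has_field_derivative chart_deriv i f (z + a) $ j) (at z)"
      using chart_has_field_derivative[OF f i, of j] unfolding translate_def by (simp add: DERIV_shift)
  qed
  then have "chart_deriv i (translate a f) z = chart_deriv i f (z + a)" by (simp add: vec_eq_iff)
  then show ?thesis using df_norm_eq[OF f i] df_norm_eq[OF t i'] by (simp add: translate_def)
qed

text \<open>
  The open square is used, so that the squares at distinct lattice points are disjoint.
\<close>

definition unit_box :: "complex \<Rightarrow> complex set" where
  "unit_box a = box a (a + Complex 1 1)"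

definition energy :: "complex set \<Rightarrow> (complex \<Rightarrow> 'n::finite cp) \<Rightarrow> real" where
  "energy S f = integral S (\<lambda>z. (df_norm f z)\<^sup>2)"

lemma energy_translate:
  assumes f: "holomorphic_curve f" and t: "holomorphic_curve (translate a f)"
  shows "energy (unit_box 0) (translate a f) = energy (unit_box a) f"
  using integral_shift_cbox_plus[of 0 "Complex 1 1" "\<lambda>z. (df_norm f z)\<^sup>2" a]
  by (simp add: energy_def unit_box_def integral_open_interval df_norm_translate[OF f t] comp_def add.commute)

lemma energy_unit_box_pos:
  assumes f: "holomorphic_curve f" and nonconst: "\<And>p. f \<noteq> (\<lambda>_. p)"
  shows "0 < energy (unit_box 0) f"
proof (rule ccontr)
  let ?g = "\<lambda>z. (df_norm f z)\<^sup>2"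
  assume "\<not> ?thesis"
  moreover have "0 \<le> energy (unit_box 0) f" unfolding energy_def by (rule integral_nonneg) (auto simp: unit_box_def integrable_on_open_interval intro: integrable_continuous continuous_on_df_norm_sq[OF f])
  ultimately have "integral (cbox 0 (Complex 1 1)) ?g = 0"
    by (simp add: energy_def unit_box_def integral_open_interval)
  moreover have "box 0 (Complex 1 1) \<noteq> {}" by (simp add: box_ne_empty Basis_complex_def)
  ultimately have z: "\<forall>z\<in>cbox 0 (Complex 1 1). ?g z = 0"
    using integral_cbox_eq_0_iff[OF continuous_on_df_norm_sq[OF f], of 0 "Complex 1 1"] by simp
  have "Complex (1/2) (1/2) \<in> box 0 (Complex 1 1)" by (simp add: in_box_complex_iff)
  then obtain r where r: "r > 0" "ball (Complex (1/2) (1/2)) r \<subseteq> box 0 (Complex 1 1)"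
    using open_contains_ball_eq[OF open_box] by blast
  have "df_norm f w = 0" if "w \<in> ball (Complex (1/2) (1/2)) r" for w
    using that r(2) box_subset_cbox z by fastforce
  then show False using constant_of_df_norm_zero[OF f r(1)] nonconst by blast
qed

lemma energy_limit:
  assumes F: "\<And>n. F n \<in> brody_curves"
    and lim: "\<And>z j k. (\<lambda>n. proj_entry j k (F n z)) \<longlonglongrightarrow> proj_entry j k (f z)"
  shows "(\<lambda>n. energy (unit_box 0) (F n)) \<longlonglongrightarrow> energy (unit_box 0) f"
  unfolding energy_def unit_box_def integral_open_interval
proof (rule dominated_convergence(2)[where h = "\<lambda>_. 1"])
  fix n
  show "(\<lambda>z. (df_norm (F n) z)\<^sup>2) integrable_on cbox 0 (0 + Complex 1 1)"
    using F[of n] by (intro integrable_continuous continuous_on_df_norm_sq) (simp add: brody_curves_def)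
  fix z
  have "0 \<le> df_norm (F n) z" "df_norm (F n) z \<le> 1" using F[of n] by (auto simp: brody_curves_def df_norm_nonneg)
  then show "norm ((df_norm (F n) z)\<^sup>2) \<le> 1" by (simp add: power_le_one)
next
  fix z
  show "(\<lambda>n. (df_norm (F n) z)\<^sup>2) \<longlonglongrightarrow> (df_norm f z)\<^sup>2"
    by (intro tendsto_power limit_df_norm[OF F lim])
qed (simp add: integrable_on_const)

lemma unit_box_iff:
  "z \<in> unit_box (Complex (of_int p) (of_int q)) \<longleftrightarrow>
     of_int p < Re z \<and> Re z < of_int p + 1 \<and> of_int q < Im z \<and> Im z < of_int q + 1"
  by (auto simp: unit_box_def in_box_complex_iff)

lemma unit_box_integer_disjoint:
  assumes "(p, q) \<noteq> (p', q')"
  shows "unit_box (Complex (of_int p) (of_int q)) \<inter> unit_box (Complex (of_int p') (of_int q')) = {}"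
proof (rule ccontr)
  assume "\<not> ?thesis"
  then obtain z where "z \<in> unit_box (Complex (of_int p) (of_int q))" "z \<in> unit_box (Complex (of_int p') (of_int q'))" by blast
  then have "p = p'" "q = q'" unfolding unit_box_iff by linarith+
  then show False using assms by simp
qed

lemma energy_cball_ge:
  assumes f: "holomorphic_curve f"
    and V: "V \<subseteq> {- int (2 ^ j)<..<int (2 ^ j)} \<times> {- int (2 ^ j)<..<int (2 ^ j)}"
    and c: "\<And>p q. (p, q) \<in> V \<Longrightarrow> c \<le> energy (unit_box (Complex (of_int p) (of_int q))) f"
    and t: "2 * 2 ^ j \<le> t"
  shows "c * real (card V) \<le> energy (cball 0 t) f"
proof -
  let ?g = "\<lambda>z. (df_norm f z)\<^sup>2"
  let ?B = "\<lambda>pq :: int \<times> int. unit_box (Complex (of_int (fst pq)) (of_int (snd pq)))"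
  have fin: "finite V" using V finite_subset by blast
  have "(?g has_integral (\<Sum>pq\<in>V. energy (?B pq) f)) (\<Union>pq\<in>V. ?B pq)"
  proof (rule has_integral_UN[OF fin])
    fix pq
    have "?g integrable_on ?B pq"
      unfolding unit_box_def by (rule integrable_df_norm_sq[OF f]) auto
    then show "(?g has_integral energy (?B pq) f) (?B pq)"
      unfolding energy_def by (rule integrable_integral)
  next
    show "pairwise (\<lambda>pq pq'. negligible (?B pq \<inter> ?B pq')) V"
      unfolding pairwise_def using unit_box_integer_disjoint by (metis negligible_empty prod.collapse)
  qed
  moreover have "(?g has_integral energy (cball 0 t) f) (cball 0 t)"
    unfolding energy_def by (rule integrable_integral, rule integrable_df_norm_sq[OF f]) auto
  moreover have "(\<Union>pq\<in>V. ?B pq) \<subseteq> cball 0 t"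
  proof
    fix z assume "z \<in> (\<Union>pq\<in>V. ?B pq)"
    then obtain p q where pq: "(p, q) \<in> V" "z \<in> unit_box (Complex (of_int p) (of_int q))" by force
    have "\<bar>x\<bar> \<le> 2 ^ j" if i: "i \<in> {- int (2 ^ j)<..<int (2 ^ j)}" and x: "of_int i < x" "x < of_int i + 1" for i and x :: real
    proof -
      have "- int (2 ^ j) \<le> i" "i + 1 \<le> int (2 ^ j)" using i by auto
      then have "real_of_int (- int (2 ^ j)) \<le> of_int i" "real_of_int (i + 1) \<le> of_int (int (2 ^ j))"
        by (simp_all only: of_int_le_iff)
      then show ?thesis using x by simp
    qed
    then have "\<bar>Re z\<bar> \<le> 2 ^ j" "\<bar>Im z\<bar> \<le> 2 ^ j" using pq V unfolding unit_box_iff by blast+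
    then show "z \<in> cball 0 t" using cmod_le[of z] t by simp
  qed
  ultimately have "(\<Sum>pq\<in>V. energy (?B pq) f) \<le> energy (cball 0 t) f"
    by (intro has_integral_subset_le) auto
  moreover have "(\<Sum>pq\<in>V. c) \<le> (\<Sum>pq\<in>V. energy (?B pq) f)"
    using c by (intro sum_mono) (metis prod.collapse)
  ultimately show ?thesis by (simp add: mult.commute)
qed

lemma energy_cball_mono:
  assumes "holomorphic_curve f" "s \<le> t"
  shows "energy (cball 0 s) f \<le> energy (cball 0 t) f"
  unfolding energy_def
  by (rule integral_subset_le) (use assms in \<open>auto intro: integrable_df_norm_sq\<close>)

lemma energy_nonneg: "0 \<le> energy S f"
proof (cases "(\<lambda>z. (df_norm f z)\<^sup>2) integrable_on S")
  case True
  then show ?thesis unfolding energy_def by (rule integral_nonneg) simp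
next
  case False
  then show ?thesis unfolding energy_def by (simp add: not_integrable_integral)
qed

text \<open>
  The energy of discs is monotone in the radius, which gives the integrability that is needed to
  compare integrals. The contribution of radii between 1 and 2 is nonnegative and is dropped.
\<close>

lemma char_function_ge:
  assumes f: "holomorphic_curve f" and \<kappa>: "\<And>t. 2 \<le> t \<Longrightarrow> \<kappa> * t\<^sup>2 \<le> energy (cball 0 t) f" and r: "2 \<le> r"
  shows "\<kappa> * (r\<^sup>2 - 4) / 2 \<le> char_function r f"
proof -
  let ?I = "\<lambda>t. energy (cball 0 t) f"
  have "?I integrable_on {1..r}"
    by (rule integrable_on_mono_on) (simp add: mono_on_def energy_cball_mono[OF f])
  then have "?I absolutely_integrable_on {1..r}"
    by (rule nonnegative_absolutely_integrable_1) (simp add: energy_nonneg)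
  moreover have "(\<lambda>t::real. 1 / t) \<in> borel_measurable (lebesgue_on {1..r})"
    by (intro continuous_imp_measurable_on_sets_lebesgue continuous_intros) auto
  moreover have "bounded ((\<lambda>t::real. 1 / t) ` {1..r})"
    by (intro compact_imp_bounded compact_continuous_image continuous_intros) auto
  ultimately have "(\<lambda>t. 1 / t * ?I t) absolutely_integrable_on {1..r}"
    by (intro absolutely_integrable_bounded_measurable_product_real) auto
  then have int: "(\<lambda>t. 1 / t * ?I t) integrable_on {1..r}" by (simp add: absolutely_integrable_on_def)
  then have int2: "(\<lambda>t. 1 / t * ?I t) integrable_on {2..r}"
    by (rule integrable_on_subinterval) auto
  have hi: "((\<lambda>t. \<kappa> * t) has_integral \<kappa> * r\<^sup>2 / 2 - \<kappa> * 2\<^sup>2 / 2) {2..r}"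
    by (rule fundamental_theorem_of_calculus[OF r])
       (auto intro!: derivative_eq_intros simp flip: has_real_derivative_iff_has_vector_derivative)
  have "\<kappa> * (r\<^sup>2 - 4) / 2 = \<kappa> * r\<^sup>2 / 2 - \<kappa> * 2\<^sup>2 / 2"
    by (simp add: algebra_simps diff_divide_distrib)
  also have "\<dots> = integral {2..r} (\<lambda>t. \<kappa> * t)" by (rule integral_unique[OF hi, symmetric])
  also have "\<dots> \<le> integral {2..r} (\<lambda>t. 1 / t * ?I t)"
  proof (rule integral_le[OF _ int2])
    show "(\<lambda>t. \<kappa> * t) integrable_on {2..r}" by (intro integrable_continuous_real continuous_intros)
    fix t assume "t \<in> {2..r}"
    then show "\<kappa> * t \<le> 1 / t * ?I t" using \<kappa>[of t] by (simp add: field_simps power2_eq_square)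
  qed
  also have "\<dots> \<le> integral {1..r} (\<lambda>t. 1 / t * ?I t)"
    by (rule integral_subset_le[OF _ int2 int]) (auto simp: energy_nonneg)
  finally show ?thesis by (simp add: char_function_def energy_def)
qed

text \<open>
  The squares at the points of \<open>V j\<close> are disjoint and contained in the disc of radius
  \<open>2 * 2 ^ j\<close>, so the energy of discs grows at least quadratically in the radius. Then so does the
  characteristic function.
\<close>

lemma mean_energy_pos:
  assumes f: "holomorphic_curve f" and c: "0 < c" and \<delta>: "0 < \<delta>"
    and V: "\<And>j. V j \<subseteq> {- int (2 ^ j)<..<int (2 ^ j)} \<times> {- int (2 ^ j)<..<int (2 ^ j)}"
    and card: "\<And>j. \<delta> * 4 ^ j \<le> real (card (V j))"
    and en: "\<And>j p q. (p, q) \<in> V j \<Longrightarrow> c \<le> energy (unit_box (Complex (of_int p) (of_int q))) f"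
  shows "0 < mean_energy f"
proof -
  \<comment> \<open>For \<open>t\<close> between \<open>2 * 2 ^ j\<close> and \<open>4 * 2 ^ j\<close> one has \<open>4 ^ j \<ge> t\<^sup>2 / 16\<close>.\<close>
  define \<kappa> where "\<kappa> = c * \<delta> / 16"
  have \<kappa>0: "0 < \<kappa>" using c \<delta> by (simp add: \<kappa>_def)
  have \<kappa>: "\<kappa> * t\<^sup>2 \<le> energy (cball 0 t) f" if t: "2 \<le> t" for t
  proof -
    obtain j :: nat where j: "2 ^ j \<le> t / 2" "t / 2 < 2 ^ Suc j"
    proof -
      have ex: "\<exists>n. t / 2 < 2 ^ n" using real_arch_pow[of 2 "t / 2"] by simp
      define n where "n = (LEAST n. t / 2 < 2 ^ n)"
      have n: "t / 2 < 2 ^ n" unfolding n_def using ex by (rule LeastI_ex)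
      then have "n \<noteq> 0" using t by (cases n) auto
      then obtain j where j: "n = Suc j" using not0_implies_Suc by blast
      then have "\<not> t / 2 < 2 ^ j" unfolding n_def using not_less_Least by (metis lessI)
      then show thesis using that[of j] n j by simp
    qed
    have "t\<^sup>2 \<le> (4 * 2 ^ j)\<^sup>2" using j(2) t by (intro power_mono) auto
    also have "\<dots> = 16 * 4 ^ j" by (simp add: power_mult_distrib power2_eq_square flip: power_mult_distrib)
    finally have "\<kappa> * t\<^sup>2 \<le> \<kappa> * (16 * 4 ^ j)" using \<kappa>0 by (intro mult_left_mono) auto
    also have "\<dots> = c * (\<delta> * 4 ^ j)" by (simp add: \<kappa>_def)
    also have "\<dots> \<le> c * real (card (V j))" using card c by (intro mult_left_mono) auto
    also have "\<dots> \<le> energy (cball 0 t) f" by (rule energy_cball_ge[OF f V en]) (use j(1) in auto)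
    finally show ?thesis .
  qed
  have "\<kappa> / (2 * pi) \<le> 2 / (pi * r\<^sup>2) * char_function r f" if r: "3 \<le> r" for r
  proof -
    have "3 * 3 \<le> r * r" using r by (intro mult_mono) auto
    then have r2: "9 \<le> r\<^sup>2" by (simp add: power2_eq_square)
    have half: "\<kappa> * (2 * x) / (2 * pi * y) = 2 / (pi * y) * (\<kappa> * x / 2)" for x y by simp
    have "\<kappa> / (2 * pi) = \<kappa> * r\<^sup>2 / (2 * pi * r\<^sup>2)" using r2 r by simp
    also have "\<dots> \<le> \<kappa> * (2 * (r\<^sup>2 - 4)) / (2 * pi * r\<^sup>2)"
      using r2 \<kappa>0 by (intro divide_right_mono mult_left_mono) auto
    also have "\<dots> = 2 / (pi * r\<^sup>2) * (\<kappa> * (r\<^sup>2 - 4) / 2)" by (rule half)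
    also have "\<dots> \<le> 2 / (pi * r\<^sup>2) * char_function r f"
      using char_function_ge[OF f \<kappa>, of r] r by (intro mult_left_mono) auto
    finally show ?thesis .
  qed
  then have "\<forall>\<^sub>F r in at_top. ereal (\<kappa> / (2 * pi)) \<le> ereal (2 / (pi * r\<^sup>2) * char_function r f)"
    by (intro eventually_mono[OF eventually_ge_at_top[of 3]]) simp
  then have "ereal (\<kappa> / (2 * pi)) \<le> mean_energy f"
    unfolding mean_energy_def by (intro le_Limsup) (auto simp: trivial_limit_at_top_linorder)
  moreover have "0 < ereal (\<kappa> / (2 * pi))" using \<kappa>0 by simp
  ultimately show ?thesis by (rule less_le_trans[rotated])
qed

section \<open>Closed invariant sets of Brody curves\<close>

context
  fixes M :: "(complex \<Rightarrow> 'n::finite cp) set"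
    and d :: "(complex \<Rightarrow> 'n cp) \<Rightarrow> (complex \<Rightarrow> 'n cp) \<Rightarrow> real"
  assumes closed: "closedin brody_topology M"
    and invariant: "\<And>a f. f \<in> M \<Longrightarrow> translate a f \<in> M"
    and metric: "Metric_space M d"
    and compatible: "Metric_space.mtopology M d = subtopology brody_topology M"
begin

lemma M_brody: "f \<in> M \<Longrightarrow> f \<in> brody_curves"
  using closedin_subset[OF closed] by (auto simp: topspace_brody)

lemma M_holomorphic: "f \<in> M \<Longrightarrow> holomorphic_curve f"
  using M_brody by (auto simp: brody_curves_def)

text \<open>
  Since \<open>M\<close> is closed and carries the topology of Brody curves, statements about the given metric
  reduce to pointwise convergence of matrix entries.
\<close>

lemma limitin_M_iff:
  assumes "\<And>n. s n \<in> M"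
  shows "limitin (Metric_space.mtopology M d) s f sequentially \<longleftrightarrow>
    f \<in> M \<and> (\<forall>z j k. (\<lambda>n. proj_entry j k (s n z)) \<longlonglongrightarrow> proj_entry j k (f z))"
  unfolding compatible limitin_subtopology
  using limitin_brody_iff[of s f] assms M_brody by auto

lemma convergent_subsequence_in_M:
  assumes s: "\<And>n. s n \<in> M"
  obtains f r where "f \<in> M" "strict_mono (r :: nat \<Rightarrow> nat)"
    "\<And>z j k. (\<lambda>n. proj_entry j k (s (r n) z)) \<longlonglongrightarrow> proj_entry j k (f z)"
proof -
  obtain f r where f: "f \<in> brody_curves" "strict_mono (r :: nat \<Rightarrow> nat)"
    "\<And>z j k. (\<lambda>n. proj_entry j k (s (r n) z)) \<longlonglongrightarrow> proj_entry j k (f z)"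
    by (rule brody_convergent_subsequence[of s, OF M_brody[OF s]]) (rule that)
  have "limitin brody_topology (\<lambda>n. s (r n)) f sequentially"
    using limitin_brody_iff[of "\<lambda>n. s (r n)" f] f M_brody[OF s] by blast
  then have "f \<in> M" by (rule limitin_closedin[OF _ closed]) (use s in auto)
  then show thesis using f(2,3) by (rule that)
qed

lemma planar_flow_translate: "planar_flow M d translate"
proof -
  interpret Metric_space M d by (rule metric)
  show ?thesis
  proof
    show "compact_space mtopology"
      unfolding compact_space_sequentially
    proof (intro allI impI)
      fix s :: "nat \<Rightarrow> complex \<Rightarrow> 'n cp" assume "range s \<subseteq> M"
      then have s: "s n \<in> M" for n by blast
      obtain f r where f: "f \<in> M" "strict_mono (r :: nat \<Rightarrow> nat)"
        "\<And>z j k. (\<lambda>n. proj_entry j k (s (r n) z)) \<longlonglongrightarrow> proj_entry j k (f z)"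
        by (rule convergent_subsequence_in_M[of s, OF s]) (rule that)
      then have "limitin mtopology (s \<circ> r) f sequentially"
        using limitin_M_iff[of "s \<circ> r" f] s by simp
      then show "\<exists>l r. l \<in> M \<and> strict_mono r \<and> limitin mtopology (s \<circ> r) l sequentially" using f by blast
    qed
    show "translate a x \<in> M" if "x \<in> M" for a x using invariant that .
    show "translate a (translate b x) = translate (a + b) x" for a b and x :: "complex \<Rightarrow> 'n cp"
      by (simp add: translate_def add.assoc fun_eq_iff)
    show "translate 0 x = x" for x :: "complex \<Rightarrow> 'n cp" by (simp add: translate_def)
    fix s :: "nat \<Rightarrow> complex \<Rightarrow> 'n cp" and f and c :: "nat \<Rightarrow> complex" and c0
    assume "limitin mtopology s f sequentially" "range s \<subseteq> M" and c: "c \<longlonglongrightarrow> c0"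
    then have s: "\<And>n. s n \<in> M" by blast
    then have f: "f \<in> M" and lim: "\<And>z j k. (\<lambda>n. proj_entry j k (s n z)) \<longlonglongrightarrow> proj_entry j k (f z)"
      using limitin_M_iff[of s f] \<open>limitin mtopology s f sequentially\<close> by auto
    have "(\<lambda>n. proj_entry j k (s n (z + c n))) \<longlonglongrightarrow> proj_entry j k (f (z + c0))" for z j k
    proof -
      have "(\<lambda>n. 4 * norm (c n - c0)) \<longlonglongrightarrow> 0"
        using tendsto_mult_left[OF tendsto_norm[OF LIM_zero[OF c]], of 4] by simp
      then have "(\<lambda>n. proj_entry j k (s n (z + c n)) - proj_entry j k (s n (z + c0))) \<longlonglongrightarrow> 0"
      proof (rule Lim_null_comparison[rotated], intro always_eventually allI)
        fix n
        show "norm (proj_entry j k (s n (z + c n)) - proj_entry j k (s n (z + c0))) \<le> 4 * norm (c n - c0)"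
          using brody_lipschitz[OF M_brody[OF s], of j k n "z + c n" "z + c0"] by simp
      qed
      from tendsto_add[OF this lim[of j k "z + c0"]] show ?thesis by simp
    qed
    then show "limitin mtopology (\<lambda>n. translate (c n) (s n)) (translate c0 f) sequentially"
      using limitin_M_iff[of "\<lambda>n. translate (c n) (s n)" "translate c0 f"] invariant s f
      by (simp add: translate_def)
  qed
qed

interpretation planar_flow M d translate by (rule planar_flow_translate)

definition const_curves :: "(complex \<Rightarrow> 'n cp) set" where
  "const_curves = {f \<in> M. \<exists>p. f = (\<lambda>_. p)}"

lemma closedin_const_curves: "closedin mtopology const_curves"
  unfolding metric_closedin_iff_sequentially_closed
proof (intro conjI allI impI)
  show "const_curves \<subseteq> M" by (auto simp: const_curves_def)
  fix s l assume "range s \<subseteq> const_curves \<and> limitin mtopology s l sequentially"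
  then have s: "\<And>n. s n \<in> const_curves" and l: "limitin mtopology s l sequentially" by auto
  then have sM: "\<And>n. s n \<in> M" by (simp add: const_curves_def)
  have lim: "l \<in> M" "\<And>z j k. (\<lambda>n. proj_entry j k (s n z)) \<longlonglongrightarrow> proj_entry j k (l z)"
    using limitin_M_iff[of s l, OF sM] l by auto
  have "l z = l 0" for z
  proof (rule proj_entry_inj)
    fix j k
    have "s n z = s n 0" for n using s[of n] by (auto simp: const_curves_def)
    then show "proj_entry j k (l z) = proj_entry j k (l 0)"
      using LIMSEQ_unique[OF lim(2)[of j k z]] lim(2)[of j k 0] by simp
  qed
  then have "l = (\<lambda>_. l 0)" by (rule ext)
  then show "l \<in> const_curves" using lim(1) unfolding const_curves_def by blast
qed

lemma continuous_map_proj_entry: "continuous_map mtopology euclidean (\<lambda>f. proj_entry j k (f z))"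
proof -
  have "continuous_map compact_open_topology euclidean (\<lambda>f :: complex \<Rightarrow> 'n cp. f z)"
    unfolding continuous_map_def
  proof (intro conjI allI impI)
    fix U :: "'n cp set" assume U: "openin euclidean U"
    have "{f \<in> topspace compact_open_topology. f z \<in> U} = {f. continuous_on UNIV f \<and> f ` {z} \<subseteq> U}"
      by (auto simp: topspace_compact_open)
    moreover have "openin compact_open_topology {f. continuous_on UNIV f \<and> f ` {z} \<subseteq> U}"
      unfolding compact_open_topology_def using U
      by (intro topology_generated_by_Basis CollectI exI[of _ "{z}"] exI[of _ U]) simp
    ultimately show "openin compact_open_topology {f \<in> topspace compact_open_topology. f z \<in> U}" by simp
  qed auto
  then have "continuous_map mtopology euclidean (\<lambda>f :: complex \<Rightarrow> 'n cp. f z)"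
    unfolding compatible brody_topology_def by (intro continuous_map_from_subtopology)
  then have "continuous_map mtopology euclidean (proj_entry j k \<circ> (\<lambda>f. f z))"
    by (rule continuous_map_compose) (use continuous_on_proj_entry in simp)
  then show ?thesis by (simp add: comp_def)
qed

text \<open>
  A constant curve is determined by its value at 0, that is, by the real and imaginary parts of the
  matrix entries of this value. They lie in $[-1,1]$ and are rescaled to the unit interval.
\<close>

lemma encodable_const_curves:
  obtains m where "\<And>\<epsilon> l. 0 < \<epsilon> \<Longrightarrow> encodable \<epsilon> l m const_curves"
proof -
  define \<rho> where "\<rho> j k f = (1 + Re (proj_entry j k (f 0))) / 2" for j k and f :: "complex \<Rightarrow> 'n cp"
  define \<iota> where "\<iota> j k f = (1 + Im (proj_entry j k (f 0))) / 2" for j k and f :: "complex \<Rightarrow> 'n cp"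
  define \<Psi> where "\<Psi> = (\<lambda>(j, k). \<rho> j k) ` UNIV \<union> (\<lambda>(j, k). \<iota> j k) ` UNIV"
  have mem: "\<rho> j k \<in> \<Psi>" "\<iota> j k \<in> \<Psi>" for j k by (auto simp: \<Psi>_def)
  have "continuous_on UNIV (\<lambda>w. (1 + Re w) / 2)" "continuous_on UNIV (\<lambda>w. (1 + Im w) / 2)"
    by (intro continuous_intros; simp)+
  then have "continuous_map mtopology euclideanreal (\<lambda>f. (1 + Re (proj_entry j k (f 0))) / 2)"
    "continuous_map mtopology euclideanreal (\<lambda>f. (1 + Im (proj_entry j k (f 0))) / 2)" for j k
    using continuous_map_compose[OF continuous_map_proj_entry, of euclideanreal "\<lambda>w. (1 + Re w) / 2" j k 0]
      continuous_map_compose[OF continuous_map_proj_entry, of euclideanreal "\<lambda>w. (1 + Im w) / 2" j k 0]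
    by (simp_all only: comp_def continuous_map_iff_continuous2)
  then have cont: "continuous_map mtopology euclideanreal \<psi>" if "\<psi> \<in> \<Psi>" for \<psi>
    using that by (auto simp: \<Psi>_def \<rho>_def[abs_def] \<iota>_def[abs_def])
  have "\<bar>Re (proj_entry j k p)\<bar> \<le> 1" "\<bar>Im (proj_entry j k p)\<bar> \<le> 1" for j k and p :: "'n cp"
    using abs_Re_le_cmod abs_Im_le_cmod norm_proj_entry_le order_trans by blast+
  then have range: "\<psi> ` M \<subseteq> {0..1}" if "\<psi> \<in> \<Psi>" for \<psi>
    using that by (auto simp: \<Psi>_def \<rho>_def \<iota>_def abs_le_iff) (smt (verit))+
  have sep: "f = g" if f: "f \<in> const_curves" and g: "g \<in> const_curves" and eq: "\<And>\<psi>. \<psi> \<in> \<Psi> \<Longrightarrow> \<psi> f = \<psi> g" for f g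
  proof -
    have "f 0 = g 0"
      by (rule proj_entry_inj) (use eq[OF mem(1)] eq[OF mem(2)] in \<open>simp add: \<rho>_def \<iota>_def complex_eq_iff\<close>)
    then show ?thesis using f g by (auto simp: const_curves_def)
  qed
  show thesis
  proof (rule that)
    fix \<epsilon> :: real and l assume "0 < \<epsilon>"
    then show "encodable \<epsilon> l (card \<Psi> + 1) const_curves"
      by (intro encodable_of_separating closedin_const_curves cont range sep) (auto simp: \<Psi>_def)
  qed
qed

text \<open>
  Otherwise curves in \<open>A\<close> with energy tending to 0 on the unit square would subconverge to a curve
  in \<open>A\<close> without energy there, that is, to a constant curve.
\<close>

lemma energy_bounded_below:
  assumes A: "closedin mtopology A" and disj: "A \<inter> const_curves = {}"
  obtains c where "0 < c" "\<And>f. f \<in> A \<Longrightarrow> c \<le> energy (unit_box 0) f"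
proof (rule ccontr)
  assume no: "\<not> thesis"
  have "\<exists>f\<in>A. energy (unit_box 0) f < inverse (real (Suc n))" for n
  proof (rule ccontr)
    assume "\<not> ?thesis"
    then show False using no that[of "inverse (real (Suc n))"] by (force simp: not_less)
  qed
  then obtain s where s: "\<And>n. s n \<in> A" "\<And>n. energy (unit_box 0) (s n) < inverse (real (Suc n))" by metis
  have AM: "A \<subseteq> M" using closedin_subset[OF A] by simp
  then have sM: "\<And>n. s n \<in> M" using s(1) by blast
  obtain f r where f: "f \<in> M" "strict_mono (r :: nat \<Rightarrow> nat)"
    "\<And>z j k. (\<lambda>n. proj_entry j k (s (r n) z)) \<longlonglongrightarrow> proj_entry j k (f z)"
    by (rule convergent_subsequence_in_M[of s, OF sM]) (rule that)
  have "limitin mtopology (\<lambda>n. s (r n)) f sequentially"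
    using limitin_M_iff[of "\<lambda>n. s (r n)" f] sM f by blast
  then have "f \<in> A" by (rule limitin_closedin[OF _ A]) (use s(1) in auto)
  then have "f \<noteq> (\<lambda>_. p)" for p using disj AM unfolding const_curves_def by blast
  then have pos: "0 < energy (unit_box 0) f" by (rule energy_unit_box_pos[OF M_holomorphic[OF f(1)]])
  have "(\<lambda>n. energy (unit_box 0) (s (r n))) \<longlonglongrightarrow> energy (unit_box 0) f"
    by (rule energy_limit) (use M_brody sM f(3) in auto)
  moreover have "(\<lambda>n. energy (unit_box 0) (s (r n))) \<longlonglongrightarrow> 0"
  proof (rule Lim_null_comparison)
    show "(\<lambda>n. inverse (real (Suc (r n)))) \<longlonglongrightarrow> 0"
      using LIMSEQ_subseq_LIMSEQ[OF LIMSEQ_inverse_real_of_nat f(2)] by (simp add: comp_def)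
    show "\<forall>\<^sub>F n in sequentially. norm (energy (unit_box 0) (s (r n))) \<le> inverse (real (Suc (r n)))"
      using s(2) by (intro always_eventually allI) (simp add: energy_nonneg less_imp_le)
  qed
  ultimately show False using pos LIMSEQ_unique by fastforce
qed

text \<open>
  Frequent visits would give \<open>g \<in> A\<close> that visits \<open>A\<close> frequently at all scales. At each visit
  the unit square carries energy at least \<open>c\<close>, so \<open>g\<close> has positive mean energy.
\<close>

lemma visits_negligible:
  assumes A: "closedin mtopology A" and const: "A \<inter> const_curves = {}"
    and energy: "\<And>f. f \<in> A \<Longrightarrow> \<not> mean_energy f > 0" and \<delta>: "0 < \<delta>"
  shows "\<exists>K>0. \<forall>x\<in>M. real (card (visits A K x)) \<le> \<delta> * (real K)\<^sup>2"
proof (rule ccontr)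
  assume no: "\<not> ?thesis"
  obtain g where g: "g \<in> A" "\<And>j. \<delta> * 4 ^ j \<le> real (card (nearby_visits A (2 ^ j) g))"
  proof (rule recurrent_point[OF A \<delta>])
    show "\<exists>x\<in>M. real (card (visits A K x)) > \<delta> * (real K)\<^sup>2" if "0 < K" for K
      using no that by (meson not_le)
  qed (rule that)
  have gM: "g \<in> M" using g(1) closedin_subset[OF A] by auto
  obtain c where c: "0 < c" "\<And>f. f \<in> A \<Longrightarrow> c \<le> energy (unit_box 0) f"
    by (rule energy_bounded_below[OF A const]) (rule that)
  have "0 < mean_energy g"
  proof (rule mean_energy_pos[OF M_holomorphic[OF gM] c(1) \<delta> _ g(2)])
    show "nearby_visits A (2 ^ j) g \<subseteq> {- int (2 ^ j)<..<int (2 ^ j)} \<times> {- int (2 ^ j)<..<int (2 ^ j)}" for j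
      by (auto simp: nearby_visits_def)
    fix j p q assume "(p, q) \<in> nearby_visits A (2 ^ j) g"
    then have "translate (Complex (of_int p) (of_int q)) g \<in> A" by (simp add: nearby_visits_def)
    from c(2)[OF this] show "c \<le> energy (unit_box (Complex (of_int p) (of_int q))) g"
      by (simp add: energy_translate M_holomorphic gM invariant)
  qed
  then show False using energy[OF g(1)] by blast
qed

lemma mean_dim_eq_0_if_finite_covering_dim:
  assumes dim: "covering_dim_le (subtopology brody_topology (brody_topology closure_of {f \<in> M. mean_energy f > 0})) n"
  shows "mean_dim translate M d = 0"
proof -
  define P where "P = brody_topology closure_of {f \<in> M. mean_energy f > 0}"
  have PM: "P \<subseteq> M" unfolding P_def by (rule closure_of_minimal[OF _ closed]) auto
  have sub: "{f \<in> M. mean_energy f > 0} \<subseteq> P"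
    unfolding P_def by (rule closure_of_subset) (use M_brody in \<open>auto simp: topspace_brody\<close>)
  have clP: "closedin mtopology P"
    unfolding compatible P_def by (rule closedin_subset_topspace) (use PM in \<open>auto simp: P_def\<close>)
  have "subtopology mtopology P = subtopology brody_topology P"
    unfolding compatible subtopology_subtopology using PM by (simp add: Int_absorb1)
  then have dimP: "covering_dim_le (subtopology mtopology P) n" using dim by (simp add: P_def)
  obtain m where m: "\<And>\<epsilon> l. 0 < \<epsilon> \<Longrightarrow> encodable \<epsilon> l m const_curves"
    by (rule encodable_const_curves) (rule that)
  show ?thesis
  proof (rule mean_dim_eq_0)
    show "closedin mtopology (P \<union> const_curves)" using clP closedin_const_curves by (rule closedin_Un)
    show "encodable \<epsilon> l (n + 1 + m) (P \<union> const_curves)" if "0 < \<epsilon>" for \<epsilon> l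
      by (rule encodable_Un[OF encodable_of_covering_dim[OF clP dimP that] m[OF that]])
    fix A \<delta> assume A: "closedin mtopology A" "A \<inter> (P \<union> const_curves) = {}" "0 < (\<delta> :: real)"
    have "A \<subseteq> M" using closedin_subset[OF A(1)] by simp
    then show "\<exists>K>0. \<forall>x\<in>M. real (card (visits A K x)) \<le> \<delta> * (real K)\<^sup>2"
      using A sub by (intro visits_negligible) blast+
  qed
qed

end

theorem corollary1p9:
  fixes M :: "(complex \<Rightarrow> 'n::finite cp) set"
    and d :: "(complex \<Rightarrow> 'n cp) \<Rightarrow> (complex \<Rightarrow> 'n cp) \<Rightarrow> real"
  assumes closed: "closedin brody_topology M"
    and invariant: "\<And>a f. f \<in> M \<Longrightarrow> translate a f \<in> M"
    and metric: "Metric_space M d"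
    and compatible: "Metric_space.mtopology M d = subtopology brody_topology M"
    and positive: "mean_dim translate M d > 0"
  defines "M_plus \<equiv> brody_topology closure_of {f \<in> M. mean_energy f > 0}"
  shows "infinite_covering_dim (subtopology brody_topology M_plus)"
  unfolding infinite_covering_dim_def
proof (intro allI notI)
  fix n assume "covering_dim_le (subtopology brody_topology M_plus) n"
  then have "mean_dim translate M d = 0"
    unfolding M_plus_def
    using mean_dim_eq_0_if_finite_covering_dim[of M d n] closed invariant metric compatible by blast
  then show False using positive by simp
qed

end
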